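(* Consider the minsum 1-sink problem on a path network $P$ with $n$ vertices and general (not necessarily uniform) edge capacities, as described in the context. There is an algorithm that finds a minsum 1-sink (a point $\mu$ of $P$ minimizing the total evacuation cost $\Phi$) in $O(n\log n)$ time.
   Context: A path network $P$ has vertices $v_1,\dots,v_n$ arranged left to right. Vertex $v_i$ has weight $w_i>0$, the number (amount, treated as a continuous fluid) of evacuees initially at $v_i$. Edge $e_i=(v_i,v_{i+1})$ has length $d_i>0$ and capacity $c_i>0$, the maximum flow rate (evacuees per unit time) through $e_i$. Every evacuee needs $\tau$ units of time to travel a unit distance. Given a sink location $x$ on $P$, all evacuees move along the path toward $x$; all start at time $0$; evacuees leave a vertex along the outgoing edge toward $x$ at a rate not exceeding that edge's capacity, waiting (queueing) at the vertex when the rate is exceeded. The cost $\Phi(x)$ is the sum over all evacuees of their arrival times at $x$ (the total evacuation time), under this continuous flow model in which the cost of a group of $\lambda$ evacuees leaving a vertex at constant rate $c$ and then needing further travel time $t_0$ is $\lambda t_0+\lambda^2/(2c)$. A minsum 1-sink is a point $\mu\in P$ minimizing $\Phi(x)$. The input consists of the $w_i$, $d_i$, $c_i$. *)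

theory Defs
  imports "HOL-Analysis.Analysis" "HOL-Library.Landau_Symbols"
begin

section \<open>Path networks\<close>

text \<open>Vertices are numbered \<open>1, \<dots>, n\<close>; edge \<open>i\<close> joins the vertices \<open>i\<close> and \<open>i + 1\<close>, for
  \<open>1 \<le> i < n\<close>. Values of the fields outside these ranges are irrelevant.\<close>

record path_network =
  num_vertices :: nat
  weight :: "nat \<Rightarrow> real"
  edge_len :: "nat \<Rightarrow> real"
  capacity :: "nat \<Rightarrow> real"
  tau :: real

definition path_network :: "path_network \<Rightarrow> bool" where
  "path_network P \<longleftrightarrow> 1 \<le> num_vertices P \<and> 0 < tau P
     \<and> (\<forall>i. 1 \<le> i \<and> i \<le> num_vertices P \<longrightarrow> 0 < weight P i)
     \<and> (\<forall>i. 1 \<le> i \<and> i < num_vertices P \<longrightarrow> 0 < edge_len P i \<and> 0 < capacity P i)"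

text \<open>A point of \<open>P\<close> (a vertex or a point inside an edge) is given by its distance from vertex 1.\<close>

definition pos :: "path_network \<Rightarrow> nat \<Rightarrow> real" where
  "pos P i = (\<Sum>j = 1..<i. edge_len P j)"

definition points :: "path_network \<Rightarrow> real set" where
  "points P = {0..pos P (num_vertices P)}"

text \<open>The same network read from right to left.\<close>

definition reversed :: "path_network \<Rightarrow> path_network" where
  "reversed P = P\<lparr>weight := (\<lambda>i. weight P (num_vertices P + 1 - i)),
                  edge_len := (\<lambda>i. edge_len P (num_vertices P - i)),
                  capacity := (\<lambda>i. capacity P (num_vertices P - i))\<rparr>"


section \<open>The fluid model of evacuation\<close>

text \<open>\<open>A t\<close> is the amount of evacuees that have reached a vertex up to time \<open>t\<close> (including those
  initially there), \<open>D t\<close> the amount that have left it along an outgoing edge of capacity \<open>c\<close>;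
  \<open>A t - D t\<close> is the queue. The last clause says that evacuees wait only because the edge is
  saturated: as long as the queue is nonempty, they leave at rate exactly \<open>c\<close>.\<close>

definition discharges :: "real \<Rightarrow> (real \<Rightarrow> real) \<Rightarrow> (real \<Rightarrow> real) \<Rightarrow> bool" where
  "discharges c A D \<longleftrightarrow>
     (\<forall>t\<le>0. D t = 0)
   \<and> (\<forall>s t. 0 \<le> s \<and> s \<le> t \<longrightarrow> 0 \<le> D t - D s \<and> D t - D s \<le> c * (t - s))
   \<and> (\<forall>t\<ge>0. D t \<le> A t)
   \<and> (\<forall>s t. 0 \<le> s \<and> s \<le> t \<and> (\<forall>u\<in>{s..t}. D u < A u) \<longrightarrow> D t - D s = c * (t - s))"

text \<open>Existence and uniqueness are proved below.\<close>

definition departures :: "real \<Rightarrow> (real \<Rightarrow> real) \<Rightarrow> real \<Rightarrow> real" where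
  "departures c A = (THE D. discharges c A D)"

text \<open>\<open>outflow P i t\<close> is the amount that has left vertex \<open>i\<close> along edge \<open>i\<close> up to time \<open>t\<close> when
  everybody moves to the right. Nothing flows into vertex 1, hence the value at 0.\<close>

primrec outflow :: "path_network \<Rightarrow> nat \<Rightarrow> real \<Rightarrow> real" where
  "outflow P 0 = (\<lambda>t. 0)"
| "outflow P (Suc i) = departures (capacity P (Suc i))
     (\<lambda>t. weight P (Suc i) + outflow P i (t - tau P * edge_len P i))"

text \<open>If \<open>F t\<close> is the amount that has arrived up to time \<open>t\<close>, then the evacuees can be indexed by
  \<open>q\<close> in the order of their arrival; evacuee \<open>q\<close> arrives at time \<open>arrival_time F q\<close>.\<close>

definition arrival_time :: "(real \<Rightarrow> real) \<Rightarrow> real \<Rightarrow> real" where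
  "arrival_time F q = Inf {t. 0 \<le> t \<and> q \<le> F t}"

text \<open>The last vertex strictly to the left of \<open>x\<close>, or 0 if there is none.\<close>

definition last_left :: "path_network \<Rightarrow> real \<Rightarrow> nat" where
  "last_left P x = Max (insert 0 {i \<in> {1..num_vertices P}. pos P i < x})"

definition left_cost :: "path_network \<Rightarrow> real \<Rightarrow> real" where
  "left_cost P x = (let k = last_left P x in
     integral {0..\<Sum>i = 1..k. weight P i}
       (arrival_time (\<lambda>t. outflow P k (t - tau P * (x - pos P k)))))"

text \<open>Evacuees initially at \<open>x\<close> itself arrive at time 0 and contribute nothing.\<close>

definition evac_cost :: "path_network \<Rightarrow> real \<Rightarrow> real" where
  "evac_cost P x = left_cost P x + left_cost (reversed P) (pos P (num_vertices P) - x)"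

definition minsum_sink :: "path_network \<Rightarrow> real \<Rightarrow> bool" where
  "minsum_sink P \<mu> \<longleftrightarrow> \<mu> \<in> points P \<and> (\<forall>x\<in>points P. evac_cost P \<mu> \<le> evac_cost P x)"


subsection \<open>The fluid model is well defined\<close>

lemma discharges_le:
  assumes D: "discharges c A D" and E: "discharges c A E" and t: "0 \<le> t"
  shows "D t \<le> E t"
proof (rule ccontr)
  assume "\<not> D t \<le> E t"
  hence gt: "E t < D t" by simp
  define S where "S = {u. 0 \<le> u \<and> u \<le> t \<and> D u \<le> E u}"
  have D0: "D 0 = 0" and E0: "E 0 = 0" using D E by (auto simp: discharges_def)
  have S0: "0 \<in> S" using D0 E0 t by (simp add: S_def)
  have bdd: "bdd_above S" by (auto simp: S_def)
  define s where "s = Sup S"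
  have s0: "0 \<le> s" unfolding s_def by (rule cSup_upper[OF S0 bdd])
  have st: "s \<le> t" unfolding s_def by (rule cSup_least) (use S0 in \<open>auto simp: S_def\<close>)
  have lip: "0 \<le> X v - X u \<and> X v - X u \<le> c * (v - u)"
    if "0 \<le> u" "u \<le> v" "discharges c A X" for u v X
    using that by (auto simp: discharges_def)
  have c0: "0 \<le> c" using lip[of 0 1 D] D by simp
  have drop: "D t - E t \<le> D u - E u" if u: "s < u" "u \<le> t" for u
  proof -
    have "E v < A v" if v: "v \<in> {u..t}" for v
    proof -
      have "v \<notin> S" using cSup_upper[OF _ bdd, of v] v u by (auto simp: s_def)
      hence "E v < D v" using v u s0 by (auto simp: S_def)
      moreover have "D v \<le> A v" using D v u s0 by (auto simp: discharges_def)
      ultimately show ?thesis by simp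
    qed
    hence "E t - E u = c * (t - u)" using E u s0 by (auto simp: discharges_def)
    moreover have "D t - D u \<le> c * (t - u)" using lip[of u t D] D u s0 by auto
    ultimately show ?thesis by simp
  qed
  define \<epsilon> where "\<epsilon> = D t - E t"
  have eps: "0 < \<epsilon>" using gt by (simp add: \<epsilon>_def)
  define \<delta> where "\<delta> = \<epsilon> / (4 * (c + 1))"
  have del: "0 < \<delta>" using eps c0 by (simp add: \<delta>_def)
  have cdel: "c * \<delta> \<le> \<epsilon> / 4" using eps c0 by (simp add: \<delta>_def field_simps)
  obtain v where v: "v \<in> S" "s - \<delta> < v"
    using less_cSup_iff[OF _ bdd, of "s - \<delta>"] S0 del by (auto simp: s_def)
  have vs: "v \<le> s" unfolding s_def by (rule cSup_upper[OF v(1) bdd])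
  have v0: "0 \<le> v" and vt: "v \<le> t" and DEv: "D v \<le> E v" using v(1) by (auto simp: S_def)
  have "v \<noteq> t" using DEv gt by auto
  have "\<exists>u. v \<le> u \<and> u \<le> v + 2 * \<delta> \<and> u \<le> t \<and> \<epsilon> \<le> D u - E u"
  proof (cases "s = t")
    case True
    thus ?thesis using v vs vt del by (intro exI[of _ t]) (auto simp: \<epsilon>_def)
  next
    case False
    hence "s < min t (s + \<delta>)" using st del by auto
    thus ?thesis using drop[of "min t (s + \<delta>)"] v vs vt
      by (intro exI[of _ "min t (s + \<delta>)"]) (auto simp: \<epsilon>_def)
  qed
  then obtain u where u: "v \<le> u" "u \<le> v + 2 * \<delta>" "\<epsilon> \<le> D u - E u" by blast
  have "D u - D v \<le> c * (u - v)" and "0 \<le> E u - E v"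
    using lip[of v u] D E v0 u by auto
  moreover have "c * (u - v) \<le> c * (2 * \<delta>)" using u c0 by (intro mult_left_mono) auto
  ultimately show False using DEv u cdel eps by (auto simp: algebra_simps)
qed

lemma discharges_unique:
  assumes "discharges c A D" "discharges c A E"
  shows "D = E"
proof
  fix t
  show "D t = E t"
  proof (cases "0 \<le> t")
    case True
    thus ?thesis using discharges_le assms by (metis order_antisym)
  next
    case False
    thus ?thesis using assms by (auto simp: discharges_def)
  qed
qed

lemma departures_eq: "discharges c A D \<Longrightarrow> departures c A = D"
  unfolding departures_def by (rule the_equality) (auto intro: discharges_unique)

lemma discharges_exists:
  assumes c: "0 \<le> c" and A0: "0 \<le> A 0"
    and mono: "\<And>s t. 0 \<le> s \<Longrightarrow> s \<le> t \<Longrightarrow> A s \<le> A t"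
    and cont: "continuous_on {0..} A"
  shows "\<exists>D. discharges c A D"
proof -
  define G where "G = (\<lambda>t. (\<lambda>s. A s + c * (t - s)) ` {0..t})"
  define D where "D = (\<lambda>t::real. if t \<le> 0 then 0 else min (c * t) (Inf (G t)))"
  have Apos: "0 \<le> A s" if "0 \<le> s" for s using mono[of 0 s] A0 that by simp
  have Gpos: "0 \<le> y" if "y \<in> G t" for y t
  proof -
    from that obtain s where s: "0 \<le> s" "s \<le> t" "y = A s + c * (t - s)" by (auto simp: G_def)
    have "0 \<le> c * (t - s)" using s c by simp
    thus ?thesis using s Apos[of s] by simp
  qed
  have bdd: "bdd_below (G t)" for t by (rule bdd_belowI[of _ 0]) (rule Gpos)
  have D_if: "D t = min (c * t) (Inf (G t))" if "0 \<le> t" for t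
    using that A0 by (cases "t = 0") (auto simp: D_def G_def)
  have D_le: "D t \<le> A s + c * (t - s)" if "0 \<le> s" "s \<le> t" for s t
  proof -
    have "Inf (G t) \<le> A s + c * (t - s)"
      by (rule cInf_lower[OF _ bdd]) (use that in \<open>auto simp: G_def\<close>)
    thus ?thesis using D_if[of t] that by auto
  qed
  have D_ct: "D t \<le> c * t" if "0 \<le> t" for t using D_if[OF that] by simp
  have D_ge: "y \<le> D t"
    if "0 \<le> t" "y \<le> c * t" "\<And>s. 0 \<le> s \<Longrightarrow> s \<le> t \<Longrightarrow> y \<le> A s + c * (t - s)" for y t
  proof -
    have "y \<le> Inf (G t)"
      by (rule cInf_greatest) (use that in \<open>auto simp: G_def\<close>)
    thus ?thesis using D_if[of t] that by auto
  qed
  have lip: "D t \<le> D s + c * (t - s)" if st: "0 \<le> s" "s \<le> t" for s t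
  proof -
    have "D t - c * (t - s) \<le> D s"
    proof (rule D_ge)
      show "D t - c * (t - s) \<le> c * s" using D_ct[of t] st by (simp add: algebra_simps)
      show "D t - c * (t - s) \<le> A u + c * (s - u)" if "0 \<le> u" "u \<le> s" for u
        using D_le[of u t] that st by (simp add: algebra_simps)
    qed (use st in auto)
    thus ?thesis by simp
  qed
  have incr: "D s \<le> D t" if st: "0 \<le> s" "s \<le> t" for s t
  proof (rule D_ge)
    show "D s \<le> c * t" using D_ct[of s] st c mult_left_mono[of s t c] by linarith
    show "D s \<le> A u + c * (t - u)" if u: "0 \<le> u" "u \<le> t" for u
    proof (cases "u \<le> s")
      case True
      thus ?thesis using D_le[of u s] u c st mult_left_mono[of "s - u" "t - u" c] by auto
    next
      case False
      hence "D s \<le> A s" "A s \<le> A u" using D_le[of s s] mono[of s u] st by auto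
      moreover have "0 \<le> c * (t - u)" using u c by simp
      ultimately show ?thesis by linarith
    qed
  qed (use st in auto)
  have busy: "D t - D s = c * (t - s)"
    if st: "0 \<le> s" "s \<le> t" and q: "\<And>u. u \<in> {s..t} \<Longrightarrow> D u < A u" for s t
  proof -
    have "D s + c * (t - s) \<le> D t"
    proof (rule ccontr)
      assume less: "\<not> ?thesis"
      have "continuous_on {0..t} (\<lambda>u. A u + c * (t - u))"
        by (intro continuous_intros continuous_on_subset[OF cont]) auto
      then obtain v where v: "v \<in> {0..t}" "\<And>u. u \<in> {0..t} \<Longrightarrow> A v + c * (t - v) \<le> A u + c * (t - u)"
        using continuous_attains_inf[of "{0..t}" "\<lambda>u. A u + c * (t - u)"] st
        by (metis atLeastAtMost_iff compact_Icc empty_iff order_trans order_refl)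
      have "D t \<ge> min (c * t) (A v + c * (t - v))"
      proof (rule D_ge)
        show "min (c * t) (A v + c * (t - v)) \<le> A u + c * (t - u)" if "0 \<le> u" "u \<le> t" for u
          using v(2)[of u] that by (simp add: min_le_iff_disj)
      qed (use st in simp_all)
      moreover have "D s + c * (t - s) \<le> c * t" using D_ct[of s] st by (simp add: algebra_simps)
      ultimately have Dt: "A v + c * (t - v) \<le> D t" using less by linarith
      show False
      proof (cases "v \<le> s")
        case True
        hence "D s \<le> A v + c * (s - v)" using D_le[of v s] v(1) by simp
        thus False using Dt less by (simp add: algebra_simps)
      next
        case False
        hence "D v < A v" using q[of v] v(1) by simp
        moreover have "D t \<le> D v + c * (t - v)" using lip[of v t] v(1) by simp
        ultimately show False using Dt by linarith
      qed
    qed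
    thus ?thesis using lip[OF st] by linarith
  qed
  have "discharges c A D"
    unfolding discharges_def
  proof (intro conjI allI impI)
    show "D t = 0" if "t \<le> 0" for t using that by (simp add: D_def)
    show "D t \<le> A t" if "0 \<le> t" for t using D_le[of t t] that by simp
    fix s t :: real
    show "0 \<le> D t - D s" "D t - D s \<le> c * (t - s)" if "0 \<le> s \<and> s \<le> t"
      using that incr[of s t] lip[of s t] by auto
    show "D t - D s = c * (t - s)" if "0 \<le> s \<and> s \<le> t \<and> (\<forall>u\<in>{s..t}. D u < A u)"
      using that busy[of s t] by auto
  qed
  thus ?thesis by (intro exI[of _ D])
qed

lemma discharges_mono_cont:
  assumes "discharges c A D"
  shows "s \<le> t \<Longrightarrow> D s \<le> D t" and "continuous_on UNIV D"
proof -
  have z: "D t = 0" if "t \<le> 0" for t using assms that by (auto simp: discharges_def)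
  have l: "D s \<le> D t \<and> D t - D s \<le> c * (t - s)" if "0 \<le> s" "s \<le> t" for s t
    using assms that by (auto simp: discharges_def)
  have c: "0 \<le> c" using l[of 0 1] by auto
  have gl: "D s \<le> D t \<and> D t - D s \<le> c * (t - s)" if "s \<le> t" for s t
  proof -
    have "D (max 0 s) = D s" "D (max 0 t) = D t" using z[of s] z[of t] z[of 0] by (auto simp: max_def)
    moreover have "c * (max 0 t - max 0 s) \<le> c * (t - s)" using c that by (intro mult_left_mono) auto
    moreover have "D (max 0 s) \<le> D (max 0 t) \<and> D (max 0 t) - D (max 0 s) \<le> c * (max 0 t - max 0 s)"
      using that by (intro l) auto
    ultimately show ?thesis by linarith
  qed
  show "s \<le> t \<Longrightarrow> D s \<le> D t" using gl by blast
  have "c-lipschitz_on UNIV D"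
  proof (rule lipschitz_onI[OF _ c])
    fix s t
    show "dist (D s) (D t) \<le> c * dist s t"
      using gl[of s t] gl[of t s] by (cases "s \<le> t") (auto simp: dist_real_def abs_if)
  qed
  thus "continuous_on UNIV D" by (rule lipschitz_on_continuous_on)
qed

lemma outflow_discharges:
  assumes P: "path_network P" and i: "Suc i < num_vertices P"
  shows "discharges (capacity P (Suc i))
    (\<lambda>t. weight P (Suc i) + outflow P i (t - tau P * edge_len P i)) (outflow P (Suc i))"
  using i
proof (induction i)
  case 0
  hence c: "0 \<le> capacity P (Suc 0)" and w: "0 \<le> weight P (Suc 0)"
    using P by (auto simp: path_network_def intro: less_imp_le)
  obtain D where "discharges (capacity P (Suc 0)) (\<lambda>t. weight P (Suc 0) + 0) D"
    using discharges_exists[OF c, of "\<lambda>t. weight P (Suc 0) + 0"] w by auto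
  moreover from this have "departures (capacity P (Suc 0)) (\<lambda>t. weight P (Suc 0) + 0) = D"
    by (rule departures_eq)
  ultimately show ?case by simp
next
  case (Suc i)
  let ?A = "\<lambda>t. weight P (Suc (Suc i)) + outflow P (Suc i) (t - tau P * edge_len P (Suc i))"
  have IH: "discharges (capacity P (Suc i))
    (\<lambda>t. weight P (Suc i) + outflow P i (t - tau P * edge_len P i)) (outflow P (Suc i))"
    using Suc by simp
  have c: "0 \<le> capacity P (Suc (Suc i))" and w: "0 \<le> weight P (Suc (Suc i))"
    and l: "0 \<le> tau P * edge_len P (Suc i)"
    using P Suc.prems by (auto simp: path_network_def less_imp_le)
  have "outflow P (Suc i) (0 - tau P * edge_len P (Suc i)) = 0"
    using IH l unfolding discharges_def by (simp del: outflow.simps)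
  hence A0: "0 \<le> ?A 0" using w by simp
  have "continuous_on {0..} ?A"
    by (intro continuous_intros continuous_on_compose2[OF discharges_mono_cont(2)[OF IH]]) auto
  then obtain D where "discharges (capacity P (Suc (Suc i))) ?A D"
    using discharges_exists[of _ ?A, OF c A0] discharges_mono_cont(1)[OF IH] by auto
  moreover from this have "departures (capacity P (Suc (Suc i))) ?A = D"
    by (rule departures_eq)
  moreover have "outflow P (Suc (Suc i)) = departures (capacity P (Suc (Suc i))) ?A"
    by (rule outflow.simps(2))
  ultimately show ?case by (simp only:)
qed

text \<open>Sanity check: a group of \<open>l\<close> evacuees that leaves at rate \<open>c\<close> and then travels for time \<open>t0\<close>
  has cost \<open>l * t0 + l\<^sup>2 / (2 * c)\<close>.\<close>

lemma group_cost:
  assumes c: "0 < c" and l: "0 < l" and t0: "0 \<le> t0"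
  shows "integral {0..l} (arrival_time (\<lambda>t. departures c (\<lambda>_. l) (t - t0))) = l * t0 + l\<^sup>2 / (2 * c)"
proof -
  have "discharges c (\<lambda>_. l) (\<lambda>t. if t \<le> 0 then 0 else min l (c * t))"
    unfolding discharges_def
  proof (intro conjI allI impI)
    fix s t :: real
    let ?D = "\<lambda>t. if t \<le> 0 then 0 else min l (c * t)"
    have D: "?D u = min l (c * u)" if "0 \<le> u" for u using that l by auto
    show "?D t = 0" if "t \<le> 0" using that by simp
    show "?D t \<le> l" if "0 \<le> t" using l by auto
    show "0 \<le> ?D t - ?D s" if st: "0 \<le> s \<and> s \<le> t"
    proof -
      have "c * s \<le> c * t" using st c by simp
      thus ?thesis using D[of s] D[of t] st by linarith
    qed
    show "?D t - ?D s \<le> c * (t - s)" if st: "0 \<le> s \<and> s \<le> t"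
    proof -
      have "0 \<le> c * (t - s)" using st c by simp
      thus ?thesis using D[of s] D[of t] st by (auto simp: min_def algebra_simps)
    qed
    show "?D t - ?D s = c * (t - s)" if st: "0 \<le> s \<and> s \<le> t \<and> (\<forall>u\<in>{s..t}. ?D u < l)"
    proof -
      have "?D s < l" "?D t < l" using st by auto
      thus ?thesis using D[of s] D[of t] st by (auto simp: min_def algebra_simps split: if_splits)
    qed
  qed
  hence dep: "departures c (\<lambda>_. l) = (\<lambda>t. if t \<le> 0 then 0 else min l (c * t))"
    by (rule departures_eq)
  have at: "arrival_time (\<lambda>t. departures c (\<lambda>_. l) (t - t0)) q = t0 + q / c"
    if q: "q \<in> {0..l} - {0}" for q
  proof -
    have "{t. 0 \<le> t \<and> q \<le> departures c (\<lambda>_. l) (t - t0)} = {t0 + q / c..}" (is "?S = ?T")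
    proof (rule set_eqI)
      fix t
      have "0 < q / c" using q c by simp
      moreover have "q \<le> c * (t - t0) \<longleftrightarrow> t0 + q / c \<le> t" using c by (auto simp: field_simps)
      ultimately show "t \<in> ?S \<longleftrightarrow> t \<in> ?T" using q t0 by (auto simp: dep)
    qed
    thus ?thesis by (simp add: arrival_time_def)
  qed
  have "((\<lambda>q. t0 + q / c) has_integral (l * t0 + l\<^sup>2 / (2 * c)) - (0 * t0 + 0\<^sup>2 / (2 * c))) {0..l}"
    using l c
    by (intro fundamental_theorem_of_calculus)
       (auto intro!: derivative_eq_intros simp: has_real_derivative_iff_has_vector_derivative[symmetric]
          field_simps power2_eq_square)
  hence "((\<lambda>q. t0 + q / c) has_integral (l * t0 + l\<^sup>2 / (2 * c))) {0..l}" by simp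
  moreover have "integral {0..l} (arrival_time (\<lambda>t. departures c (\<lambda>_. l) (t - t0)))
      = integral {0..l} (\<lambda>q. t0 + q / c)"
    by (rule integral_spike[of "{0}"]) (use at in auto)
  ultimately show ?thesis by (simp add: integral_unique)
qed


section \<open>Real RAM programs\<close>

text \<open>A unit-cost real RAM, programmed in a while language. The memory consists of registers and
  arrays (with unbounded address space) for natural numbers, which serve as addresses and counters,
  and for exact real numbers. On natural numbers there are only addition and truncated subtraction,
  and there is no conversion from real to natural numbers; this rules out the well-known abuses of
  unit-cost arithmetic. The only constants are natural numbers, so that no information can be
  encoded in a real constant. A program is a finite object that is independent of \<open>n\<close>. Division by
  zero yields zero.\<close>

datatype nexp =
    NConst nat
  | NVar string
  | NRead string nexp
  | NAdd nexp nexp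
  | NSub nexp nexp

datatype rexp =
    OfNat nexp
  | RVar string
  | RRead string nexp
  | RAdd rexp rexp
  | RSub rexp rexp
  | RMul rexp rexp
  | RDiv rexp rexp

datatype bexp =
    NLess nexp nexp
  | RLess rexp rexp
  | Not bexp
  | And bexp bexp

datatype com =
    Skip
  | NAssign string nexp
  | RAssign string rexp
  | NWrite string nexp nexp
  | RWrite string nexp rexp
  | Seq com com
  | If bexp com com
  | While bexp com

record state =
  nvar :: "string \<Rightarrow> nat"
  rvar :: "string \<Rightarrow> real"
  narr :: "string \<Rightarrow> nat \<Rightarrow> nat"
  rarr :: "string \<Rightarrow> nat \<Rightarrow> real"

primrec nval :: "state \<Rightarrow> nexp \<Rightarrow> nat" where
  "nval s (NConst k) = k"
| "nval s (NVar x) = nvar s x"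
| "nval s (NRead a e) = narr s a (nval s e)"
| "nval s (NAdd e f) = nval s e + nval s f"
| "nval s (NSub e f) = nval s e - nval s f"

primrec rval :: "state \<Rightarrow> rexp \<Rightarrow> real" where
  "rval s (OfNat e) = real (nval s e)"
| "rval s (RVar x) = rvar s x"
| "rval s (RRead a e) = rarr s a (nval s e)"
| "rval s (RAdd e f) = rval s e + rval s f"
| "rval s (RSub e f) = rval s e - rval s f"
| "rval s (RMul e f) = rval s e * rval s f"
| "rval s (RDiv e f) = rval s e / rval s f"

primrec bval :: "state \<Rightarrow> bexp \<Rightarrow> bool" where
  "bval s (NLess e f) \<longleftrightarrow> nval s e < nval s f"
| "bval s (RLess e f) \<longleftrightarrow> rval s e < rval s f"
| "bval s (Not b) \<longleftrightarrow> \<not> bval s b"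
| "bval s (And b b') \<longleftrightarrow> bval s b \<and> bval s b'"

text \<open>Evaluating an expression takes one step per memory access, constant and operation in it.\<close>

primrec ncost :: "nexp \<Rightarrow> nat" where
  "ncost (NConst k) = 1"
| "ncost (NVar x) = 1"
| "ncost (NRead a e) = 1 + ncost e"
| "ncost (NAdd e f) = 1 + ncost e + ncost f"
| "ncost (NSub e f) = 1 + ncost e + ncost f"

primrec rcost :: "rexp \<Rightarrow> nat" where
  "rcost (OfNat e) = 1 + ncost e"
| "rcost (RVar x) = 1"
| "rcost (RRead a e) = 1 + ncost e"
| "rcost (RAdd e f) = 1 + rcost e + rcost f"
| "rcost (RSub e f) = 1 + rcost e + rcost f"
| "rcost (RMul e f) = 1 + rcost e + rcost f"
| "rcost (RDiv e f) = 1 + rcost e + rcost f"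

primrec bcost :: "bexp \<Rightarrow> nat" where
  "bcost (NLess e f) = 1 + ncost e + ncost f"
| "bcost (RLess e f) = 1 + rcost e + rcost f"
| "bcost (Not b) = 1 + bcost b"
| "bcost (And b b') = 1 + bcost b + bcost b'"

text \<open>\<open>run p s t s'\<close>: started in state \<open>s\<close>, program \<open>p\<close> halts in state \<open>s'\<close> after \<open>t\<close> steps.\<close>

inductive run :: "com \<Rightarrow> state \<Rightarrow> nat \<Rightarrow> state \<Rightarrow> bool" where
  run_Skip: "run Skip s 1 s"
| run_NAssign: "run (NAssign x e) s (1 + ncost e) (s\<lparr>nvar := (nvar s)(x := nval s e)\<rparr>)"
| run_RAssign: "run (RAssign x e) s (1 + rcost e) (s\<lparr>rvar := (rvar s)(x := rval s e)\<rparr>)"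
| run_NWrite: "run (NWrite a i e) s (1 + ncost i + ncost e)
    (s\<lparr>narr := (narr s)(a := (narr s a)(nval s i := nval s e))\<rparr>)"
| run_RWrite: "run (RWrite a i e) s (1 + ncost i + rcost e)
    (s\<lparr>rarr := (rarr s)(a := (rarr s a)(nval s i := rval s e))\<rparr>)"
| run_Seq: "run p s t s' \<Longrightarrow> run q s' t' s'' \<Longrightarrow> run (Seq p q) s (t + t') s''"
| run_IfT: "bval s b \<Longrightarrow> run p s t s' \<Longrightarrow> run (If b p q) s (1 + bcost b + t) s'"
| run_IfF: "\<not> bval s b \<Longrightarrow> run q s t s' \<Longrightarrow> run (If b p q) s (1 + bcost b + t) s'"
| run_WhileF: "\<not> bval s b \<Longrightarrow> run (While b p) s (1 + bcost b) s"
| run_WhileT: "bval s b \<Longrightarrow> run p s t s' \<Longrightarrow> run (While b p) s' t' s'' \<Longrightarrow>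
    run (While b p) s (1 + bcost b + t + t') s''"

inductive_cases run_SkipE: "run Skip s t s'"
inductive_cases run_NAssignE: "run (NAssign x e) s t s'"
inductive_cases run_RAssignE: "run (RAssign x e) s t s'"
inductive_cases run_NWriteE: "run (NWrite a i e) s t s'"
inductive_cases run_RWriteE: "run (RWrite a i e) s t s'"
inductive_cases run_SeqE: "run (Seq p q) s t s'"
inductive_cases run_IfE: "run (If b p q) s t s'"
inductive_cases run_WhileE: "run (While b p) s t s'"

lemma run_deterministic: "run p s t s' \<Longrightarrow> run p s u s'' \<Longrightarrow> t = u \<and> s' = s''"
proof (induction arbitrary: u s'' rule: run.induct)
  case (run_Seq p s t s' q t' s2)
  from run_Seq.prems obtain t1 t2 r where
    "u = t1 + t2" "run p s t1 r" "run q r t2 s''" by (rule run_SeqE)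
  thus ?case using run_Seq.IH(1)[of t1 r] run_Seq.IH(2)[of t2 s''] by simp
next
  case (run_IfT s b p t s' q)
  from run_IfT.prems run_IfT.hyps(1) obtain t1 where
    "u = 1 + bcost b + t1" "run p s t1 s''" by (elim run_IfE; simp)
  thus ?case using run_IfT.IH[of t1 s''] by simp
next
  case (run_IfF s b q t s' p)
  from run_IfF.prems run_IfF.hyps(1) obtain t1 where
    "u = 1 + bcost b + t1" "run q s t1 s''" by (elim run_IfE; simp)
  thus ?case using run_IfF.IH[of t1 s''] by simp
next
  case (run_WhileF s b p)
  from run_WhileF.prems show ?case by (rule run_WhileE) (use run_WhileF.hyps in auto)
next
  case (run_WhileT s b p t s' t' s2)
  from run_WhileT.prems show ?case
  proof (rule run_WhileE)
    fix t1 r t2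
    assume "u = Suc (bcost b + t1 + t2)" "run p s t1 r" "run (While b p) r t2 s''"
    thus ?case using run_WhileT.IH(1)[of t1 r] run_WhileT.IH(2)[of t2 s''] by simp
  qed (use run_WhileT.hyps in simp)
qed ((erule run_SkipE run_NAssignE run_RAssignE run_NWriteE run_RWriteE; simp)+)

text \<open>The input is \<open>n\<close>, \<open>\<tau>\<close> and the \<open>w\<^sub>i\<close>, \<open>d\<^sub>i\<close>, \<open>c\<^sub>i\<close>; all other memory cells are 0.\<close>

definition input_state :: "path_network \<Rightarrow> state" where
  "input_state P =
     \<lparr>nvar = (\<lambda>_. 0)(''n'' := num_vertices P),
      rvar = (\<lambda>_. 0)(''tau'' := tau P),
      narr = (\<lambda>_ _. 0),
      rarr = (\<lambda>_ _. 0)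
        (''w'' := (\<lambda>i. if 1 \<le> i \<and> i \<le> num_vertices P then weight P i else 0),
         ''d'' := (\<lambda>i. if 1 \<le> i \<and> i < num_vertices P then edge_len P i else 0),
         ''c'' := (\<lambda>i. if 1 \<le> i \<and> i < num_vertices P then capacity P i else 0))\<rparr>"

end

theory Submission
  imports Defs "HOL-Real_Asymp.Real_Asymp"
begin

text \<open>The fluid model has a closed form: the amount that has left vertex \<open>k\<close> up to time \<open>t\<close> is the
  minimum over \<open>j \<le> k\<close> of \<open>W\<^sub>k - W\<^sub>j + r\<^sub>j\<^sub>k * max 0 (t - \<tau> * (x\<^sub>k - x\<^sub>j))\<close>, where \<open>W\<^sub>j\<close> is the weight of the
  first \<open>j\<close> vertices and \<open>r\<^sub>j\<^sub>k\<close> the least capacity of the edges \<open>j, \<dots>, k\<close>. Hence the evacuee with the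
  amount \<open>p\<close> to its left leaves vertex \<open>k\<close> at time \<open>\<tau> * x\<^sub>k + g\<^sub>k p\<close>, where \<open>g\<^sub>k p\<close> is the maximum of
  \<open>(W\<^sub>j - p) / r\<^sub>j\<^sub>k - \<tau> * x\<^sub>j\<close> over all \<open>j\<close> with \<open>p \<le> W\<^sub>j\<close>: an upper envelope of rays that end in
  the points \<open>(W\<^sub>j, - \<tau> * x\<^sub>j)\<close>. The cost is affine between vertices and does not exceed its one-sided
  limits at vertices, so an optimal vertex is an optimal sink, and it suffices to know the area below
  \<open>g\<^sub>k\<close> for all \<open>k\<close>.

  The envelope is a list of pieces with nondecreasing rates. Passing from \<open>k\<close> to \<open>k + 1\<close> adds one piece
  and replaces all rates above the new capacity by the latter. Pieces of equal rate are kept in groups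
  on a stack, so that only the last group changes, and its area is determined by the sum of the
  squared lengths of its pieces. Two neighbours in a group merge as soon as the rate drops to
  a threshold that is fixed by their end points; the largest threshold is found in a
  tournament tree. The last group may further cut or absorb pieces of the group before it. Every
  operation but the cut, which occurs once per step, removes a piece or a group, so there are \<open>O(n)\<close>
  tree operations of cost \<open>O(log n)\<close>. The program runs this on the network and on its reversal.\<close>

section \<open>Closed form of the fluid model\<close>

text \<open>The obstacle is that one small capacity changes the rates of arbitrarily many pieces at
  once and makes many of them vanish in an order that is hard to predict. Capping the rates,
  however, acts on the envelope alone: the new envelope is the old one together with all lines of
  slope \<open>1 / c\<close> drawn to the left from its points. So a piece that was once discarded
  never comes back. A single tree serves all groups: neighbours of equal rate are kept strictly
  separated, so the thresholds inside a group on the stack lie strictly below its rate and hence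
  below the current capacity; a leaf that reaches the capacity must belong to the last group. Only
  the link between the last group and the stack has no threshold and is tested directly. A cut makes
  the two rays meet exactly at the common end, where equality is allowed because the rates differ,
  so nothing remains to be done at this link in the same step.\<close>

text \<open>Ray \<open>i\<close> ends in the point \<open>(b i, y i)\<close> and rises to the left with slope \<open>1 / m i\<close>.\<close>

definition ray :: "(nat \<Rightarrow> real) \<Rightarrow> (nat \<Rightarrow> real) \<Rightarrow> (nat \<Rightarrow> real) \<Rightarrow> nat \<Rightarrow> real \<Rightarrow> real" where
  "ray b y m i p = y i + (b i - p) / m i"

definition envelope ::
  "nat set \<Rightarrow> (nat \<Rightarrow> real) \<Rightarrow> (nat \<Rightarrow> real) \<Rightarrow> (nat \<Rightarrow> real) \<Rightarrow> real \<Rightarrow> real" where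
  "envelope S b y m p = Max ((\<lambda>i. ray b y m i p) ` {i \<in> S. p \<le> b i})"

text \<open>Starting from 0 makes the rate of the fictitious vertex 0 equal to 0. Its curve is then
  the constant total weight, which expresses that no more can leave than there is.\<close>

primrec rate :: "(nat \<Rightarrow> real) \<Rightarrow> nat \<Rightarrow> nat \<Rightarrow> real" where
  "rate c j 0 = 0"
| "rate c j (Suc k) = (if j = Suc k then c j else min (rate c j k) (c (Suc k)))"

lemma rate_0: "(\<And>i. 1 \<le> i \<Longrightarrow> i \<le> k \<Longrightarrow> 0 < c i) \<Longrightarrow> rate c 0 k = 0"
proof (induction k)
  case (Suc k)
  have "rate c 0 k = 0" by (rule Suc.IH) (use Suc.prems in auto)
  moreover have "0 < c (Suc k)" using Suc.prems by auto
  ultimately show ?case by simp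
qed simp

lemma rate_pos:
  "(\<And>i. 1 \<le> i \<Longrightarrow> i \<le> k \<Longrightarrow> 0 < c i) \<Longrightarrow> 1 \<le> j \<Longrightarrow> j \<le> k \<Longrightarrow> 0 < rate c j k"
proof (induction k)
  case (Suc k)
  show ?case
  proof (cases "j = Suc k")
    case False
    hence "0 < rate c j k" by (intro Suc.IH) (use Suc.prems in auto)
    moreover have "0 < c (Suc k)" using Suc.prems by auto
    ultimately show ?thesis using False by simp
  qed (use Suc.prems in simp)
qed simp

lemma rate_le: "1 \<le> k \<Longrightarrow> rate c j k \<le> c k"
  by (cases k) auto

definition total_weight :: "path_network \<Rightarrow> nat \<Rightarrow> real" where
  "total_weight P k = (\<Sum>i = 1..k. weight P i)"

definition offset :: "path_network \<Rightarrow> nat \<Rightarrow> real" where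
  "offset P k = tau P * pos P k"

lemma total_weight_Suc: "total_weight P (Suc k) = total_weight P k + weight P (Suc k)"
  by (simp add: total_weight_def)

lemma total_weight_0 [simp]: "total_weight P 0 = 0"
  by (simp add: total_weight_def)

lemma pos_Suc: "1 \<le> k \<Longrightarrow> pos P (Suc k) = pos P k + edge_len P k"
  by (simp add: pos_def)

lemma pos_1 [simp]: "pos P (Suc 0) = 0"
  by (simp add: pos_def)

lemma offset_Suc: "1 \<le> k \<Longrightarrow> offset P (Suc k) = offset P k + tau P * edge_len P k"
  by (simp add: offset_def pos_Suc algebra_simps)

lemma total_weight_strict:
  assumes "path_network P" "i < j" "j \<le> num_vertices P"
  shows "total_weight P i < total_weight P j"
  using assms(2,3)
proof (induction j)
  case (Suc j)
  have "0 < weight P (Suc j)" using assms(1) Suc.prems by (simp add: path_network_def)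
  thus ?case using Suc by (cases "i = j") (auto simp: total_weight_Suc)
qed simp

lemma pos_strict:
  assumes "path_network P" "1 \<le> i" "i < j" "j \<le> num_vertices P"
  shows "pos P i < pos P j"
  using assms(3,4)
proof (induction j)
  case (Suc j)
  have "0 < edge_len P j" using assms Suc.prems by (simp add: path_network_def)
  thus ?case using Suc assms(2) by (cases "i = j") (auto simp: pos_Suc)
qed simp

lemma pos_mono:
  assumes "path_network P" "1 \<le> i" "i \<le> j" "j \<le> num_vertices P"
  shows "pos P i \<le> pos P j"
  using pos_strict[OF assms(1,2)] assms by (cases "i = j") (auto simp: less_imp_le)

text \<open>An upper bound on the outflow of vertex \<open>k\<close>: the evacuees from the vertices
  after \<open>j\<close> contribute at most their number, and all others pass the bottleneck of the
  edges \<open>j, ..., k\<close> and cannot leave vertex \<open>k\<close> before the travel time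
  from \<open>j\<close> has passed.\<close>

definition delay_curve :: "path_network \<Rightarrow> nat \<Rightarrow> nat \<Rightarrow> real \<Rightarrow> real" where
  "delay_curve P k j t = total_weight P k - total_weight P j
     + rate (capacity P) j k * max 0 (t - (offset P k - offset P j))"

definition min_curve :: "path_network \<Rightarrow> nat \<Rightarrow> real \<Rightarrow> real" where
  "min_curve P k t = Min ((\<lambda>j. delay_curve P k j t) ` {0..k})"

lemma min_curve_le: "j \<le> k \<Longrightarrow> min_curve P k t \<le> delay_curve P k j t"
  unfolding min_curve_def by (intro Min_le) auto

lemma min_curve_ex: "\<exists>j\<le>k. min_curve P k t = delay_curve P k j t"
proof -
  have "min_curve P k t \<in> (\<lambda>j. delay_curve P k j t) ` {0..k}"
    unfolding min_curve_def by (intro Min_in) auto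
  thus ?thesis by auto
qed

lemma le_min_curve: "(\<And>j. j \<le> k \<Longrightarrow> q \<le> delay_curve P k j t) \<Longrightarrow> q \<le> min_curve P k t"
  using min_curve_ex[of k P t] by auto

text \<open>The induction step of the closed form: a new edge caps all slopes at its capacity and
  adds one curve. The hard clause is that a nonempty queue discharges at full rate. It holds because
  a curve that attains the minimum while \<open>D < A\<close> must be one whose slope is
  \<open>c\<close>, already on its rising part.\<close>

lemma min_curve_discharges:
  assumes P: "path_network P" and k: "Suc k < num_vertices P"
  shows "discharges (capacity P (Suc k))
    (\<lambda>t. weight P (Suc k) + min_curve P k (t - tau P * edge_len P k)) (min_curve P (Suc k))"
proof -
  define c where "c = capacity P (Suc k)"
  define A where "A = (\<lambda>t. weight P (Suc k) + min_curve P k (t - tau P * edge_len P k))"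
  let ?K = "Suc k"
  let ?D = "min_curve P ?K"
  let ?h = "delay_curve P ?K"
  let ?r = "rate (capacity P)"
  have cpos: "0 < capacity P i" if "1 \<le> i" "i \<le> ?K" for i
    using P k that by (auto simp: path_network_def)
  have c0: "0 < c" using cpos[of ?K] by (simp add: c_def)
  have r0: "?r 0 l = 0" if "l \<le> ?K" for l by (rule rate_0) (use cpos that in auto)
  have rpos: "0 \<le> ?r j l" if "j \<le> l" "l \<le> ?K" for j l
    using rate_pos[of l "capacity P" j] r0[of l] cpos that by (cases "j = 0") (auto intro: less_imp_le)
  have rle: "?r j ?K \<le> c" for j using rate_le[of ?K] by (simp add: c_def)
  \<comment> \<open>The curves of the arrivals at vertex \<open>Suc k\<close>: same delays as for
    the outflow, but rates not yet capped by the new edge.\<close>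
  define hA where "hA = (\<lambda>j t. total_weight P ?K - total_weight P j
     + ?r j k * max 0 (t - (offset P ?K - offset P j)))"
  have hA: "weight P ?K + delay_curve P k j (t - tau P * edge_len P k) = hA j t" if "j \<le> k" for j t
  proof (cases "k = 0")
    \<comment> \<open>Here \<open>edge_len P 0\<close> occurs in the shift of time although
      \<open>offset\<close> ignores it; the only curve is that of vertex 0, which has rate 0 and
      does not notice the shift.\<close>
    case True
    thus ?thesis using that by (simp add: delay_curve_def hA_def total_weight_def)
  next
    case False
    thus ?thesis by (simp add: delay_curve_def hA_def total_weight_Suc offset_Suc algebra_simps)
  qed
  have Ale: "A t \<le> hA j t" if "j \<le> k" for j t
    using hA[OF that, of t] min_curve_le[OF that, of P "t - tau P * edge_len P k"] by (simp add: A_def)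
  have Aex: "\<exists>j\<le>k. A t = hA j t" for t
    using hA min_curve_ex[of k P "t - tau P * edge_len P k"] by (fastforce simp: A_def)
  have hhA: "?h j t \<le> hA j t" if "j \<le> k" for j t
    using that by (auto simp: delay_curve_def hA_def intro!: mult_right_mono)
  have hincr: "?h j s \<le> ?h j t" if "j \<le> ?K" "s \<le> t" for j s t
    using rpos[of j ?K] that by (auto simp: delay_curve_def simp del: rate.simps intro!: mult_left_mono)
  have hlip: "?h j t \<le> ?h j s + c * (t - s)" if "j \<le> ?K" "s \<le> t" for j s t
  proof -
    let ?T = "offset P ?K - offset P j"
    have "?r j ?K * (max 0 (t - ?T) - max 0 (s - ?T)) \<le> c * (t - s)"
      by (rule mult_mono) (use rle c0 rpos[of j ?K] that in auto)
    thus ?thesis by (simp add: delay_curve_def right_diff_distrib del: rate.simps)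
  qed
  have Dlip: "?D t \<le> ?D s + c * (t - s)" if "s \<le> t" for s t
    using min_curve_ex[of ?K P s] min_curve_le[of _ ?K P t] hlip that by (metis order_trans)
  have Dincr: "?D s \<le> ?D t" if "s \<le> t" for s t
    by (rule le_min_curve) (use min_curve_le[of _ ?K P s] hincr that in \<open>blast intro: order_trans\<close>)
  have "discharges c A ?D"
    unfolding discharges_def
  proof (intro conjI allI impI)
    fix t :: real assume t: "t \<le> 0"
    have "?D t \<le> ?h ?K t" by (rule min_curve_le) simp
    also have "?h ?K t = 0" using t by (simp add: delay_curve_def)
    finally have "?D t \<le> 0" .
    moreover have "0 \<le> ?D t"
    proof (rule le_min_curve)
      fix j assume j: "j \<le> ?K"
      have "total_weight P j \<le> total_weight P ?K"
        using total_weight_strict[OF P, of j ?K] j k by (cases "j = ?K") auto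
      thus "0 \<le> ?h j t" using rpos[OF j] by (simp add: delay_curve_def del: rate.simps)
    qed
    ultimately show "?D t = 0" by simp
  next
    fix s t :: real
    show "0 \<le> ?D t - ?D s" if "0 \<le> s \<and> s \<le> t" using Dincr that by auto
    show "?D t - ?D s \<le> c * (t - s)" if "0 \<le> s \<and> s \<le> t" using Dlip[of s t] that by auto
    show "?D t \<le> A t"
      using Aex[of t] hhA min_curve_le[of _ ?K P t] by (metis le_SucI order_trans)
    assume st: "0 \<le> s \<and> s \<le> t \<and> (\<forall>u\<in>{s..t}. ?D u < A u)"
    obtain j where j: "j \<le> ?K" "?D t = ?h j t" using min_curve_ex by blast
    let ?T = "offset P ?K - offset P j"
    have "?D t < A t" using st by auto
    \<comment> \<open>If the cap did not lower the rate of curve \<open>j\<close>, or if its delay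
      had not passed at time \<open>t\<close>, then \<open>?h j t = hA j t\<close>, which is at
      least \<open>A t\<close>, contradicting \<open>?D t < A t\<close>.\<close>
    have slope: "?r j ?K = c \<and> (s \<ge> ?T \<or> j \<le> k \<and> t > ?T)"
    proof (cases "j = ?K")
      case True
      thus ?thesis using st by (simp add: c_def)
    next
      case False
      hence jk: "j \<le> k" using j by simp
      have less: "?h j t < hA j t" using Ale[OF jk, of t] \<open>?D t < A t\<close> j by simp
      hence "t > ?T"
        using False by (cases "t > ?T") (auto simp: delay_curve_def hA_def)
      moreover have "\<not> ?r j k \<le> c"
        using less False by (auto simp: delay_curve_def hA_def c_def)
      ultimately show ?thesis using False jk by (auto simp: c_def)
    qed
    \<comment> \<open>Were curve \<open>j\<close> still flat at time \<open>s\<close>, then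
      \<open>?D\<close> would be strictly below it at time \<open>?T\<close>. As \<open>?D\<close>
      rises at rate at most \<open>c\<close>, the gap would persist until \<open>t\<close>, where
      the two agree.\<close>
    have "s \<ge> ?T"
    proof (rule ccontr)
      assume n: "\<not> s \<ge> ?T"
      hence jk: "j \<le> k" and tT: "t > ?T" using slope by auto
      have "?D ?T < A ?T" using st n tT by auto
      also have "\<dots> \<le> hA j ?T" by (rule Ale[OF jk])
      also have "\<dots> = ?h j ?T" by (simp add: hA_def delay_curve_def)
      finally have "?D t < ?h j ?T + c * (t - ?T)" using Dlip[of ?T t] tT by linarith
      also have "\<dots> = ?h j t" using slope tT by (simp add: delay_curve_def del: rate.simps)
      finally show False using j by simp
    qed
    hence "?h j t = ?h j s + c * (t - s)"
      using slope st by (simp add: delay_curve_def right_diff_distrib del: rate.simps)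
    moreover have "?D s \<le> ?h j s" by (rule min_curve_le[OF j(1)])
    ultimately show "?D t - ?D s = c * (t - s)" using j(2) Dlip[of s t] st by linarith
  qed
  thus ?thesis by (simp add: c_def A_def)
qed

lemma outflow_eq_min_curve:
  assumes P: "path_network P"
  shows "k < num_vertices P \<Longrightarrow> outflow P k = min_curve P k"
proof (induction k)
  case 0
  show ?case by (rule ext) (simp add: min_curve_def delay_curve_def)
next
  case (Suc k)
  hence "outflow P k = min_curve P k" by simp
  thus ?case using departures_eq[OF min_curve_discharges[OF P Suc.prems]] by simp
qed

section \<open>The cost of a sink\<close>

text \<open>The departure time from vertex \<open>k\<close> without the travel time
  \<open>offset P k\<close>. In this form the end points of the rays stay fixed as \<open>k\<close>
  grows, and only the rates change.\<close>

definition residual :: "path_network \<Rightarrow> nat \<Rightarrow> real \<Rightarrow> real" where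
  "residual P k = envelope {1..k} (total_weight P) (\<lambda>j. - offset P j) (\<lambda>j. rate (capacity P) j k)"

lemma envelope_ge:
  "finite S \<Longrightarrow> i \<in> S \<Longrightarrow> p \<le> b i \<Longrightarrow> ray b y m i p \<le> envelope S b y m p"
  unfolding envelope_def by (intro Max_ge) auto

lemma envelope_attained:
  assumes "finite S" "i \<in> S" "p \<le> b i"
  shows "\<exists>j\<in>S. p \<le> b j \<and> envelope S b y m p = ray b y m j p"
proof -
  have "envelope S b y m p \<in> (\<lambda>i. ray b y m i p) ` {i \<in> S. p \<le> b i}"
    unfolding envelope_def by (intro Max_in) (use assms in auto)
  thus ?thesis by auto
qed

lemma envelope_antimono:
  assumes "finite S" "i \<in> S" "q \<le> b i" "p \<le> q" "\<And>j. j \<in> S \<Longrightarrow> 0 < m j"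
  shows "envelope S b y m q \<le> envelope S b y m p"
proof -
  obtain j where j: "j \<in> S" "q \<le> b j" "envelope S b y m q = ray b y m j q"
    using envelope_attained[of S i q b y m] assms by blast
  have "ray b y m j q \<le> ray b y m j p"
    using assms(4) assms(5)[OF j(1)] by (simp add: ray_def divide_right_mono)
  also have "\<dots> \<le> envelope S b y m p"
    using envelope_ge[of S j p b y m] assms j by simp
  finally show ?thesis using j(3) by simp
qed

lemma envelope_integrable:
  assumes "finite S" "i \<in> S" "B \<le> b i" "\<And>j. j \<in> S \<Longrightarrow> 0 < m j"
  shows "envelope S b y m integrable_on {A..B}"
proof -
  have "mono_on {A..B} (\<lambda>p. - envelope S b y m p)"
    by (rule mono_onI) (use envelope_antimono[OF assms(1,2)] assms in auto)
  hence "(\<lambda>p. - envelope S b y m p) integrable_on {A..B}" by (rule integrable_on_mono_on)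
  thus ?thesis by (simp add: integrable_neg_iff)
qed

section \<open>Arrival times and the cost of the evacuees on one side\<close>

context
  fixes P :: path_network
  assumes P: "path_network P"
begin

lemma rate_capacity_pos: "1 \<le> j \<Longrightarrow> j \<le> k \<Longrightarrow> k < num_vertices P \<Longrightarrow> 0 < rate (capacity P) j k"
  by (rule rate_pos) (use P in \<open>auto simp: path_network_def\<close>)

lemma rate_capacity_0: "k < num_vertices P \<Longrightarrow> rate (capacity P) 0 k = 0"
  by (rule rate_0) (use P in \<open>auto simp: path_network_def\<close>)

lemma total_weight_pos: "1 \<le> k \<Longrightarrow> k \<le> num_vertices P \<Longrightarrow> 0 < total_weight P k"
  using total_weight_strict[OF P, of 0 k] by simp

text \<open>The inverse of a minimum of increasing curves is the maximum of their inverses. At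
  \<open>p = total_weight P j\<close> curve \<open>j\<close> already meets the demand on its flat
  part, so its inverse jumps there; these finitely many values are excluded.\<close>

lemma arrival_time_outflow:
  assumes k: "1 \<le> k" "k < num_vertices P" and a: "0 \<le> a"
    and p: "0 \<le> p" "p < total_weight P k" "p \<notin> total_weight P ` {1..k}"
  shows "arrival_time (\<lambda>t. outflow P k (t - a)) (total_weight P k - p) = a + offset P k + residual P k p"
proof -
  let ?W = "total_weight P" and ?r = "\<lambda>j. rate (capacity P) j k"
  define \<theta> where "\<theta> = a + offset P k + residual P k p"
  have res_le: "residual P k p \<le> z \<longleftrightarrow> (\<forall>j\<in>{1..k}. p \<le> ?W j \<longrightarrow> - offset P j + (?W j - p) / ?r j \<le> z)" for z
    unfolding residual_def envelope_def ray_def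
    by (subst Max_le_iff) (use k p in auto)
  have curve: "?W k - p \<le> delay_curve P k j (t - a) \<longleftrightarrow>
      (p \<le> ?W j \<longrightarrow> - offset P j + (?W j - p) / ?r j \<le> t - a - offset P k)"
    if j: "j \<in> {1..k}" for j t
  proof -
    have r: "0 < ?r j" using rate_capacity_pos[of j k] j k by auto
    have ne: "p \<noteq> ?W j" using p j by auto
    show ?thesis
    proof (cases "p \<le> ?W j")
      case True
      define z where "z = t - a - (offset P k - offset P j)"
      have "?W k - p \<le> delay_curve P k j (t - a) \<longleftrightarrow> ?W j - p \<le> ?r j * max 0 z"
        by (auto simp: delay_curve_def z_def)
      \<comment> \<open>For negative \<open>z\<close> both sides fail: the left one because
        \<open>?W j - p\<close> is positive, which is where \<open>p \<noteq> ?W j\<close> is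
        used.\<close>
      also have "\<dots> \<longleftrightarrow> ?W j - p \<le> ?r j * z"
      proof (cases "0 \<le> z")
        case False
        moreover have "?r j * z < 0" using False r by (simp add: mult_pos_neg)
        ultimately show ?thesis using ne True by auto
      qed simp
      also have "\<dots> \<longleftrightarrow> (?W j - p) / ?r j \<le> z" using r by (simp add: field_simps)
      finally show ?thesis using True by (auto simp: z_def)
    next
      case False
      moreover have "0 \<le> ?r j * max 0 (t - a - (offset P k - offset P j))" using r by simp
      ultimately show ?thesis by (simp add: delay_curve_def)
    qed
  qed
  have "?W k - p \<le> outflow P k (t - a) \<longleftrightarrow> \<theta> \<le> t" for t
  proof -
    have "?W k - p \<le> outflow P k (t - a) \<longleftrightarrow> (\<forall>j\<in>{0..k}. ?W k - p \<le> delay_curve P k j (t - a))"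
      unfolding outflow_eq_min_curve[OF P k(2)] min_curve_def by (subst Min_ge_iff) auto
    also have "\<dots> \<longleftrightarrow> (\<forall>j\<in>{1..k}. ?W k - p \<le> delay_curve P k j (t - a))"
    proof -
      have "?W k - p \<le> delay_curve P k 0 (t - a)"
        using p rate_capacity_0[OF k(2)] by (simp add: delay_curve_def)
      moreover have "j = 0 \<or> j \<in> {1..k}" if "j \<in> {0..k}" for j using that by auto
      ultimately show ?thesis by fastforce
    qed
    also have "\<dots> \<longleftrightarrow> residual P k p \<le> t - a - offset P k"
      unfolding res_le using curve by blast
    finally show ?thesis by (simp add: \<theta>_def algebra_simps)
  qed
  moreover have "0 \<le> \<theta>"
  proof -
    have "- offset P k + (?W k - p) / ?r k \<le> residual P k p"
      using res_le[of "residual P k p"] k p by auto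
    moreover have "0 \<le> (?W k - p) / ?r k" using rate_capacity_pos[of k k] k p by simp
    ultimately show ?thesis using a by (simp add: \<theta>_def)
  qed
  ultimately have "{t. 0 \<le> t \<and> ?W k - p \<le> outflow P k (t - a)} = {\<theta>..}" by auto
  thus ?thesis by (simp add: arrival_time_def \<theta>_def)
qed

lemma residual_integrable:
  assumes "1 \<le> k" "k < num_vertices P" "B \<le> total_weight P k"
  shows "residual P k integrable_on {A..B}"
  unfolding residual_def
  by (rule envelope_integrable[of _ k]) (use assms rate_capacity_pos in auto)

definition residual_area :: "nat \<Rightarrow> real" where
  "residual_area k = integral {0..total_weight P k} (residual P k)"

lemma residual_area_0: "residual_area 0 = 0"
  by (simp add: residual_area_def)

text \<open>Arrivals are counted from the right, \<open>residual\<close> from the left, hence the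
  reflection and the shift of the integral. The excluded points form a finite set and do not change
  it.\<close>

lemma integral_arrival_time_outflow:
  assumes k: "1 \<le> k" "k < num_vertices P" and a: "0 \<le> a"
  shows "integral {0..total_weight P k} (arrival_time (\<lambda>t. outflow P k (t - a)))
    = (a + offset P k) * total_weight P k + residual_area k"
proof -
  let ?W = "total_weight P k"
  have W: "0 \<le> ?W" using total_weight_pos[of k] k by simp
  have "((\<lambda>p. (a + offset P k) + residual P k p) has_integral
      (a + offset P k) * ?W + residual_area k) {0..?W}"
    unfolding residual_area_def
    using has_integral_add[OF has_integral_const_real[of "a + offset P k" 0 ?W]
        integrable_integral[OF residual_integrable[OF k order_refl, of 0]]] W
    by (simp add: mult.commute)
  hence "((\<lambda>p. (a + offset P k) + residual P k (- p)) has_integral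
      (a + offset P k) * ?W + residual_area k) {- ?W..0}"
    using has_integral_reflect_real[of "\<lambda>p. (a + offset P k) + residual P k p" _ ?W 0] by simp
  hence "((\<lambda>q. (a + offset P k) + residual P k (?W - q)) has_integral
      (a + offset P k) * ?W + residual_area k) {0..?W}"
    using has_integral_shift_real_ivl[of "\<lambda>p. (a + offset P k) + residual P k (- p)" _ "- ?W" 0 "- ?W"]
    by simp
  moreover have "arrival_time (\<lambda>t. outflow P k (t - a)) q = (a + offset P k) + residual P k (?W - q)"
    if "q \<in> {0..?W} - insert 0 ((\<lambda>j. ?W - total_weight P j) ` {1..k})" for q
  proof -
    have "?W - q \<noteq> total_weight P j" if "j \<in> {1..k}" for j
    proof
      assume "?W - q = total_weight P j"
      hence "q = ?W - total_weight P j" by simp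
      thus False using that \<open>q \<in> _\<close> by blast
    qed
    hence "?W - q \<notin> total_weight P ` {1..k}" by blast
    thus ?thesis using arrival_time_outflow[OF k a, of "?W - q"] that by simp
  qed
  moreover have "finite (insert 0 ((\<lambda>j. ?W - total_weight P j) ` {1..k}))" by simp
  ultimately have "(arrival_time (\<lambda>t. outflow P k (t - a)) has_integral
      (a + offset P k) * ?W + residual_area k) {0..?W}"
    by (metis (no_types, lifting) has_integral_spike_finite)
  thus ?thesis by (rule integral_unique)
qed

lemma last_left_eq:
  assumes "1 \<le> k" "k < num_vertices P" "pos P k < x" "x \<le> pos P (Suc k)"
  shows "last_left P x = k"
  unfolding last_left_def
proof (rule Max_eqI)
  fix i assume i: "i \<in> insert 0 {i \<in> {1..num_vertices P}. pos P i < x}"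
  show "i \<le> k"
  proof (rule ccontr)
    assume "\<not> i \<le> k"
    hence "pos P (Suc k) \<le> pos P i" using i by (intro pos_mono[OF P]) auto
    thus False using i \<open>\<not> i \<le> k\<close> assms by auto
  qed
qed (use assms in auto)

lemma left_cost_eq:
  assumes k: "1 \<le> k" "k < num_vertices P" "pos P k < x" "x \<le> pos P (Suc k)"
  shows "left_cost P x = tau P * x * total_weight P k + residual_area k"
proof -
  have "0 \<le> tau P * (x - pos P k)" using P k by (simp add: path_network_def)
  from integral_arrival_time_outflow[OF k(1,2) this] show ?thesis
    unfolding left_cost_def Let_def last_left_eq[OF k] total_weight_def[symmetric]
    by (simp add: offset_def algebra_simps)
qed

lemma left_cost_0: "left_cost P 0 = 0"
proof -
  have "0 \<le> pos P i" if "1 \<le> i" "i \<le> num_vertices P" for i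
    using pos_mono[OF P, of 1 i] that by simp
  hence "{i \<in> {1..num_vertices P}. pos P i < 0} = {}" by force
  hence "last_left P 0 = 0" unfolding last_left_def by (simp only: Max_singleton)
  thus ?thesis by (simp add: left_cost_def)
qed

text \<open>Lower rates only make the rays steeper, and a new ray can only raise the
  maximum.\<close>

lemma residual_Suc:
  assumes k: "1 \<le> k" "Suc k < num_vertices P" and p: "p \<le> total_weight P k"
  shows "residual P k p \<le> residual P (Suc k) p"
proof -
  obtain j where j: "j \<in> {1..k}" "p \<le> total_weight P j"
    "residual P k p = ray (total_weight P) (\<lambda>j. - offset P j) (\<lambda>j. rate (capacity P) j k) j p"
    using envelope_attained[of "{1..k}" k p "total_weight P"] k p unfolding residual_def
    by (metis atLeastAtMost_iff finite_atLeastAtMost order_refl)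
  have "(total_weight P j - p) / rate (capacity P) j k \<le> (total_weight P j - p) / rate (capacity P) j (Suc k)"
    using rate_capacity_pos[of j "Suc k"] k j by (intro divide_left_mono) auto
  hence "residual P k p \<le> ray (total_weight P) (\<lambda>j. - offset P j) (\<lambda>j. rate (capacity P) j (Suc k)) j p"
    unfolding j(3) by (simp add: ray_def del: rate.simps)
  also have "\<dots> \<le> residual P (Suc k) p"
    unfolding residual_def by (rule envelope_ge) (use j in auto)
  finally show ?thesis .
qed

text \<open>Compares \<open>left_cost\<close> at vertex \<open>Suc k\<close> with its limit from the
  right, where the evacuees of that vertex begin to count. On the old range the curve has not become
  lower; on the new range it lies above the end point of the new ray.\<close>

lemma residual_area_Suc:
  assumes k: "Suc k < num_vertices P"
  shows "residual_area k - offset P (Suc k) * weight P (Suc k) \<le> residual_area (Suc k)"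
proof -
  let ?W = "total_weight P" and ?f = "residual P (Suc k)"
  have Wk: "0 \<le> ?W k" "?W k \<le> ?W (Suc k)"
    using total_weight_pos[of k] total_weight_strict[OF P, of k "Suc k"] k by (cases "k = 0"; simp)+
  have int: "?f integrable_on {A..B}" if "B \<le> ?W (Suc k)" for A B
    by (rule residual_integrable) (use k that in auto)
  have "residual_area (Suc k) = integral {0..?W k} ?f + integral {?W k..?W (Suc k)} ?f"
    unfolding residual_area_def by (rule Henstock_Kurzweil_Integration.integral_combine[symmetric])
       (use Wk int in auto)
  moreover have "residual_area k \<le> integral {0..?W k} ?f"
  proof (cases "k = 0")
    case False
    thus ?thesis unfolding residual_area_def
      by (intro integral_le residual_integrable int) (use k Wk residual_Suc in auto)
  qed (simp add: residual_area_def)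
  moreover have "- offset P (Suc k) * weight P (Suc k) \<le> integral {?W k..?W (Suc k)} ?f"
  proof -
    have "integral {?W k..?W (Suc k)} (\<lambda>_. - offset P (Suc k)) \<le> integral {?W k..?W (Suc k)} ?f"
    proof (intro integral_le int)
      fix p assume p: "p \<in> {?W k..?W (Suc k)}"
      have "- offset P (Suc k) \<le> ray ?W (\<lambda>j. - offset P j) (\<lambda>j. rate (capacity P) j (Suc k)) (Suc k) p"
        using p rate_capacity_pos[of "Suc k" "Suc k"] k by (simp add: ray_def)
      also have "\<dots> \<le> ?f p" unfolding residual_def by (rule envelope_ge) (use p in auto)
      finally show "- offset P (Suc k) \<le> ?f p" .
    qed auto
    thus ?thesis using Wk by (simp add: total_weight_Suc mult.commute)
  qed
  ultimately show ?thesis by simp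
qed

text \<open>On an edge the left cost is affine and attains its value at the right end. At the left
  end it may jump, because the evacuees of vertex \<open>k\<close> must move only if the sink lies
  strictly to its right.\<close>

lemma left_cost_edge:
  assumes k: "1 \<le> k" "k < num_vertices P" and x: "pos P k < x" "x < pos P (Suc k)"
  shows "left_cost P (pos P (Suc k)) = left_cost P x + tau P * total_weight P k * (pos P (Suc k) - x)"
    and "left_cost P (pos P k) \<le> left_cost P x - tau P * total_weight P k * (x - pos P k)"
proof -
  have eq: "left_cost P x = tau P * x * total_weight P k + residual_area k"
    by (rule left_cost_eq) (use assms in auto)
  have "left_cost P (pos P (Suc k)) = tau P * pos P (Suc k) * total_weight P k + residual_area k"
    by (rule left_cost_eq) (use assms in auto)
  thus "left_cost P (pos P (Suc k)) = left_cost P x + tau P * total_weight P k * (pos P (Suc k) - x)"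
    unfolding eq by (simp add: algebra_simps)
  have "left_cost P (pos P k) \<le> tau P * pos P k * total_weight P k + residual_area k"
  proof (cases "k = 1")
    case True
    thus ?thesis using left_cost_0 residual_area_Suc[of 0] k by (simp add: residual_area_0 offset_def)
  next
    case False
    then obtain l where l: "k = Suc l" "1 \<le> l" using k by (cases k) auto
    have "left_cost P (pos P k) = tau P * pos P k * total_weight P l + residual_area l"
      unfolding l(1) by (rule left_cost_eq) (use k l pos_strict[OF P, of l "Suc l"] in auto)
    thus ?thesis using residual_area_Suc[of l] k l by (simp add: total_weight_Suc offset_def algebra_simps)
  qed
  thus "left_cost P (pos P k) \<le> left_cost P x - tau P * total_weight P k * (x - pos P k)"
    unfolding eq by (simp add: algebra_simps)
qed

section \<open>The reversed network and optimality of a vertex\<close>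

lemma path_network_reversed: "path_network (reversed P)"
  unfolding path_network_def
proof (intro conjI allI impI)
  fix i assume "1 \<le> i \<and> i \<le> num_vertices (reversed P)"
  hence "1 \<le> num_vertices P + 1 - i" "num_vertices P + 1 - i \<le> num_vertices P" by (auto simp: reversed_def)
  thus "0 < weight (reversed P) i" using P by (simp add: path_network_def reversed_def)
qed (use P in \<open>auto simp: path_network_def reversed_def\<close>)

lemma pos_reversed:
  "1 \<le> i \<Longrightarrow> i \<le> num_vertices P \<Longrightarrow>
    pos (reversed P) i = pos P (num_vertices P) - pos P (num_vertices P + 1 - i)"
proof (induction i)
  case (Suc i)
  show ?case
  proof (cases "i = 0")
    case False
    have "pos P (num_vertices P + 1 - i) = pos P (num_vertices P - i) + edge_len P (num_vertices P - i)"
      using pos_Suc[of "num_vertices P - i" P] Suc.prems by (simp add: Suc_diff_le)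
    moreover have "edge_len (reversed P) i = edge_len P (num_vertices P - i)" by (simp add: reversed_def)
    ultimately show ?thesis using Suc False by (simp add: pos_Suc)
  qed (simp add: reversed_def)
qed simp

lemma num_vertices_reversed [simp]: "num_vertices (reversed P) = num_vertices P"
  by (simp add: reversed_def)

lemma tau_reversed [simp]: "tau (reversed P) = tau P"
  by (simp add: reversed_def)

end

definition vertex_cost :: "path_network \<Rightarrow> nat \<Rightarrow> real" where
  "vertex_cost P i = left_cost P (pos P i)
     + left_cost (reversed P) (pos (reversed P) (num_vertices P + 1 - i))"

lemma evac_cost_vertex:
  assumes "path_network P" "1 \<le> i" "i \<le> num_vertices P"
  shows "evac_cost P (pos P i) = vertex_cost P i"
  using pos_reversed[OF assms(1), of "num_vertices P + 1 - i"] assms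
  by (simp add: evac_cost_def vertex_cost_def)

text \<open>Between two vertices the cost is affine, and at a vertex it does not exceed the one-sided limits.\<close>

lemma evac_cost_ge_vertex:
  assumes P: "path_network P" and x: "x \<in> points P"
  shows "\<exists>i. 1 \<le> i \<and> i \<le> num_vertices P \<and> evac_cost P (pos P i) \<le> evac_cost P x"
proof -
  let ?n = "num_vertices P" and ?Q = "reversed P"
  have n: "1 \<le> ?n" using P by (simp add: path_network_def)
  define k where "k = Max {i \<in> {1..?n}. pos P i \<le> x}"
  have fin: "finite {i \<in> {1..?n}. pos P i \<le> x}" by simp
  have "1 \<in> {i \<in> {1..?n}. pos P i \<le> x}" using x n by (simp add: points_def)
  hence "k \<in> {i \<in> {1..?n}. pos P i \<le> x}" unfolding k_def by (intro Max_in) auto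
  hence k: "1 \<le> k" "k \<le> ?n" "pos P k \<le> x" by auto
  show ?thesis
  proof (cases "pos P k = x")
    case True
    thus ?thesis using k by auto
  next
    case False
    hence less: "pos P k < x" using k by simp
    have kn: "k < ?n" using less x k by (cases "k = ?n") (auto simp: points_def)
    have "x < pos P (Suc k)"
    proof (rule ccontr)
      assume "\<not> x < pos P (Suc k)"
      hence "Suc k \<le> k" unfolding k_def using kn by (intro Max_ge) (auto simp: k_def)
      thus False by simp
    qed
    note xx = less this
    note Q = path_network_reversed[OF P]
    let ?X = "pos P ?n"
    define l where "l = ?n - k"
    have l: "1 \<le> l" "l < num_vertices ?Q" using k kn P by (auto simp: l_def num_vertices_reversed)
    have pl: "pos ?Q l = ?X - pos P (Suc k)" "pos ?Q (Suc l) = ?X - pos P k"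
      using pos_reversed[OF P, of l] pos_reversed[OF P, of "Suc l"] k kn by (auto simp: l_def Suc_diff_le)
    define \<alpha> where "\<alpha> = tau P * total_weight P k"
    define \<beta> where "\<beta> = tau P * total_weight ?Q l"
    note L = left_cost_edge[OF P k(1) kn xx]
    note R = left_cost_edge[OF Q l, of "?X - x"]
    \<comment> \<open>The jumps of the two one-sided costs lie at opposite ends of the edge, so
      towards either end one of them is given by the equation and the other by the inequality. The
      sign of the slope then decides which end to take.\<close>
    have 1: "evac_cost P (pos P (Suc k)) \<le> evac_cost P x + (\<alpha> - \<beta>) * (pos P (Suc k) - x)"
      using L(1) R(2) xx P unfolding pl tau_reversed[OF P] \<beta>_def[symmetric] \<alpha>_def[symmetric]
      by (simp add: evac_cost_def algebra_simps)
    have 2: "evac_cost P (pos P k) \<le> evac_cost P x - (\<alpha> - \<beta>) * (x - pos P k)"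
      using L(2) R(1) xx P unfolding pl tau_reversed[OF P] \<beta>_def[symmetric] \<alpha>_def[symmetric]
      by (simp add: evac_cost_def algebra_simps)
    show ?thesis
    proof (cases "\<alpha> \<le> \<beta>")
      case True
      hence "(\<alpha> - \<beta>) * (pos P (Suc k) - x) \<le> 0" using xx by (intro mult_nonpos_nonneg) auto
      thus ?thesis using 1 kn by (intro exI[of _ "Suc k"]) simp
    next
      case False
      hence "0 \<le> (\<alpha> - \<beta>) * (x - pos P k)" using xx by (intro mult_nonneg_nonneg) auto
      thus ?thesis using 2 k by (intro exI[of _ k]) simp
    qed
  qed
qed

lemma minsum_sink_vertexI:
  assumes P: "path_network P" and i: "1 \<le> i" "i \<le> num_vertices P"
    and le: "\<And>j. 1 \<le> j \<Longrightarrow> j \<le> num_vertices P \<Longrightarrow> vertex_cost P i \<le> vertex_cost P j"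
  shows "minsum_sink P (pos P i)"
proof -
  have "pos P i \<in> points P"
    using pos_mono[OF P, of 1 i] pos_mono[OF P, of i "num_vertices P"] i by (simp add: points_def)
  moreover have "evac_cost P (pos P i) \<le> evac_cost P x" if "x \<in> points P" for x
    using evac_cost_ge_vertex[OF P that] evac_cost_vertex[OF P] le i by fastforce
  ultimately show ?thesis by (simp add: minsum_sink_def)
qed

section \<open>Envelopes of rays\<close>

text \<open>A pointwise comparison of envelopes, phrased without \<open>Max\<close> so that it makes
  sense where no ray exists. Only \<open>p \<ge> 0\<close> matters, since areas are taken to the
  right of 0.\<close>

definition dominated ::
  "nat set \<Rightarrow> (nat \<Rightarrow> real) \<Rightarrow> (nat \<Rightarrow> real) \<Rightarrow> (nat \<Rightarrow> real) \<Rightarrow>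
   nat set \<Rightarrow> (nat \<Rightarrow> real) \<Rightarrow> (nat \<Rightarrow> real) \<Rightarrow> (nat \<Rightarrow> real) \<Rightarrow> bool" where
  "dominated S b y m S' b' y' m' \<longleftrightarrow>
     (\<forall>i\<in>S. \<forall>p. 0 \<le> p \<and> p \<le> b i \<longrightarrow> (\<exists>j\<in>S'. p \<le> b' j \<and> ray b y m i p \<le> ray b' y' m' j p))"

definition equiv_rays ::
  "nat set \<Rightarrow> (nat \<Rightarrow> real) \<Rightarrow> (nat \<Rightarrow> real) \<Rightarrow> (nat \<Rightarrow> real) \<Rightarrow>
   nat set \<Rightarrow> (nat \<Rightarrow> real) \<Rightarrow> (nat \<Rightarrow> real) \<Rightarrow> (nat \<Rightarrow> real) \<Rightarrow> bool" where
  "equiv_rays S b y m S' b' y' m' \<longleftrightarrow>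
     dominated S b y m S' b' y' m' \<and> dominated S' b' y' m' S b y m"

lemma dominatedI:
  "(\<And>i p. i \<in> S \<Longrightarrow> 0 \<le> p \<Longrightarrow> p \<le> b i \<Longrightarrow> \<exists>j\<in>S'. p \<le> b' j \<and> ray b y m i p \<le> ray b' y' m' j p)
   \<Longrightarrow> dominated S b y m S' b' y' m'"
  by (auto simp: dominated_def)

lemma dominated_trans:
  assumes "dominated S b y m S' b' y' m'" "dominated S' b' y' m' S'' b'' y'' m''"
  shows "dominated S b y m S'' b'' y'' m''"
proof (rule dominatedI)
  fix i p assume i: "i \<in> S" "0 \<le> p" "p \<le> b i"
  then obtain j where j: "j \<in> S'" "p \<le> b' j" "ray b y m i p \<le> ray b' y' m' j p"
    using assms(1) unfolding dominated_def by blast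
  then obtain l where "l \<in> S''" "p \<le> b'' l" "ray b' y' m' j p \<le> ray b'' y'' m'' l p"
    using assms(2) i(2) unfolding dominated_def by blast
  thus "\<exists>j\<in>S''. p \<le> b'' j \<and> ray b y m i p \<le> ray b'' y'' m'' j p" using j(3) order_trans by blast
qed

lemma equiv_rays_trans:
  "equiv_rays S b y m S' b' y' m' \<Longrightarrow> equiv_rays S' b' y' m' S'' b'' y'' m'' \<Longrightarrow>
   equiv_rays S b y m S'' b'' y'' m''"
  unfolding equiv_rays_def using dominated_trans by blast

lemma ray_cong: "b i = b' i \<Longrightarrow> y i = y' i \<Longrightarrow> m i = m' i \<Longrightarrow> ray b y m i p = ray b' y' m' i p"
  by (simp add: ray_def)

lemma equiv_rays_cong:
  assumes "\<And>i. i \<in> S \<Longrightarrow> b i = b' i \<and> y i = y' i \<and> m i = m' i"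
  shows "equiv_rays S b y m S b' y' m'"
  unfolding equiv_rays_def dominated_def using assms ray_cong[of b _ b' y y' m m']
  by (metis order_refl)

text \<open>A capped ray has slope at least \<open>1 / c\<close> and is nowhere below the original
  one, so it stays above the line of slope \<open>1 / c\<close> that leaves the original ray at
  \<open>q\<close> to the left. The second alternative is a ray that ends before
  \<open>q\<close>.\<close>

lemma ray_cap:
  assumes "p \<le> q" "0 < m i" "0 < c"
  shows "ray b y m i q + (q - p) / c \<le> ray b y (\<lambda>i. min (m i) c) i p \<or> b i < q"
proof (cases "b i < q")
  case False
  let ?r = "min (m i) c"
  have r: "0 < ?r" using assms by simp
  have "(b i - q) / m i \<le> (b i - q) / ?r" using False assms r by (intro divide_left_mono) auto
  moreover have "(q - p) / c \<le> (q - p) / ?r" using assms r by (intro divide_left_mono) auto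
  moreover have "(b i - p) / ?r = (b i - q) / ?r + (q - p) / ?r"
    by (simp add: diff_divide_distrib)
  ultimately show ?thesis by (simp add: ray_def)
qed simp

text \<open>This is what allows a step to start from the simplified list of pieces in place of all
  original rays: the capped envelope depends only on the old envelope.\<close>

lemma dominated_cap:
  assumes dom: "dominated S b y m S' b' y' m'" and c: "0 < c"
    and m: "\<And>i. i \<in> S \<Longrightarrow> 0 < m i" and m': "\<And>i. i \<in> S' \<Longrightarrow> 0 < m' i"
  shows "dominated S b y (\<lambda>i. min (m i) c) S' b' y' (\<lambda>i. min (m' i) c)"
proof (rule dominatedI)
  fix i p assume i: "i \<in> S" "0 \<le> p" "p \<le> b i"
  \<comment> \<open>A ray whose rate survives the cap is compared at \<open>p\<close> itself.
    Otherwise the capped ray is the line of slope \<open>1 / c\<close> from its end point, so the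
    comparison takes place at \<open>b i\<close>.\<close>
  define q where "q = (if m i \<le> c then p else b i)"
  have q: "0 \<le> q" "p \<le> q" "q \<le> b i" using i by (auto simp: q_def)
  have eq: "ray b y (\<lambda>i. min (m i) c) i p = ray b y m i q + (q - p) / c"
    by (auto simp: q_def ray_def)
  obtain j where j: "j \<in> S'" "q \<le> b' j" "ray b y m i q \<le> ray b' y' m' j q"
    using dom i(1) q unfolding dominated_def by blast
  have "ray b' y' m' j q + (q - p) / c \<le> ray b' y' (\<lambda>i. min (m' i) c) j p"
    using ray_cap[of p q m' j c b' y'] q(2) m'[OF j(1)] c j(2) by auto
  hence "ray b y (\<lambda>i. min (m i) c) i p \<le> ray b' y' (\<lambda>i. min (m' i) c) j p"
    using eq j(3) by linarith
  thus "\<exists>j\<in>S'. p \<le> b' j \<and> ray b y (\<lambda>i. min (m i) c) i p \<le> ray b' y' (\<lambda>i. min (m' i) c) j p"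
    using j q by (intro bexI[of _ j]) auto
qed

lemma equiv_rays_cap:
  assumes "equiv_rays S b y m S' b' y' m'" "0 < c"
    "\<And>i. i \<in> S \<Longrightarrow> 0 < m i" "\<And>i. i \<in> S' \<Longrightarrow> 0 < m' i"
  shows "equiv_rays S b y (\<lambda>i. min (m i) c) S' b' y' (\<lambda>i. min (m' i) c)"
  using assms dominated_cap unfolding equiv_rays_def by blast

lemma equiv_rays_insert:
  assumes "equiv_rays S b y m S' b' y' m'" "b i = b' i" "y i = y' i" "m i = m' i"
  shows "equiv_rays (insert i S) b y m (insert i S') b' y' m'"
  using assms ray_cong[of b i b' y y' m m'] unfolding equiv_rays_def dominated_def
  by (metis insert_iff order_refl)

lemma equiv_rays_envelope:
  assumes eq: "equiv_rays S b y m S' b' y' m'" and fin: "finite S" "finite S'"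
    and i: "i \<in> S" "0 \<le> p" "p \<le> b i"
  shows "envelope S b y m p = envelope S' b' y' m' p"
proof -
  have le: "envelope S b y m p \<le> envelope S' b' y' m' p"
    if dom: "dominated S b y m S' b' y' m'" and prem: "finite S" "finite S'" "i \<in> S" "p \<le> b i"
    for S S' b b' y y' m m' i
  proof -
    obtain j where "j \<in> S" "p \<le> b j" "envelope S b y m p = ray b y m j p"
      using envelope_attained[of S i p b y m] prem by metis
    moreover then obtain l where "l \<in> S'" "p \<le> b' l" "ray b y m j p \<le> ray b' y' m' l p"
      using dom i(2) unfolding dominated_def by blast
    ultimately show ?thesis using envelope_ge[of S' l p b' y' m'] prem by fastforce
  qed
  obtain j where "j \<in> S'" "p \<le> b' j" using eq i unfolding equiv_rays_def dominated_def by blast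
  thus ?thesis using le[of S b y m S' b' y' m' i] le[of S' b' y' m' S b y m j] eq fin i
    unfolding equiv_rays_def by (intro antisym) auto
qed

text \<open>The pieces of the envelope form a linked list; 0 is the sentinel.\<close>

definition linked :: "(nat \<Rightarrow> nat) \<Rightarrow> (nat \<Rightarrow> nat) \<Rightarrow> nat set \<Rightarrow> nat \<Rightarrow> bool" where
  "linked prv nxt S k \<longleftrightarrow> S \<subseteq> {1..k} \<and> k \<in> insert 0 S \<and>
     (\<forall>i\<in>S. prv i < i \<and> prv i \<in> insert 0 S \<and> nxt (prv i) = i \<and> (\<forall>j\<in>S. j < i \<longrightarrow> j \<le> prv i))"

lemma linked_finite: "linked prv nxt S k \<Longrightarrow> finite S"
  unfolding linked_def using finite_subset by blast

lemma linked_bounds: "linked prv nxt S k \<Longrightarrow> i \<in> S \<Longrightarrow> 1 \<le> i \<and> i \<le> k"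
  unfolding linked_def by auto

lemma linked_prv:
  assumes "linked prv nxt S k" "i \<in> S"
  shows "prv i < i" "prv i \<in> insert 0 S" "nxt (prv i) = i" "j \<in> S \<Longrightarrow> j < i \<Longrightarrow> j \<le> prv i"
  using assms unfolding linked_def by auto

text \<open>\<open>linked\<close> constrains \<open>nxt\<close> only through \<open>prv\<close>. The
  successor is recovered as the least larger member \<open>j0\<close>: its predecessor can be
  neither smaller nor larger than \<open>i\<close>.\<close>

lemma linked_nxt:
  assumes L: "linked prv nxt S k" and i: "i \<in> insert 0 S" "i < k"
  shows "nxt i \<in> S" "i < nxt i" "prv (nxt i) = i" "j \<in> S \<Longrightarrow> i < j \<Longrightarrow> nxt i \<le> j"
proof -
  define j0 where "j0 = (LEAST j. j \<in> S \<and> i < j)"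
  have "k \<in> S \<and> i < k" using L i by (auto simp: linked_def)
  hence j0: "j0 \<in> S" "i < j0" unfolding j0_def using LeastI[of "\<lambda>j. j \<in> S \<and> i < j"] by auto
  have least: "j0 \<le> j" if "j \<in> S" "i < j" for j
    unfolding j0_def using that by (intro Least_le) auto
  have "i \<le> prv j0" using linked_prv[OF L j0(1)] i j0 by (cases "i = 0") auto
  moreover have "\<not> i < prv j0" using least[of "prv j0"] linked_prv[OF L j0(1)] by fastforce
  ultimately have "prv j0 = i" by simp
  moreover from this have "nxt i = j0" using linked_prv[OF L j0(1)] by simp
  ultimately show "nxt i \<in> S" "i < nxt i" "prv (nxt i) = i" "j \<in> S \<Longrightarrow> i < j \<Longrightarrow> nxt i \<le> j"
    using j0 least by auto
qed

lemma linked_push: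
  assumes L: "linked prv nxt S k"
  shows "linked (prv(Suc k := k)) (nxt(k := Suc k)) (insert (Suc k) S) (Suc k)"
  unfolding linked_def
proof (intro conjI ballI)
  show "insert (Suc k) S \<subseteq> {1..Suc k}" using L by (auto simp: linked_def)
  fix i assume i: "i \<in> insert (Suc k) S"
  have "prv i \<noteq> k" if "i \<in> S" using linked_prv(1)[OF L that] linked_bounds[OF L that] by simp
  thus "(nxt(k := Suc k)) ((prv(Suc k := k)) i) = i"
    using i linked_prv(3)[OF L] linked_bounds[OF L] by fastforce
qed (use L in \<open>auto simp: linked_def\<close>)

lemma linked_delete:
  assumes L: "linked prv nxt S k" and i: "i \<in> S" "i < k"
  shows "linked (prv(nxt i := prv i)) (nxt(prv i := nxt i)) (S - {i}) k"
proof -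
  note n = linked_nxt[OF L, of i] 
  note p = linked_prv[OF L i(1)]
  have n': "nxt i \<in> S" "i < nxt i" "prv (nxt i) = i" using n i by auto
  have *: "(prv(nxt i := prv i)) j < j \<and> (prv(nxt i := prv i)) j \<in> insert 0 (S - {i}) \<and>
      (nxt(prv i := nxt i)) ((prv(nxt i := prv i)) j) = j \<and>
      (\<forall>l\<in>S - {i}. l < j \<longrightarrow> l \<le> (prv(nxt i := prv i)) j)" if j: "j \<in> S - {i}" for j
  proof (cases "j = nxt i")
    case True
    have "l \<le> prv i" if "l \<in> S - {i}" "l < nxt i" for l
      using linked_prv(4)[OF L n'(1), of l] n' p(4)[of l] that by fastforce
    thus ?thesis using True p n' by auto
  next
    case False
    have q: "prv j < j" "prv j \<in> insert 0 S" "nxt (prv j) = j" "\<forall>l\<in>S. l < j \<longrightarrow> l \<le> prv j"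
      using linked_prv[OF L, of j] j by auto
    have "prv j \<noteq> i" using q False by auto
    moreover have "prv j \<noteq> prv i" using q p j by auto
    ultimately show ?thesis using False q by auto
  qed
  show ?thesis unfolding linked_def using * L i n' by (auto simp: linked_def)
qed

text \<open>The end points form a descending staircase, which makes the denominators of the
  thresholds positive. The sentinel has no end point; \<open>b 0 = 0\<close> only lets the first
  piece start at 0.\<close>

definition heights :: "(nat \<Rightarrow> nat) \<Rightarrow> (nat \<Rightarrow> real) \<Rightarrow> (nat \<Rightarrow> real) \<Rightarrow> nat set \<Rightarrow> bool" where
  "heights prv b y S \<longleftrightarrow> b 0 = 0 \<and> (\<forall>i\<in>S. b (prv i) < b i \<and> (prv i \<noteq> 0 \<longrightarrow> y i < y (prv i)))"

definition square_sum :: "(nat \<Rightarrow> nat) \<Rightarrow> (nat \<Rightarrow> real) \<Rightarrow> nat set \<Rightarrow> real" where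
  "square_sum prv b S = (\<Sum>i\<in>S. (b i - b (prv i))\<^sup>2)"

text \<open>The integral of ray \<open>i\<close> over \<open>[b (prv i), b i]\<close>. The rate
  enters only through the squared length, so changing the rate of a whole group requires just the
  sum of these squares.\<close>

definition area :: "(nat \<Rightarrow> nat) \<Rightarrow> (nat \<Rightarrow> real) \<Rightarrow> (nat \<Rightarrow> real) \<Rightarrow> (nat \<Rightarrow> real) \<Rightarrow> nat set \<Rightarrow> real" where
  "area prv b y m S = (\<Sum>i\<in>S. y i * (b i - b (prv i)) + (b i - b (prv i))\<^sup>2 / (2 * m i))"

text \<open>The ray of \<open>j\<close> must not cover the end of the preceding piece. For equal
  rates strictness says that the threshold of the pair lies strictly below their common rate; for
  different rates equality must be allowed, because a cut produces it.\<close>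

definition separated ::
  "(nat \<Rightarrow> nat) \<Rightarrow> (nat \<Rightarrow> real) \<Rightarrow> (nat \<Rightarrow> real) \<Rightarrow> (nat \<Rightarrow> real) \<Rightarrow> nat \<Rightarrow> bool" where
  "separated prv b y m j \<longleftrightarrow> (prv j \<noteq> 0 \<longrightarrow>
     y j + (b j - b (prv j)) / m j \<le> y (prv j) \<and>
     (m (prv j) = m j \<longrightarrow> y j + (b j - b (prv j)) / m j < y (prv j)))"

text \<open>On its own piece a ray beats all others: earlier rays have ended, and later ones start
  below its end point and rise less steeply to the left. So the integral splits into the
  pieces.\<close>

lemma envelope_has_integral:
  assumes "linked prv nxt S k" "heights prv b y S" "\<And>i. i \<in> S \<Longrightarrow> 0 < m i"
    "\<And>i j. i \<in> S \<Longrightarrow> j \<in> S \<Longrightarrow> i \<le> j \<Longrightarrow> m i \<le> m j"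
    "\<And>j. j \<in> S \<Longrightarrow> separated prv b y m j"
  shows "(envelope S b y m has_integral area prv b y m S) {0..b k}"
proof -
  note L = assms(1) and H = assms(2) and mpos = assms(3) and mono = assms(4) and sep = assms(5)
  have fin: "finite S" by (rule linked_finite[OF L])
  have b0: "b 0 = 0" using H by (simp add: heights_def)
  have bmono: "b i \<le> b j" if "i \<in> insert 0 S" "j \<in> insert 0 S" "i \<le> j" for i j
    using that(2,3)
  proof (induction j rule: less_induct)
    case (less j)
    show ?case
    proof (cases "i = j")
      case False
      hence j: "j \<in> S" "i < j" using less.prems by auto
      have "i \<le> prv j" using linked_prv(4)[OF L j(1)] j that(1) by auto
      hence "b i \<le> b (prv j)" using less.IH[of "prv j"] linked_prv[OF L j(1)] by auto
      thus ?thesis using H j by (auto simp: heights_def intro: order_trans less_imp_le)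
    qed simp
  qed
  have bstrict: "b i \<le> b (prv j)" if "i \<in> S" "j \<in> S" "i < j" for i j
    using bmono[of i "prv j"] linked_prv[OF L that(2)] that by auto
  \<comment> \<open>Separation concerns neighbours only. It carries over to all earlier end points
    because rates do not decrease to the right: beyond the end point of its predecessor, ray
    \<open>j\<close> rises no faster than the predecessor's ray.\<close>
  have above: "ray b y m j (b i) \<le> y i" if ij: "i \<in> S" "j \<in> S" "i \<le> j" for i j
    using ij(2,3)
  proof (induction j rule: less_induct)
    case (less j)
    show ?case
    proof (cases "i = j")
      case False
      hence lt: "i < j" using less.prems by simp
      let ?p = "prv j"
      have pS: "?p \<in> S" "i \<le> ?p" "?p < j"
        using linked_prv[OF L less.prems(1)] lt ij(1) linked_bounds[OF L ij(1)] by fastforce+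
      have "?p \<noteq> 0" using linked_bounds[OF L pS(1)] by simp
      hence s: "y j + (b j - b ?p) / m j \<le> y ?p"
        using sep[OF less.prems(1)] by (simp add: separated_def)
      have "ray b y m j (b i) = y j + (b j - b ?p) / m j + (b ?p - b i) / m j"
        by (simp add: ray_def diff_divide_distrib)
      also have "\<dots> \<le> y ?p + (b ?p - b i) / m ?p"
        using s mpos mono[OF pS(1) less.prems(1)] pS bmono[of i ?p] ij(1) less.prems
        by (intro add_mono divide_left_mono mult_pos_pos) auto
      also have "\<dots> \<le> y i" using less.IH[of ?p] pS by (simp add: ray_def)
      finally show ?thesis .
    qed (simp add: ray_def)
  qed
  have env: "envelope S b y m p = ray b y m i p" if i: "i \<in> S" and p: "b (prv i) < p" "p \<le> b i" for i p
    unfolding envelope_def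
  proof (rule Max_eqI)
    fix z assume "z \<in> (\<lambda>i. ray b y m i p) ` {i \<in> S. p \<le> b i}"
    then obtain j where j: "j \<in> S" "p \<le> b j" "z = ray b y m j p" by auto
    have ij: "i \<le> j"
    proof (rule ccontr)
      assume "\<not> i \<le> j"
      hence "b j \<le> b (prv i)" using bstrict[OF j(1) i] by simp
      thus False using j p by simp
    qed
    have "z = ray b y m j (b i) + (b i - p) / m j"
      by (simp add: j(3) ray_def diff_divide_distrib)
    also have "\<dots> \<le> y i + (b i - p) / m i"
      using above[OF i j(1) ij] mono[OF i j(1) ij] mpos i j p
      by (intro add_mono divide_left_mono mult_pos_pos) auto
    finally show "z \<le> ray b y m i p" by (simp add: ray_def)
  qed (use fin i p in auto)
  have part: "(envelope S b y m has_integral area prv b y m {j \<in> S. j \<le> i}) {0..b i}"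
    if "i \<in> insert 0 S" for i
    using that
  proof (induction i rule: less_induct)
    case (less i)
    show ?case
    proof (cases "i = 0")
      case True
      hence e: "{j \<in> S. j \<le> i} = {}" using linked_bounds[OF L] by auto
      have "area prv b y m {j \<in> S. j \<le> i} = 0" unfolding e by (simp add: area_def)
      thus ?thesis using True b0 has_integral_null_real[of 0 0 "envelope S b y m"] by simp
    next
      case False
      hence i: "i \<in> S" using less.prems by simp
      let ?p = "prv i"
      note lp = linked_prv[OF L i]
      have b1: "b ?p < b i" using H i by (simp add: heights_def)
      have IH: "(envelope S b y m has_integral area prv b y m {j \<in> S. j \<le> ?p}) {0..b ?p}"
        using less.IH[of ?p] lp by auto
      have "((\<lambda>q. y i + (b i - q) / m i) has_integral
          (y i * b i + b i * b i / m i - (b i)\<^sup>2 / (2 * m i))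
          - (y i * b ?p + b i * b ?p / m i - (b ?p)\<^sup>2 / (2 * m i))) {b ?p..b i}"
        using b1 mpos[OF i]
        by (intro fundamental_theorem_of_calculus)
           (auto intro!: derivative_eq_intros simp: has_real_derivative_iff_has_vector_derivative[symmetric]
              field_simps power2_eq_square)
      moreover have "(y i * b i + b i * b i / m i - (b i)\<^sup>2 / (2 * m i))
          - (y i * b ?p + b i * b ?p / m i - (b ?p)\<^sup>2 / (2 * m i))
          = y i * (b i - b ?p) + (b i - b ?p)\<^sup>2 / (2 * m i)"
        using mpos[OF i] by (simp add: field_simps power2_eq_square)
      ultimately have "(ray b y m i has_integral y i * (b i - b ?p) + (b i - b ?p)\<^sup>2 / (2 * m i)) {b ?p..b i}"
        unfolding ray_def[abs_def] by simp
      \<comment> \<open>At \<open>b ?p\<close> itself the preceding ray is still present and the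
        envelope may be larger than ray \<open>i\<close>, so this point is left out.\<close>
      hence "(envelope S b y m has_integral y i * (b i - b ?p) + (b i - b ?p)\<^sup>2 / (2 * m i)) {b ?p..b i}"
        by (rule has_integral_spike_finite[of "{b ?p}", rotated 2]) (use env[OF i] in auto)
      from has_integral_combine[OF _ _ IH this]
      have "(envelope S b y m has_integral area prv b y m {j \<in> S. j \<le> ?p}
          + (y i * (b i - b ?p) + (b i - b ?p)\<^sup>2 / (2 * m i))) {0..b i}"
        using bmono[of 0 ?p] lp b0 b1 by auto
      moreover have "{j \<in> S. j \<le> i} = insert i {j \<in> S. j \<le> ?p}"
        using lp i by (auto simp: order_le_less)
      moreover have "area prv b y m (insert i {j \<in> S. j \<le> ?p}) =
          (y i * (b i - b ?p) + (b i - b ?p)\<^sup>2 / (2 * m i)) + area prv b y m {j \<in> S. j \<le> ?p}"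
        unfolding area_def by (rule sum.insert) (use fin lp in auto)
      ultimately show ?thesis by (simp add: add.commute)
    qed
  qed
  have "{j \<in> S. j \<le> k} = S" using linked_bounds[OF L] by auto
  moreover have "k \<in> insert 0 S" using L by (simp add: linked_def)
  ultimately show ?thesis using part[of k] by simp
qed

section \<open>The data structure\<close>

text \<open>The pieces before \<open>f\<close> are on the stack: group \<open>l\<close> has rate \<open>gm l\<close>, first piece \<open>gf l\<close> and sum of
  squared lengths \<open>g2 l\<close>. The pieces from \<open>f\<close> on form the last group, which is kept in registers.\<close>

definition levels ::
  "(nat \<Rightarrow> nat) \<Rightarrow> (nat \<Rightarrow> real) \<Rightarrow> (nat \<Rightarrow> real) \<Rightarrow> nat set \<Rightarrow> nat \<Rightarrow> nat \<Rightarrow>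
   (nat \<Rightarrow> nat) \<Rightarrow> (nat \<Rightarrow> real) \<Rightarrow> (nat \<Rightarrow> real) \<Rightarrow> bool" where
  "levels prv b m S f h gf gm g2 \<longleftrightarrow>
     (\<forall>l\<in>{1..h}. gf l \<in> S \<and> gf l < f \<and> m (gf l) = gm l \<and> 0 < gm l \<and>
        (\<forall>i\<in>S. i < f \<and> m i = gm l \<longrightarrow> gf l \<le> i) \<and>
        g2 l = square_sum prv b {i \<in> S. i < f \<and> m i = gm l}) \<and>
     (\<forall>l l'. 1 \<le> l \<and> l < l' \<and> l' \<le> h \<longrightarrow> gm l < gm l') \<and>
     (\<forall>i\<in>S. i < f \<longrightarrow> (\<exists>l\<in>{1..h}. m i = gm l)) \<and>
     (\<forall>i\<in>S. \<forall>j\<in>S. i \<le> j \<and> j < f \<longrightarrow> m i \<le> m j)"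

text \<open>Pieces \<open>i\<close> and \<open>nxt i\<close> of the same group merge when its rate drops to \<open>u i\<close>; 0 means never.\<close>

definition thresholds ::
  "(nat \<Rightarrow> nat) \<Rightarrow> (nat \<Rightarrow> real) \<Rightarrow> (nat \<Rightarrow> real) \<Rightarrow> (nat \<Rightarrow> real) \<Rightarrow> nat set \<Rightarrow> nat \<Rightarrow> nat \<Rightarrow>
   nat \<Rightarrow> (nat \<Rightarrow> real) \<Rightarrow> bool" where
  "thresholds nxt b y m S k f n u \<longleftrightarrow> (\<forall>i\<le>n. u i =
     (if i \<in> S \<and> i < k \<and> (f \<le> i \<or> nxt i < f \<and> m i = m (nxt i))
      then (b (nxt i) - b i) / (y i - y (nxt i)) else 0))"

lemma levels_group:
  assumes "levels prv b m S f h gf gm g2" "1 \<le> l" "l \<le> h"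
  shows "gf l \<in> S" "gf l < f" "m (gf l) = gm l" "0 < gm l"
    "i \<in> S \<Longrightarrow> i < f \<Longrightarrow> m i = gm l \<Longrightarrow> gf l \<le> i"
    "g2 l = square_sum prv b {i \<in> S. i < f \<and> m i = gm l}"
  using assms by (auto simp: levels_def)

lemma levels_strict:
  "levels prv b m S f h gf gm g2 \<Longrightarrow> 1 \<le> l \<Longrightarrow> l < l' \<Longrightarrow> l' \<le> h \<Longrightarrow> gm l < gm l'"
  by (simp add: levels_def)

lemma levels_ex:
  "levels prv b m S f h gf gm g2 \<Longrightarrow> i \<in> S \<Longrightarrow> i < f \<Longrightarrow> \<exists>l. 1 \<le> l \<and> l \<le> h \<and> m i = gm l"
  unfolding levels_def by (meson atLeastAtMost_iff)

lemma levels_mono: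
  "levels prv b m S f h gf gm g2 \<Longrightarrow> i \<in> S \<Longrightarrow> j \<in> S \<Longrightarrow> i \<le> j \<Longrightarrow> j < f \<Longrightarrow> m i \<le> m j"
  by (simp add: levels_def)

text \<open>A frame rule: what happens inside the last group does not disturb the stack.\<close>

lemma levels_cong:
  assumes V: "levels prv b m S f h gf gm g2"
    and S: "\<And>i. i \<in> S' \<and> i < f' \<longleftrightarrow> i \<in> S \<and> i < f" and m: "\<And>i. i \<in> S \<Longrightarrow> i < f \<Longrightarrow> m' i = m i"
    and sq: "\<And>A. A \<subseteq> {i \<in> S. i < f} \<Longrightarrow> square_sum prv' b' A = square_sum prv b A"
  shows "levels prv' b' m' S' f' h gf gm g2"
proof -
  have "{i \<in> S'. i < f' \<and> m' i = z} = {i \<in> S. i < f \<and> m i = z}" for z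
  proof (rule set_eqI)
    fix i
    show "i \<in> {i \<in> S'. i < f' \<and> m' i = z} \<longleftrightarrow> i \<in> {i \<in> S. i < f \<and> m i = z}"
      using S[of i] m[of i] by auto
  qed
  moreover have "square_sum prv' b' {i \<in> S. i < f \<and> m i = z} = square_sum prv b {i \<in> S. i < f \<and> m i = z}" for z
    by (rule sq) auto
  ultimately have sum: "square_sum prv' b' {i \<in> S'. i < f' \<and> m' i = z} = square_sum prv b {i \<in> S. i < f \<and> m i = z}" for z
    by simp
  show ?thesis
    unfolding levels_def sum
  proof (intro conjI ballI allI impI)
    fix l assume "l \<in> {1..h}"
    hence l: "1 \<le> l" "l \<le> h" by auto
    note g = levels_group[OF V l]
    show "gf l \<in> S'" "gf l < f'" "m' (gf l) = gm l" "0 < gm l" "g2 l = square_sum prv b {i \<in> S. i < f \<and> m i = gm l}"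
      using g S[of "gf l"] m[of "gf l"] by auto
    show "gf l \<le> i" if "i \<in> S'" "i < f' \<and> m' i = gm l" for i
      using g(5)[of i] that S[of i] m[of i] by auto
  next
    fix l l' assume "1 \<le> l \<and> l < l' \<and> l' \<le> h"
    thus "gm l < gm l'" using levels_strict[OF V] by blast
  next
    fix i assume "i \<in> S'" "i < f'"
    hence "i \<in> S" "i < f" using S by blast+
    thus "\<exists>l\<in>{1..h}. m' i = gm l" using levels_ex[OF V, of i] m[of i] by auto
  next
    fix i j assume "i \<in> S'" "j \<in> S'" "i \<le> j \<and> j < f'"
    hence "i \<in> S" "j \<in> S" "i \<le> j" "i < f" "j < f" using S[of i] S[of j] by auto
    thus "m' i \<le> m' j" using levels_mono[OF V] m by simp
  qed
qed

text \<open>\<open>rest_inv\<close> holds between two steps, \<open>step_inv\<close> while vertex \<open>k\<close> is being processed.\<close>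

definition rest_inv where
  "rest_inv S m k n prv nxt b y gf gm g2 u h E \<longleftrightarrow>
     linked prv nxt S k \<and> heights prv b y S \<and> levels prv b m S (Suc k) h gf gm g2 \<and>
     thresholds nxt b y m S k (Suc k) n u \<and> E = area prv b y m S \<and>
     (\<forall>j\<in>S. separated prv b y m j)"

definition step_inv where
  "step_inv S m k n c prv nxt b y gf gm g2 u f h q E \<longleftrightarrow>
     linked prv nxt S k \<and> k \<le> n \<and> heights prv b y S \<and> levels prv b m S f h gf gm g2 \<and>
     thresholds nxt b y m S k f n u \<and> E = area prv b y m S \<and>
     (\<forall>j\<in>S. j < f \<longrightarrow> separated prv b y m j) \<and>
     f \<in> S \<and> 0 < c \<and> (\<forall>i\<in>S. f \<le> i \<longrightarrow> m i = c) \<and> q = square_sum prv b {i \<in> S. f \<le> i}"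

text \<open>The new vertex forms a last group of its own. No leaf of the tree changes, since the
  link from \<open>k\<close> to \<open>Suc k\<close> crosses a group boundary. Rates above
  \<open>c\<close> on the stack and a missing separation at \<open>Suc k\<close> are tolerated by
  \<open>step_inv\<close> and repaired by the loops.\<close>

lemma rest_inv_push:
  assumes R: "rest_inv S m k n prv nxt b y gf gm g2 u h E" and kn: "Suc k \<le> n" and c: "0 < c"
    and W: "b k < W" and Y: "k \<noteq> 0 \<Longrightarrow> Y < y k"
    and q: "q = (W - b k)\<^sup>2" and E': "E' = E + Y * (W - b k) + (W - b k)\<^sup>2 / (2 * c)"
  shows "step_inv (insert (Suc k) S) (m(Suc k := c)) (Suc k) n c (prv(Suc k := k)) (nxt(k := Suc k))
    (b(Suc k := W)) (y(Suc k := Y)) gf gm g2 u (Suc k) h q E'"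
proof -
  have L: "linked prv nxt S k" and H: "heights prv b y S" and V: "levels prv b m S (Suc k) h gf gm g2"
    and T: "thresholds nxt b y m S k (Suc k) n u" and E: "E = area prv b y m S"
    and sep: "\<And>j. j \<in> S \<Longrightarrow> separated prv b y m j"
    using R by (auto simp: rest_inv_def)
  have bd: "1 \<le> i \<and> i \<le> k" if "i \<in> S" for i using linked_bounds[OF L that] .
  have pr: "prv i < i" "nxt (prv i) = i" if "i \<in> S" for i using linked_prv[OF L that] by auto
  have nk: "Suc k \<notin> S" using bd by fastforce
  have ne: "i \<noteq> Suc k" "prv i \<noteq> Suc k" if "i \<in> S" for i using bd[OF that] pr[OF that] by auto
  have fin: "finite S" by (rule linked_finite[OF L])
  have old: "(b(Suc k := W)) i = b i" "(y(Suc k := Y)) i = y i" "(m(Suc k := c)) i = m i"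
    "(prv(Suc k := k)) i = prv i" "(b(Suc k := W)) (prv i) = b (prv i)"
    "(y(Suc k := Y)) (prv i) = y (prv i)" "(m(Suc k := c)) (prv i) = m (prv i)" if "i \<in> S" for i
    using bd[OF that] pr[OF that] by auto
  have sq: "square_sum (prv(Suc k := k)) (b(Suc k := W)) A = square_sum prv b A" if "A \<subseteq> S" for A
    unfolding square_sum_def by (rule sum.cong) (use that old in \<open>auto simp: subset_iff\<close>)
  have set2: "{i \<in> insert (Suc k) S. Suc k \<le> i} = {Suc k}" using bd by fastforce
  show ?thesis
    unfolding step_inv_def
  proof (intro conjI)
    show "linked (prv(Suc k := k)) (nxt(k := Suc k)) (insert (Suc k) S) (Suc k)"
      by (rule linked_push[OF L])
    show "heights (prv(Suc k := k)) (b(Suc k := W)) (y(Suc k := Y)) (insert (Suc k) S)"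
      using H W Y ne by (auto simp: heights_def)
    show "levels (prv(Suc k := k)) (b(Suc k := W)) (m(Suc k := c)) (insert (Suc k) S) (Suc k) h gf gm g2"
      by (rule levels_cong[OF V]) (use nk sq in auto)
    have "nxt i \<in> S \<and> nxt i \<le> k" if "i \<in> S" "i < k" for i
      using linked_nxt(1)[OF L, of i] bd that by auto
    thus "thresholds (nxt(k := Suc k)) (b(Suc k := W)) (y(Suc k := Y)) (m(Suc k := c))
        (insert (Suc k) S) (Suc k) (Suc k) n u"
      using T nk unfolding thresholds_def by (auto simp: less_Suc_eq)
    have "area (prv(Suc k := k)) (b(Suc k := W)) (y(Suc k := Y)) (m(Suc k := c)) S = area prv b y m S"
      unfolding area_def by (rule sum.cong) (use old in auto)
    thus "E' = area (prv(Suc k := k)) (b(Suc k := W)) (y(Suc k := Y)) (m(Suc k := c)) (insert (Suc k) S)"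
      using fin nk E E' by (simp add: area_def)
    show "\<forall>j\<in>insert (Suc k) S. j < Suc k \<longrightarrow> separated (prv(Suc k := k)) (b(Suc k := W)) (y(Suc k := Y)) (m(Suc k := c)) j"
      using sep ne by (auto simp: separated_def)
    show "\<forall>i\<in>insert (Suc k) S. Suc k \<le> i \<longrightarrow> (m(Suc k := c)) i = c" using bd by fastforce
    show "q = square_sum (prv(Suc k := k)) (b(Suc k := W)) {i \<in> insert (Suc k) S. Suc k \<le> i}"
      unfolding set2 by (simp add: square_sum_def q)
  qed (use kn c in auto)
qed

text \<open>The top group occupies the list from \<open>gf h\<close> up to \<open>f\<close>; with
  rate \<open>c\<close> it joins the last group. Only the link from \<open>p\<close> to
  \<open>f\<close> becomes internal to a group, so one leaf changes. Since its rate was at least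
  \<open>c\<close>, the rates capped at \<open>c\<close> stay the same, and with them the
  represented envelope.\<close>

lemma step_inv_merge:
  assumes I: "step_inv S m k n c prv nxt b y gf gm g2 u f h q E" and h: "0 < h" "c \<le> gm h"
    and p: "p = prv f" and q': "q' = q + g2 h" and E': "E' = E + g2 h * (1 / c - 1 / gm h) / 2"
    and v: "v = (b f - b p) / (y p - y f)"
  shows "step_inv S (\<lambda>i. if gf h \<le> i then c else m i) k n c prv nxt b y gf gm g2 (u(p := v)) (gf h) (h - 1) q' E'"
    and "i \<in> S \<Longrightarrow> min (if gf h \<le> i then c else m i) c = min (m i) c" and "p \<le> n"
proof -
  have L: "linked prv nxt S k" and kn: "k \<le> n" and H: "heights prv b y S" and V: "levels prv b m S f h gf gm g2"
    and T: "thresholds nxt b y m S k f n u" and E: "E = area prv b y m S"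
    and sep: "\<And>j. j \<in> S \<Longrightarrow> j < f \<Longrightarrow> separated prv b y m j"
    and f: "f \<in> S" and c: "0 < c" and top: "\<And>i. i \<in> S \<Longrightarrow> f \<le> i \<Longrightarrow> m i = c"
    and q: "q = square_sum prv b {i \<in> S. f \<le> i}"
    using I by (auto simp: step_inv_def)
  let ?F = "gf h" and ?m = "\<lambda>i. if gf h \<le> i then c else m i"
  have F: "?F \<in> S" "?F < f" "m ?F = gm h" "0 < gm h" "\<And>i. i \<in> S \<Longrightarrow> i < f \<Longrightarrow> m i = gm h \<Longrightarrow> ?F \<le> i"
    "g2 h = square_sum prv b {i \<in> S. i < f \<and> m i = gm h}"
    using levels_group[OF V, of h] h by auto
  have gmono: "gm l < gm h" if "1 \<le> l" "l < h" for l using levels_strict[OF V that] by simp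
  have mid: "m i = gm h" if "i \<in> S" "?F \<le> i" "i < f" for i
  proof -
    obtain l where l: "1 \<le> l" "l \<le> h" "m i = gm l" using levels_ex[OF V] \<open>i \<in> S\<close> \<open>i < f\<close> by blast
    hence "m i \<le> gm h" using gmono[of l] by (cases "l = h") auto
    moreover have "m ?F \<le> m i" using levels_mono[OF V F(1)] that by simp
    ultimately show ?thesis using F by simp
  qed
  have low: "m i < gm h" if "i \<in> S" "i < ?F" for i
  proof -
    have "i < f" using that F(2) by simp
    then obtain l where l: "1 \<le> l" "l \<le> h" "m i = gm l" using levels_ex[OF V] \<open>i \<in> S\<close> by blast
    moreover have "l \<noteq> h" using F(5)[of i] l that F(2) by auto
    ultimately show ?thesis using gmono[of l] by auto
  qed
  have pp: "p \<in> S" "?F \<le> p" "p < f" "nxt p = f"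
    using linked_prv[OF L f] F linked_bounds[OF L F(1)] p by fastforce+
  show "i \<in> S \<Longrightarrow> min (?m i) c = min (m i) c" using top[of i] mid[of i] h by (cases "i < f") auto
  have kf: "f \<le> k" using linked_bounds[OF L f] by simp
  show "p \<le> n" using pp kf kn by simp
  have fin: "finite S" by (rule linked_finite[OF L])
  have mset: "{i \<in> S. ?F \<le> i} = {i \<in> S. i < f \<and> m i = gm h} \<union> {i \<in> S. f \<le> i}"
  proof (rule set_eqI)
    fix i
    show "i \<in> {i \<in> S. ?F \<le> i} \<longleftrightarrow> i \<in> {i \<in> S. i < f \<and> m i = gm h} \<union> {i \<in> S. f \<le> i}"
      using mid[of i] F(2) F(5)[of i] by (cases "i < f") auto
  qed
  have lset: "{i \<in> S. i < ?F \<and> ?m i = gm l} = {i \<in> S. i < f \<and> m i = gm l}" if "1 \<le> l" "l < h" for l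
  proof (rule set_eqI)
    fix i
    show "i \<in> {i \<in> S. i < ?F \<and> ?m i = gm l} \<longleftrightarrow> i \<in> {i \<in> S. i < f \<and> m i = gm l}"
      using mid[of i] F(2) gmono[OF that] by (cases "i < ?F") auto
  qed
  show "step_inv S ?m k n c prv nxt b y gf gm g2 (u(p := v)) ?F (h - 1) q' E'"
    unfolding step_inv_def
  proof (intro conjI)
    show "levels prv b ?m S ?F (h - 1) gf gm g2"
      unfolding levels_def
    proof (intro conjI ballI allI impI)
      fix l assume l: "l \<in> {1..h - 1}"
      hence l': "1 \<le> l" "l < h" "l \<le> h" using h by auto
      note g = levels_group[OF V l'(1,3)]
      show gF: "gf l < ?F" using mid[of "gf l"] g gmono[of l] l' by (cases "gf l < ?F") auto
      thus "?m (gf l) = gm l" using g by simp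
      show "gf l \<in> S" "0 < gm l" using g by auto
      show "gf l \<le> i" if "i \<in> S" "i < ?F \<and> ?m i = gm l" for i
        using g(5)[of i] that F by auto
      show "g2 l = square_sum prv b {i \<in> S. i < ?F \<and> ?m i = gm l}"
        using g(6) lset[OF l'(1,2)] by simp
    next
      fix i assume i: "i \<in> S" "i < ?F"
      have "i < f" using i F(2) by simp
      then obtain l where l: "1 \<le> l" "l \<le> h" "m i = gm l" using levels_ex[OF V i(1)] by blast
      moreover have "l \<noteq> h" using low[OF i] l by auto
      ultimately show "\<exists>l\<in>{1..h - 1}. ?m i = gm l" using i by (intro bexI[of _ l]) auto
    next
      fix i j assume "i \<in> S" "j \<in> S" "i \<le> j \<and> j < ?F"
      hence "m i \<le> m j" using levels_mono[OF V, of i j] F(2) by simp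
      thus "?m i \<le> ?m j" using \<open>i \<le> j \<and> j < ?F\<close> by auto
    next
      fix l l' assume "1 \<le> l \<and> l < l' \<and> l' \<le> h - 1"
      hence "1 \<le> l" "l < l'" "l' \<le> h" by auto
      thus "gm l < gm l'" by (rule levels_strict[OF V])
    qed
    show "thresholds nxt b y ?m S k ?F n (u(p := v))"
      unfolding thresholds_def
    proof (intro allI impI)
      fix i assume i: "i \<le> n"
      note Ti = T[unfolded thresholds_def, rule_format, OF i]
      show "(u(p := v)) i = (if i \<in> S \<and> i < k \<and> (?F \<le> i \<or> nxt i < ?F \<and> ?m i = ?m (nxt i))
          then (b (nxt i) - b i) / (y i - y (nxt i)) else 0)"
      proof (cases "i \<in> S \<and> i < k")
        case False
        thus ?thesis using Ti pp kf by auto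
      next
        case True
        note nx = linked_nxt[OF L, of i]
        have nx: "nxt i \<in> S" "i < nxt i" "prv (nxt i) = i" using linked_nxt[OF L, of i] True by auto
        show ?thesis
        proof (cases "i = p")
          case True
          thus ?thesis using pp kf v by auto
        next
          case False
          hence nf: "nxt i \<noteq> f" using nx p by auto
          have "(?F \<le> i \<or> nxt i < ?F \<and> ?m i = ?m (nxt i)) \<longleftrightarrow> (f \<le> i \<or> nxt i < f \<and> m i = m (nxt i))"
          proof (cases "?F \<le> i")
            case True
            have "f \<le> i \<or> nxt i < f" using linked_nxt(4)[OF L, of i f] nf f \<open>i \<in> S \<and> i < k\<close> by fastforce
            thus ?thesis using True mid[of i] mid[of "nxt i"] nx \<open>i \<in> S \<and> i < k\<close> by auto
          next
            case iF: False
            thus ?thesis using low[of i] mid[of "nxt i"] nx F(2) \<open>i \<in> S \<and> i < k\<close> by auto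
          qed
          thus ?thesis using Ti False True by simp
        qed
      qed
    qed
    have "area prv b y ?m S = area prv b y m S +
        (\<Sum>i\<in>S. (b i - b (prv i))\<^sup>2 / (2 * ?m i) - (b i - b (prv i))\<^sup>2 / (2 * m i))"
      unfolding area_def sum.distrib[symmetric] by (rule sum.cong) auto
    also have "(\<Sum>i\<in>S. (b i - b (prv i))\<^sup>2 / (2 * ?m i) - (b i - b (prv i))\<^sup>2 / (2 * m i))
        = (\<Sum>i\<in>{i \<in> S. i < f \<and> m i = gm h}. (b i - b (prv i))\<^sup>2 / (2 * ?m i) - (b i - b (prv i))\<^sup>2 / (2 * m i))"
    proof (rule sum.mono_neutral_right[OF fin])
      show "\<forall>i\<in>S - {i \<in> S. i < f \<and> m i = gm h}.
          (b i - b (prv i))\<^sup>2 / (2 * ?m i) - (b i - b (prv i))\<^sup>2 / (2 * m i) = 0"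
      proof
        fix i assume i: "i \<in> S - {i \<in> S. i < f \<and> m i = gm h}"
        hence "?m i = m i" using top[of i] mid[of i] by (cases "i < f") auto
        thus "(b i - b (prv i))\<^sup>2 / (2 * ?m i) - (b i - b (prv i))\<^sup>2 / (2 * m i) = 0" by simp
      qed
    qed auto
    also have "\<dots> = (\<Sum>i\<in>{i \<in> S. i < f \<and> m i = gm h}. (b i - b (prv i))\<^sup>2 * ((1 / c - 1 / gm h) / 2))"
      by (rule sum.cong) (use F c in \<open>auto simp: field_simps\<close>)
    also have "\<dots> = g2 h * (1 / c - 1 / gm h) / 2"
      by (simp add: F(6) square_sum_def sum_distrib_right)
    finally show "E' = area prv b y ?m S" using E E' by simp
    show "\<forall>j\<in>S. j < ?F \<longrightarrow> separated prv b y ?m j"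
    proof (intro ballI impI)
      fix j assume j: "j \<in> S" "j < ?F"
      thus "separated prv b y ?m j"
        using sep[of j] F(2) linked_prv(1)[OF L j(1)] by (auto simp: separated_def)
    qed
    show "\<forall>i\<in>S. ?F \<le> i \<longrightarrow> ?m i = c" by simp
    have "square_sum prv b {i \<in> S. ?F \<le> i} = square_sum prv b {i \<in> S. i < f \<and> m i = gm h} + q"
      unfolding mset q square_sum_def by (rule sum.union_disjoint) (use fin in auto)
    thus "q' = square_sum prv b {i \<in> S. ?F \<le> i}" using q' F(6) by simp
  qed (use L kn H F c in auto)
qed

section \<open>Removing a piece from the list\<close>

lemma square_sum_unchanged:
  "(\<And>i. i \<in> A \<Longrightarrow> prv' i = prv i \<and> b' i = b i \<and> b' (prv i) = b (prv i)) \<Longrightarrow>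
    square_sum prv' b' A = square_sum prv b A"
  unfolding square_sum_def by (rule sum.cong) auto

lemma square_sum_remove:
  "finite A \<Longrightarrow> i \<in> A \<Longrightarrow> square_sum prv b A = (b i - b (prv i))\<^sup>2 + square_sum prv b (A - {i})"
  unfolding square_sum_def by (rule sum.remove)

lemma equiv_rays_delete:
  assumes "\<And>p. 0 \<le> p \<Longrightarrow> p \<le> b i \<Longrightarrow> \<exists>j\<in>S - {i}. p \<le> b j \<and> ray b y m i p \<le> ray b y m j p"
  shows "equiv_rays (S - {i}) b y m S b y m"
  unfolding equiv_rays_def
proof
  show "dominated (S - {i}) b y m S b y m" unfolding dominated_def by blast
  show "dominated S b y m (S - {i}) b y m"
  proof (rule dominatedI)
    fix l p assume "l \<in> S" "0 \<le> p" "p \<le> b l"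
    thus "\<exists>j\<in>S - {i}. p \<le> b j \<and> ray b y m l p \<le> ray b y m j p"
      using assms[of p] by (cases "l = i") auto
  qed
qed

context
  fixes prv nxt S k i j p
  assumes L: "linked prv nxt S k" and i: "i \<in> S" "i < k" and j: "j = nxt i" and p: "p = prv i"
begin

lemma delete_succ: "j \<in> S" "i < j" "prv j = i" "p < i" "p \<in> insert 0 S" "nxt p = i"
  "l \<in> S \<Longrightarrow> l \<noteq> j \<Longrightarrow> prv l \<noteq> i" "l \<in> S \<Longrightarrow> i < l \<Longrightarrow> j \<le> l" "l \<in> S \<Longrightarrow> l < i \<Longrightarrow> l \<le> p"
  "l \<in> S \<Longrightarrow> l < k \<Longrightarrow> nxt l = i \<Longrightarrow> l = p" "j \<le> k" "p < j"
  using linked_nxt[OF L, of i] linked_prv[OF L i(1)] i j p linked_bounds[OF L, of j]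
    linked_prv(3)[OF L, of l] linked_nxt(3)[OF L, of l] by auto

lemma delete_heights: "heights prv b y S \<Longrightarrow> heights (prv(j := p)) b y (S - {i})"
  unfolding heights_def
proof (elim conjE, intro conjI ballI)
  fix l assume H: "\<forall>i\<in>S. b (prv i) < b i \<and> (prv i \<noteq> 0 \<longrightarrow> y i < y (prv i))" and l: "l \<in> S - {i}"
  have 1: "b p < b i" "p \<noteq> 0 \<longrightarrow> y i < y p" using H i(1) p by auto
  have 2: "b i < b j" "y j < y i"
    using bspec[OF H delete_succ(1)] delete_succ(3) linked_bounds[OF L i(1)] by auto
  show "b ((prv(j := p)) l) < b l" using H l 1 2 by (cases "l = j") auto
  show "(prv(j := p)) l \<noteq> 0 \<longrightarrow> y l < y ((prv(j := p)) l)" using H l 1 2 by (cases "l = j") auto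
qed

lemma delete_square_sum_other:
  "A \<subseteq> S \<Longrightarrow> j \<notin> A \<Longrightarrow> square_sum (prv(j := p)) b A = square_sum prv b A"
  by (rule square_sum_unchanged) auto

lemma delete_square_sum_succ:
  assumes "A \<subseteq> S" "j \<in> A"
  shows "square_sum (prv(j := p)) b A = square_sum prv b A
    + 2 * (b j - b i) * (b i - b p) + (b i - b p)\<^sup>2"
proof -
  have fin: "finite A" using assms(1) linked_finite[OF L] finite_subset by blast
  have "square_sum (prv(j := p)) b (A - {j}) = square_sum prv b (A - {j})"
    by (rule delete_square_sum_other) (use assms in auto)
  thus ?thesis
    using square_sum_remove[OF fin assms(2), of "prv(j := p)" b] square_sum_remove[OF fin assms(2), of prv b]
      delete_succ(3) by (simp add: power2_eq_square algebra_simps)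
qed

text \<open>The successor takes over the interval of \<open>i\<close>. Both rates are kept in the
  formula: inside a group they agree and the last term vanishes, while at the boundary to the stack
  they differ.\<close>

lemma delete_area:
  assumes "0 < m i" "0 < m j"
  shows "area (prv(j := p)) b y m (S - {i}) = area prv b y m S
    + (y j - y i) * (b i - b p) + (b j - b i) * (b i - b p) / m j
    + (b i - b p)\<^sup>2 * (1 / m j - 1 / m i) / 2"
proof -
  have fin: "finite S" by (rule linked_finite[OF L])
  define F where "F = (\<lambda>prv l. y l * (b l - b (prv l)) + (b l - b (prv l))\<^sup>2 / (2 * m l))"
  have "area (prv(j := p)) b y m (S - {i}) = F (prv(j := p)) j + sum (F (prv(j := p))) (S - {i} - {j})"
    unfolding area_def F_def by (rule sum.remove) (use fin delete_succ in auto)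
  also have "sum (F (prv(j := p))) (S - {i} - {j}) = sum (F prv) (S - {i} - {j})"
    by (rule sum.cong) (auto simp: F_def)
  also have "\<dots> = sum (F prv) (S - {i}) - F prv j"
    using sum.remove[of "S - {i}" j "F prv"] fin delete_succ by simp
  also have "sum (F prv) (S - {i}) = sum (F prv) S - F prv i"
    using sum.remove[of S i "F prv"] fin i by simp
  also have "sum (F prv) S = area prv b y m S" by (simp add: area_def F_def)
  finally have "area (prv(j := p)) b y m (S - {i})
      = area prv b y m S + (F (prv(j := p)) j - F prv j - F prv i)"
    by (simp del: fun_upd_apply)
  also have "F (prv(j := p)) j - F prv j - F prv i
      = (y j - y i) * (b i - b p) + (b j - b i) * (b i - b p) / m j
    + (b i - b p)\<^sup>2 * (1 / m j - 1 / m i) / 2"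
    using delete_succ(3) p assms by (simp add: F_def power2_eq_square field_simps)
  finally show ?thesis by (simp del: fun_upd_apply)
qed

lemma delete_separated:
  assumes "l \<in> S - {i}" "l \<noteq> j"
  shows "separated (prv(j := p)) b y m l = separated prv b y m l"
  using assms by (simp add: separated_def)

end

text \<open>A threshold of at least \<open>c\<close> means that the ray of \<open>j\<close>, at rate
  \<open>c\<close>, reaches the end point of \<open>i\<close>; the two rays being parallel,
  \<open>i\<close> is covered. Such a leaf cannot belong to the stack, where strict separation keeps
  thresholds below rates that are themselves below \<open>c\<close>. If \<open>i\<close> is the
  first piece of the last group, its predecessor is linked across the boundary and gets no
  threshold.\<close>

lemma step_inv_delete:
  assumes I: "step_inv S m k n c prv nxt b y gf gm g2 u f h q E" and h: "\<And>l. 1 \<le> l \<Longrightarrow> l \<le> h \<Longrightarrow> gm l < c"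
    and i: "i \<le> n" "c \<le> u i" and j: "j = nxt i" and p: "p = prv i"
    and q': "q' = q + 2 * (b j - b i) * (b i - b p)"
    and E': "E' = E + (y j - y i) * (b i - b p) + (b j - b i) * (b i - b p) / c"
    and u': "u' = (if i = f then u(i := 0) else u(i := 0, p := (b j - b p) / (y p - y j)))"
    and f': "f' = (if i = f then j else f)"
  shows "step_inv (S - {i}) m k n c (prv(j := p)) (nxt(p := j)) b y gf gm g2 u' f' h q' E'"
    and "equiv_rays (S - {i}) b y (\<lambda>i. min (m i) c) S b y (\<lambda>i. min (m i) c)"
    and "i \<in> S" "i < k" "i \<noteq> f \<Longrightarrow> p \<le> n" "f \<le> i"
proof -
  have L: "linked prv nxt S k" and kn: "k \<le> n" and H: "heights prv b y S" and V: "levels prv b m S f h gf gm g2"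
    and T: "thresholds nxt b y m S k f n u" and E: "E = area prv b y m S"
    and sep: "\<And>j. j \<in> S \<Longrightarrow> j < f \<Longrightarrow> separated prv b y m j"
    and f: "f \<in> S" and c: "0 < c" and top: "\<And>i. i \<in> S \<Longrightarrow> f \<le> i \<Longrightarrow> m i = c"
    and q: "q = square_sum prv b {i \<in> S. f \<le> i}"
    using I by (auto simp: step_inv_def)
  have Ti: "u l = (if l \<in> S \<and> l < k \<and> (f \<le> l \<or> nxt l < f \<and> m l = m (nxt l))
      then (b (nxt l) - b l) / (y l - y (nxt l)) else 0)" if "l \<le> n" for l
    using T that by (auto simp: thresholds_def)
  have ui: "i \<in> S" "i < k" "f \<le> i \<or> nxt i < f \<and> m i = m (nxt i)" "u i = (b j - b i) / (y i - y j)"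
    using Ti[OF i(1)] i(2) c j by (auto split: if_splits)
  show "i \<in> S" "i < k" by fact+
  note D = delete_succ[OF L ui(1,2) j p]
  have i0: "1 \<le> i" using linked_bounds[OF L ui(1)] by simp
  have yb: "y j < y i" "b i < b j" using H D(1,3) i0 unfolding heights_def by fastforce+
  have uc: "c * (y i - y j) \<le> b j - b i"
    using i(2) yb unfolding ui(4) by (simp add: field_simps)
  show fi: "f \<le> i"
  proof (rule ccontr)
    assume "\<not> f \<le> i"
    hence jf: "j < f" "m i = m j" using ui j by auto
    have s: "y j + (b j - b i) / m j < y i"
      using sep[OF D(1) jf(1)] D(3) i0 jf(2) by (simp add: separated_def)
    obtain l where "1 \<le> l" "l \<le> h" "m j = gm l" using levels_ex[OF V D(1) jf(1)] by blast
    hence mj: "0 < m j" "m j < c" using levels_group(4)[OF V] h by auto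
    have "(b j - b i) < m j * (y i - y j)" using s mj by (simp add: field_simps)
    also have "\<dots> < c * (y i - y j)" using mj yb by simp
    finally show False using uc by simp
  qed
  have fj: "f \<le> j" "m j = c" "m i = c" using fi D top ui by auto
  have fin: "finite S" by (rule linked_finite[OF L])
  have pf: "i = f \<Longrightarrow> p < f" "i \<noteq> f \<Longrightarrow> f \<le> p" using D(4) D(9)[of f] fi f by auto
  have pS: "p \<in> S" if "i \<noteq> f" using D(5) pf(2)[OF that] linked_bounds[OF L f] by auto
  show "p \<le> n" if "i \<noteq> f" using D(4) ui(2) kn by simp
  show "equiv_rays (S - {i}) b y (\<lambda>i. min (m i) c) S b y (\<lambda>i. min (m i) c)"
  proof (rule equiv_rays_delete)
    fix q assume "0 \<le> q" "q \<le> b i"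
    have "y i \<le> y j + (b j - b i) / c" using uc c by (simp add: field_simps)
    hence "ray b y (\<lambda>i. min (m i) c) i q \<le> ray b y (\<lambda>i. min (m i) c) j q"
      using fj by (simp add: ray_def diff_divide_distrib)
    thus "\<exists>j\<in>S - {i}. q \<le> b j \<and> ray b y (\<lambda>i. min (m i) c) i q \<le> ray b y (\<lambda>i. min (m i) c) j q"
      using D(1,2) yb \<open>q \<le> b i\<close> by (intro bexI[of _ j]) auto
  qed
  have ff: "f \<le> f'" using f' D fj by auto
  have lowset: "l \<in> S - {i} \<and> l < f' \<longleftrightarrow> l \<in> S \<and> l < f" for l
    using f' fi fj(1) D(2) D(8)[of l] by (cases "l < i"; cases "l = i") auto
  have topset: "{l \<in> S - {i}. f' \<le> l} = {l \<in> S. f \<le> l} - {i}"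
    using lowset ui(1) fi f' ff by (auto simp: not_less[symmetric] split: if_splits)
  show "step_inv (S - {i}) m k n c (prv(j := p)) (nxt(p := j)) b y gf gm g2 u' f' h q' E'"
    unfolding step_inv_def
  proof (intro conjI)
    show "linked (prv(j := p)) (nxt(p := j)) (S - {i}) k"
      using linked_delete[OF L ui(1,2)] j p by simp
    show "heights (prv(j := p)) b y (S - {i})" by (rule delete_heights[OF L ui(1,2) j p H])
    show "levels (prv(j := p)) b m (S - {i}) f' h gf gm g2"
    proof (rule levels_cong[OF V])
      fix A assume "A \<subseteq> {i \<in> S. i < f}"
      thus "square_sum (prv(j := p)) b A = square_sum prv b A"
        by (intro delete_square_sum_other[OF L ui(1,2) j p]) (use fj in auto)
    qed (use lowset in auto)
    show "thresholds (nxt(p := j)) b y m (S - {i}) k f' n u'"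
      unfolding thresholds_def
    proof (intro allI impI)
      fix l assume l: "l \<le> n"
      show "u' l = (if l \<in> S - {i} \<and> l < k \<and> (f' \<le> l \<or> (nxt(p := j)) l < f' \<and> m l = m ((nxt(p := j)) l))
        then (b ((nxt(p := j)) l) - b l) / (y l - y ((nxt(p := j)) l)) else 0)"
      proof (cases "l \<in> S - {i} \<and> l < k")
        case False
        have "u' l = 0"
        proof (cases "l = i")
          case True
          thus ?thesis using u' D(4) by auto
        next
          case l': False
          hence "\<not> (l \<in> S \<and> l < k)" using False by blast
          hence "u l = 0" using Ti[OF l] by auto
          moreover have "i = f \<or> l \<noteq> p" using \<open>\<not> (l \<in> S \<and> l < k)\<close> pS D(4) ui(2) by auto
          ultimately show ?thesis using u' l' by auto
        qed
        thus ?thesis using False by auto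
      next
        case True
        show ?thesis
        proof (cases "l = p")
          case True
          show ?thesis
          proof (cases "i = f")
            case True
            have "u' p = u p" using u' True D(4) by simp
            moreover have "u p = 0" using Ti[of p] l \<open>l = p\<close> pf(1)[OF True] D(6) True by auto
            moreover have "p < j" "\<not> j \<le> p" using D(12) by auto
            ultimately show ?thesis using \<open>l = p\<close> f' True by auto
          next
            case False
            have "u' p = (b j - b p) / (y p - y j)" using u' False D(4) by simp
            moreover have "f' = f" "f \<le> p" "p \<in> S - {i}" "p < k"
              using f' False pf(2) pS D(4) ui(2) by auto
            ultimately show ?thesis using \<open>l = p\<close> by auto
          qed
        next
          case False
          have nl: "nxt l \<in> S" "nxt l \<noteq> i" using linked_nxt(1)[OF L, of l] D(10)[of l] True False by auto
          have "u' l = u l" using True False u' by auto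
          moreover have "l < f' \<longleftrightarrow> l < f" "nxt l < f' \<longleftrightarrow> nxt l < f"
            using lowset[of l] lowset[of "nxt l"] nl True by auto
          hence "f' \<le> l \<longleftrightarrow> f \<le> l" "nxt l < f' \<longleftrightarrow> nxt l < f" by auto
          moreover have "(nxt(p := j)) l = nxt l" "l \<in> S" "l \<in> S - {i}" using False True by auto
          ultimately show ?thesis using Ti[OF l] by presburger
        qed
      qed
    qed
    show "E' = area (prv(j := p)) b y m (S - {i})"
      using delete_area[OF L ui(1,2) j p, of m b y] fj c E E' by simp
    show "\<forall>l\<in>S - {i}. l < f' \<longrightarrow> separated (prv(j := p)) b y m l"
    proof (intro ballI impI)
      fix l assume l: "l \<in> S - {i}" "l < f'"
      hence "l < f" using lowset by blast
      thus "separated (prv(j := p)) b y m l"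
        using delete_separated[OF L ui(1,2) j p l(1), of b y m] sep[of l] l fj by auto
    qed
    show "f' \<in> S - {i}" using f' f D by auto
    show "\<forall>l\<in>S - {i}. f' \<le> l \<longrightarrow> m l = c" using top ff by auto
    have "square_sum (prv(j := p)) b ({l \<in> S. f \<le> l} - {i}) = square_sum prv b ({l \<in> S. f \<le> l} - {i})
        + 2 * (b j - b i) * (b i - b p) + (b i - b p)\<^sup>2"
      by (rule delete_square_sum_succ[OF L ui(1,2) j p]) (use D fj in auto)
    moreover have "q = (b i - b p)\<^sup>2 + square_sum prv b ({l \<in> S. f \<le> l} - {i})"
      using square_sum_remove[of "{l \<in> S. f \<le> l}" i prv b] fin ui(1) fi q p by simp
    ultimately show "q' = square_sum (prv(j := p)) b {l \<in> S - {i}. f' \<le> l}"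
      unfolding topset using q' by simp
  qed (use kn c in auto)
qed

section \<open>The boundary between the stack and the last group\<close>

context
  fixes S m k n c prv nxt b y gf gm g2 u f h q E i p
  assumes I: "step_inv S m k n c prv nxt b y gf gm g2 u f h q E"
    and h: "0 < h" "\<And>l. 1 \<le> l \<Longrightarrow> l \<le> h \<Longrightarrow> gm l < c"
    and top_sep: "\<And>j. j \<in> S \<Longrightarrow> f < j \<Longrightarrow> separated prv b y m j"
    and i: "i = prv f" and p: "p = prv i"
begin

text \<open>The program stores no rate for single pieces. Whether \<open>p\<close> belongs to the
  same group as \<open>i\<close> is decided by comparing \<open>i\<close> with \<open>gf h\<close>,
  which the facts on \<open>m p\<close> justify.\<close>

lemma boundary:
  shows "linked prv nxt S k" "k \<le> n" "heights prv b y S" "levels prv b m S f h gf gm g2"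
    "f \<in> S" "0 < c" "\<And>i. i \<in> S \<Longrightarrow> f \<le> i \<Longrightarrow> m i = c" "f \<le> k"
    "i \<in> S" "i < f" "i < k" "nxt i = f" "m i = gm h" "0 < gm h" "gm h < c" "gf h \<le> i" "f \<noteq> i"
    "p < i" "i \<noteq> gf h \<Longrightarrow> p \<in> S \<and> p \<noteq> 0 \<and> m p = m i" "i = gf h \<Longrightarrow> p \<in> S \<Longrightarrow> m p \<noteq> m i"
    "separated prv b y m i" "p \<in> S \<Longrightarrow> m p \<le> m i" "p \<in> S \<Longrightarrow> 0 < m p" "p \<in> insert 0 S"
    "i \<noteq> 0" "0 \<notin> S" "nxt p = i"
proof -
  show L: "linked prv nxt S k" and "k \<le> n" and H: "heights prv b y S" and V: "levels prv b m S f h gf gm g2"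
    and f: "f \<in> S" and c: "0 < c" and top: "\<And>i. i \<in> S \<Longrightarrow> f \<le> i \<Longrightarrow> m i = c"
    using I by (auto simp: step_inv_def)
  show fk: "f \<le> k" using linked_bounds[OF L f] by simp
  have h': "1 \<le> h" using h by simp
  note F = levels_group[OF V h' order_refl]
  show iS: "i \<in> S" and ii: "i < f" and Fi: "gf h \<le> i" and "nxt i = f" "f \<noteq> i"
    using linked_prv[OF L f] F linked_bounds[OF L F(1)] i by fastforce+
  show "i < k" using ii fk by simp
  show "0 < gm h" "gm h < c" using F h h' by auto
  obtain l where l: "1 \<le> l" "l \<le> h" "m i = gm l" using levels_ex[OF V iS ii] by blast
  have "gm h \<le> m i" using levels_mono[OF V F(1) iS Fi ii] F(3) by simp
  moreover have "gm l \<le> gm h" using levels_strict[OF V l(1), of h] l(2) by (cases "l = h") auto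
  ultimately show mi: "m i = gm h" using l(3) by simp
  show pi: "p < i" and "p \<in> insert 0 S" and "nxt p = i" using linked_prv[OF L iS] p by auto
  show "i \<noteq> 0" "0 \<notin> S" using linked_bounds[OF L iS] linked_bounds[OF L, of 0] by auto
  show "separated prv b y m i" using I iS ii by (auto simp: step_inv_def)
  show le: "p \<in> S \<Longrightarrow> m p \<le> m i" using levels_mono[OF V _ iS] pi ii by simp
  show "p \<in> S \<Longrightarrow> 0 < m p" using levels_ex[OF V, of p] levels_group(4)[OF V] pi ii by fastforce
  show "i = gf h \<Longrightarrow> p \<in> S \<Longrightarrow> m p \<noteq> m i"
    using F(5)[of p] pi ii mi by auto
  show "i \<noteq> gf h \<Longrightarrow> p \<in> S \<and> p \<noteq> 0 \<and> m p = m i"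
  proof -
    assume ne: "i \<noteq> gf h"
    hence "gf h \<le> p" using linked_prv(4)[OF L iS F(1)] Fi p by simp
    moreover have "1 \<le> gf h" using linked_bounds[OF L F(1)] by simp
    ultimately have pS: "p \<in> S" "p \<noteq> 0" using linked_prv(2)[OF L iS] p by auto
    have "m (gf h) \<le> m p" using levels_mono[OF V F(1) pS(1) \<open>gf h \<le> p\<close>] pi ii by simp
    thus "p \<in> S \<and> p \<noteq> 0 \<and> m p = m i" using le[OF pS(1)] pS F(3) mi by simp
  qed
qed

lemma boundary_others:
  "l \<in> S \<Longrightarrow> l \<noteq> f \<Longrightarrow> prv l \<noteq> i" "l \<in> S \<Longrightarrow> l < f \<Longrightarrow> l \<le> i"
  "l \<in> S \<Longrightarrow> l < k \<Longrightarrow> nxt l = i \<Longrightarrow> l = p"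
  using linked_prv[OF boundary(1), of l] linked_prv(4)[OF boundary(1,5), of l] boundary(12) i p
    linked_nxt(3)[OF boundary(1), of l] by auto

lemma boundary_thresholds:
  "l \<le> n \<Longrightarrow> u l = (if l \<in> S \<and> l < k \<and> (f \<le> l \<or> nxt l < f \<and> m l = m (nxt l))
      then (b (nxt l) - b l) / (y l - y (nxt l)) else 0)"
  using I by (auto simp: step_inv_def thresholds_def)

text \<open>\<open>x\<close> is the crossing of the rays of \<open>i\<close> and \<open>f\<close>.
  To its left the steeper ray of \<open>i\<close> is higher, to its right the ray of
  \<open>f\<close>. So the end point of \<open>i\<close> slides along its own ray to
  \<open>(x, y')\<close>, which leaves that ray unchanged as a function, and \<open>f\<close> grows
  to the left. Besides the two lengths, only the threshold of \<open>p\<close> is affected, and only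
  if \<open>p\<close> lies in the same group.\<close>

lemma step_inv_cut:
  assumes x: "b p < x" "x < b i"
    and y': "y' = y i + (b i - x) / gm h" "y' = y f + (b f - x) / c"
    and q': "q' = q + 2 * (b f - b i) * (b i - x) + (b i - x)\<^sup>2"
    and E': "E' = E + (y f - y i) * (b i - x) + (b f - b i) * (b i - x) / c
      + (b i - x)\<^sup>2 * (1 / c - 1 / gm h) / 2"
    and g2': "g2' = g2(h := g2 h - 2 * (b i - b p) * (b i - x) + (b i - x)\<^sup>2)"
    and u': "u' = (if i = gf h then u else u(p := (x - b p) / (y p - y')))"
  shows "step_inv S m k n c prv nxt (b(i := x)) (y(i := y')) gf gm g2' u' f h q' E'"
    and "\<And>j. j \<in> S \<Longrightarrow> separated prv (b(i := x)) (y(i := y')) m j"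
    and "equiv_rays S (b(i := x)) (y(i := y')) (\<lambda>i. min (m i) c) S b y (\<lambda>i. min (m i) c)"
    and "i \<noteq> gf h \<Longrightarrow> p \<le> n"
proof -
  let ?b = "b(i := x)" and ?y = "y(i := y')"
  note B = boundary and O = boundary_others
  have pi: "p \<noteq> i" "f \<noteq> i" using B(18,10) by auto
  show "i \<noteq> gf h \<Longrightarrow> p \<le> n" using B(2,11,18) by simp
  have fin: "finite S" by (rule linked_finite[OF B(1)])
  have bf: "b i < b f" "y f < y i" "b p < b i" "p \<noteq> 0 \<longrightarrow> y i < y p"
  proof -
    have H: "b (prv l) < b l \<and> (prv l \<noteq> 0 \<longrightarrow> y l < y (prv l))" if "l \<in> S" for l
      using B(3) that by (simp add: heights_def)
    show "b i < b f" "y f < y i" "b p < b i" "p \<noteq> 0 \<longrightarrow> y i < y p"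
      using H[OF B(5)] H[OF B(9)] B(25) unfolding i[symmetric] p[symmetric] by simp_all
  qed
  have yy: "y i < y'" using y'(1) x B(14) by simp
  have sep_i: "p \<noteq> 0 \<longrightarrow> y i + (b i - b p) / m i \<le> y p \<and> (m p = m i \<longrightarrow> y i + (b i - b p) / m i < y p)"
    using B(21) by (simp add: separated_def p)
  have line: "y' + (x - z) / gm h = y i + (b i - z) / gm h" for z
    unfolding y'(1) by (simp add: diff_divide_distrib)
  have y'p: "y' < y p" if "p \<noteq> 0"
  proof -
    have "y' + (x - b p) / gm h \<le> y p" using line[of "b p"] sep_i that B(13) by simp
    moreover have "0 < (x - b p) / gm h" using x B(14) by simp
    ultimately show ?thesis by linarith
  qed
  have unch: "?b l = b l" "?y l = y l" "?b (prv l) = b (prv l)" "?y (prv l) = y (prv l)"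
    if "l \<in> S" "l \<noteq> i" "l \<noteq> f" for l using that O(1)[of l] by auto
  show sep: "separated prv ?b ?y m j" if j: "j \<in> S" for j
  proof -
    consider "j = i" | "j = f" | "j \<noteq> i" "j \<noteq> f" by blast
    thus ?thesis
    proof cases
      case 1
      have "y' + (x - b p) / m i = y i + (b i - b p) / m i" using line[of "b p"] B(13) by simp
      thus ?thesis using 1 sep_i pi by (simp add: separated_def p[symmetric])
    next
      case 2
      have "m i \<noteq> m f" using B(13,15) B(7)[OF B(5)] by simp
      thus ?thesis using 2 y'(2) B(7)[OF B(5)] pi by (simp add: separated_def i[symmetric])
    next
      case 3
      have "separated prv b y m j"
        using 3 j top_sep[of j] I by (cases "j < f") (auto simp: step_inv_def)
      thus ?thesis using unch[OF j 3] by (simp add: separated_def)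
    qed
  qed
  have mf: "m f = c" by (rule B(7)[OF B(5)]) simp
  have ray_i: "ray ?b ?y mm i z = ray b y mm i z" if "mm i = gm h" for mm z
    using line[of z] that by (simp add: ray_def)
  have ray_o: "ray ?b ?y mm l z = ray b y mm l z" if "l \<noteq> i" for mm l z
    using that by (simp add: ray_def)
  let ?mm = "\<lambda>i. min (m i) c"
  have mmi: "?mm i = gm h" using B(13,15) by simp
  show "equiv_rays S ?b ?y ?mm S b y ?mm"
    unfolding equiv_rays_def
  proof
    show "dominated S ?b ?y ?mm S b y ?mm"
    proof (rule dominatedI)
      fix l z assume l: "l \<in> S" "0 \<le> z" "z \<le> ?b l"
      have "ray ?b ?y ?mm l z = ray b y ?mm l z" using ray_i[of ?mm z] mmi ray_o[of l ?mm] by (cases "l = i") auto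
      moreover have "z \<le> b l" using l(3) x by (cases "l = i") auto
      ultimately show "\<exists>j\<in>S. z \<le> b j \<and> ray ?b ?y ?mm l z \<le> ray b y ?mm j z" using l by auto
    qed
    show "dominated S b y ?mm S ?b ?y ?mm"
    proof (rule dominatedI)
      fix l z assume l: "l \<in> S" "0 \<le> z" "z \<le> b l"
      show "\<exists>j\<in>S. z \<le> ?b j \<and> ray b y ?mm l z \<le> ray ?b ?y ?mm j z"
      proof (cases "l = i")
        case False
        thus ?thesis using l ray_o[of l ?mm z] by (intro bexI[of _ l]) auto
      next
        case True
        show ?thesis
        proof (cases "z \<le> x")
          case True
          thus ?thesis using l ray_i[of ?mm z] mmi \<open>l = i\<close> by (intro bexI[of _ i]) auto
        next
          case False
          have "ray b y ?mm i z = y' + (x - z) / gm h" using line[of z] mmi by (simp add: ray_def)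
          also have "\<dots> \<le> y' + (x - z) / c"
          proof -
            have "(z - x) / c \<le> (z - x) / gm h" using False B(14,15) by (intro divide_left_mono) auto
            thus ?thesis by (simp add: diff_divide_distrib)
          qed
          also have "\<dots> = ray b y ?mm f z" using y'(2) mf by (simp add: ray_def diff_divide_distrib)
          finally have "ray b y ?mm l z \<le> ray ?b ?y ?mm f z" using ray_o[of f ?mm z] pi True by simp
          moreover have "z \<le> ?b f" using l True bf pi by simp
          ultimately show ?thesis using B(5) by blast
        qed
      qed
    qed
  qed
  have sqo: "square_sum prv ?b A = square_sum prv b A" if "A \<subseteq> S" "f \<notin> A" "i \<notin> A" for A
  proof (rule square_sum_unchanged)
    fix l assume "l \<in> A"
    hence l: "l \<in> S" "l \<noteq> i" "l \<noteq> f" using that by auto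
    show "prv l = prv l \<and> ?b l = b l \<and> ?b (prv l) = b (prv l)" using unch[OF l] by blast
  qed
  have sqi: "square_sum prv ?b A = square_sum prv b A - 2 * (b i - b p) * (b i - x) + (b i - x)\<^sup>2"
    if "A \<subseteq> S" "i \<in> A" "f \<notin> A" for A
  proof -
    have finA: "finite A" using that(1) fin finite_subset by blast
    have "square_sum prv ?b (A - {i}) = square_sum prv b (A - {i})"
      by (rule sqo) (use that in auto)
    thus ?thesis
      using square_sum_remove[OF finA that(2), of prv ?b] square_sum_remove[OF finA that(2), of prv b] pi p
      by (simp add: power2_eq_square algebra_simps)
  qed
  have sqf: "square_sum prv ?b A = square_sum prv b A + 2 * (b f - b i) * (b i - x) + (b i - x)\<^sup>2"
    if "A \<subseteq> S" "f \<in> A" "i \<notin> A" for A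
  proof -
    have finA: "finite A" using that(1) fin finite_subset by blast
    have "square_sum prv ?b (A - {f}) = square_sum prv b (A - {f})"
      by (rule sqo) (use that in auto)
    thus ?thesis
      using square_sum_remove[OF finA that(2), of prv ?b] square_sum_remove[OF finA that(2), of prv b] pi i
      by (simp add: power2_eq_square algebra_simps)
  qed
  show "step_inv S m k n c prv nxt ?b ?y gf gm g2' u' f h q' E'"
    unfolding step_inv_def
  proof (intro conjI)
    show "heights prv ?b ?y S"
      unfolding heights_def
    proof (intro conjI ballI)
      show "?b 0 = 0" using B(3,25) by (auto simp: heights_def)
      fix l assume l: "l \<in> S"
      consider "l = i" | "l = f" | "l \<noteq> i" "l \<noteq> f" by blast
      hence "?b (prv l) < ?b l \<and> (prv l \<noteq> 0 \<longrightarrow> ?y l < ?y (prv l))"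
      proof cases
        case 1
        thus ?thesis using x y'p pi by (auto simp: p[symmetric])
      next
        case 2
        thus ?thesis using x bf yy pi by (auto simp: i[symmetric])
      next
        case 3
        thus ?thesis using unch[OF l 3] B(3) l by (simp add: heights_def)
      qed
      thus "?b (prv l) < ?b l" "prv l \<noteq> 0 \<longrightarrow> ?y l < ?y (prv l)" by auto
    qed
    show "levels prv ?b m S f h gf gm g2'"
      unfolding levels_def
    proof (intro conjI ballI allI impI)
      fix l assume "l \<in> {1..h}"
      hence l: "1 \<le> l" "l \<le> h" by auto
      note g = levels_group[OF B(4) l]
      show "gf l \<in> S" "gf l < f" "m (gf l) = gm l" "0 < gm l" using g by auto
      show "gf l \<le> i'" if "i' \<in> S" "i' < f \<and> m i' = gm l" for i' using g(5)[of i'] that by auto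
      show "g2' l = square_sum prv ?b {i \<in> S. i < f \<and> m i = gm l}"
      proof (cases "l = h")
        case True
        thus ?thesis using g(6) sqi[of "{i \<in> S. i < f \<and> m i = gm l}"] B(9,10,13) g2' by simp
      next
        case False
        hence "m i \<noteq> gm l" using levels_strict[OF B(4), of l h] l B(13) by auto
        thus ?thesis using g(6) sqo[of "{i \<in> S. i < f \<and> m i = gm l}"] False g2' by simp
      qed
    next
      fix l l' assume "1 \<le> l \<and> l < l' \<and> l' \<le> h"
      thus "gm l < gm l'" using levels_strict[OF B(4)] by blast
    next
      fix i' assume "i' \<in> S" "i' < f"
      thus "\<exists>l\<in>{1..h}. m i' = gm l" using levels_ex[OF B(4)] by (metis atLeastAtMost_iff)
    next
      fix i' j' assume "i' \<in> S" "j' \<in> S" "i' \<le> j' \<and> j' < f"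
      thus "m i' \<le> m j'" using levels_mono[OF B(4), of i' j'] by auto
    qed
    show "thresholds nxt ?b ?y m S k f n u'"
      unfolding thresholds_def
    proof (intro allI impI)
      fix l assume l: "l \<le> n"
      note T = boundary_thresholds[OF l]
      show "u' l = (if l \<in> S \<and> l < k \<and> (f \<le> l \<or> nxt l < f \<and> m l = m (nxt l))
        then (?b (nxt l) - ?b l) / (?y l - ?y (nxt l)) else 0)"
      proof (cases "l = p \<and> i \<noteq> gf h")
        case True
        thus ?thesis using u' B(10,11,18,19,27) pi by auto
      next
        case False
        hence u'l: "u' l = u l" using u' by auto
        show ?thesis
        proof (cases "l \<in> S \<and> l < k \<and> (f \<le> l \<or> nxt l < f \<and> m l = m (nxt l))")
          case True
          have "l \<noteq> i" using True B(10,12) by auto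
          moreover have "nxt l \<noteq> i"
          proof
            assume "nxt l = i"
            hence lp: "l = p" using O(3) True by blast
            hence "m p = m i" using True B(10,18) \<open>nxt l = i\<close> by auto
            thus False using lp False True B(20) by auto
          qed
          ultimately show ?thesis using T u'l True by simp
        qed (use T u'l in auto)
      qed
    qed
    have E: "E = area prv b y m S" using I by (simp add: step_inv_def)
    define F where "F = (\<lambda>b y l. y l * (b l - b (prv l)) + (b l - b (prv l))\<^sup>2 / (2 * m l))"
    have ar: "area prv b y m S = F b y i + F b y f + sum (F b y) (S - {i} - {f})" for b y
    proof -
      have "area prv b y m S = sum (F b y) S" by (simp add: area_def F_def)
      also have "\<dots> = F b y i + sum (F b y) (S - {i})" by (rule sum.remove[OF fin B(9)])
      also have "sum (F b y) (S - {i}) = F b y f + sum (F b y) (S - {i} - {f})"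
        by (rule sum.remove) (use fin B(5) pi in auto)
      finally show ?thesis by simp
    qed
    have "sum (F ?b ?y) (S - {i} - {f}) = sum (F b y) (S - {i} - {f})"
    proof (rule sum.cong[OF refl])
      fix l assume "l \<in> S - {i} - {f}"
      hence l: "l \<in> S" "l \<noteq> i" "l \<noteq> f" by auto
      show "F ?b ?y l = F b y l" unfolding F_def unch[OF l] ..
    qed
    hence "area prv ?b ?y m S = E + (F ?b ?y i - F b y i) + (F ?b ?y f - F b y f)"
      using ar[of ?b ?y] ar[of b y] E by simp
    moreover have "F ?b ?y i = y' * (x - b p) + (x - b p)\<^sup>2 / (2 * gm h)"
      "F b y i = y i * (b i - b p) + (b i - b p)\<^sup>2 / (2 * gm h)"
      "F ?b ?y f = y f * (b f - x) + (b f - x)\<^sup>2 / (2 * c)"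
      "F b y f = y f * (b f - b i) + (b f - b i)\<^sup>2 / (2 * c)"
      using pi mf B(13) by (simp_all add: F_def p[symmetric] i[symmetric])
    moreover have "y' * (x - b p) + (x - b p)\<^sup>2 / (2 * gm h) - (y i * (b i - b p) + (b i - b p)\<^sup>2 / (2 * gm h))
        = - y i * (b i - x) - (b i - x)\<^sup>2 / (2 * gm h)"
      unfolding y'(1) using B(14) by (simp add: power2_eq_square field_simps)
    moreover have "y f * (b f - x) + (b f - x)\<^sup>2 / (2 * c) - (y f * (b f - b i) + (b f - b i)\<^sup>2 / (2 * c))
        = y f * (b i - x) + (b f - b i) * (b i - x) / c + (b i - x)\<^sup>2 / (2 * c)"
      using B(6) by (simp add: power2_eq_square field_simps)
    moreover have "(b i - x)\<^sup>2 * (1 / c - 1 / gm h) / 2 = (b i - x)\<^sup>2 / (2 * c) - (b i - x)\<^sup>2 / (2 * gm h)"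
      using B(6,14) by (simp add: field_simps)
    moreover have "(y f - y i) * (b i - x) = y f * (b i - x) - y i * (b i - x)"
      by (rule left_diff_distrib)
    ultimately show "E' = area prv ?b ?y m S" unfolding E' by linarith
    show "\<forall>j\<in>S. j < f \<longrightarrow> separated prv ?b ?y m j" using sep by blast
    show "q' = square_sum prv ?b {i \<in> S. f \<le> i}"
      using sqf[of "{i \<in> S. f \<le> i}"] B(5,10) q' I by (simp add: step_inv_def)
  qed (use B(1,2,5,6,7) in simp_all)
qed

text \<open>If the ray of \<open>f\<close> is not lower even at \<open>b p\<close>, it covers the
  whole piece \<open>i\<close>, because the ray of \<open>i\<close> falls faster to the right. Left
  of \<open>b p\<close> the ray of \<open>i\<close> is covered by that of \<open>p\<close>, by
  separation. The new link from \<open>p\<close> to \<open>f\<close> crosses the boundary, hence the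
  threshold 0; if \<open>i\<close> was the only piece of its group, the group is popped.\<close>

lemma step_inv_absorb:
  assumes le: "y i + (b i - b p) / gm h \<le> y f + (b f - b p) / c"
    and q': "q' = q + 2 * (b f - b i) * (b i - b p) + (b i - b p)\<^sup>2"
    and E': "E' = E + (y f - y i) * (b i - b p) + (b f - b i) * (b i - b p) / c
      + (b i - b p)\<^sup>2 * (1 / c - 1 / gm h) / 2"
    and g2': "g2' = g2(h := g2 h - 2 * (b i - b p) * (b i - b p) + (b i - b p)\<^sup>2)"
    and h': "h' = (if i = gf h then h - 1 else h)"
    and u': "u' = (if i = gf h then u else u(p := 0))"
  shows "step_inv (S - {i}) m k n c (prv(f := p)) (nxt(p := f)) b y gf gm g2' u' f h' q' E'"
    and "\<And>j. j \<in> S - {i} \<Longrightarrow> f < j \<Longrightarrow> separated (prv(f := p)) b y m j"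
    and "equiv_rays (S - {i}) b y (\<lambda>i. min (m i) c) S b y (\<lambda>i. min (m i) c)"
    and "i \<noteq> gf h \<Longrightarrow> p \<le> n" "i \<in> S"
proof -
  note B = boundary and O = boundary_others
  have fx: "f = nxt i" using B(12) by simp
  note D = delete_succ[OF B(1,9,11) fx p]
  have mf: "m f = c" by (rule B(7)[OF B(5)]) simp
  have pi: "p \<noteq> i" "f \<noteq> i" using B(18,10) by auto
  show "i \<noteq> gf h \<Longrightarrow> p \<le> n" using B(2,11,18) by simp
  show "i \<in> S" by (rule B(9))
  have fin: "finite S" by (rule linked_finite[OF B(1)])
  have bf: "b i < b f" "b p < b i"
  proof -
    have H: "b (prv l) < b l" if "l \<in> S" for l
      using B(3) that by (simp add: heights_def)
    show "b i < b f" "b p < b i"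
      using H[OF B(5)] H[OF B(9)] unfolding i[symmetric] p[symmetric] by simp_all
  qed
  have sep_i: "p \<noteq> 0 \<longrightarrow> y i + (b i - b p) / m i \<le> y p"
    using B(21) by (simp add: separated_def p)
  have sep: "separated (prv(f := p)) b y m j" if "j \<in> S - {i}" "j \<noteq> f" "j < f \<or> f < j" for j
    using delete_separated[OF B(1,9,11) fx p that(1,2), of b y m] top_sep[of j] that I
    by (auto simp: step_inv_def)
  show "separated (prv(f := p)) b y m j" if "j \<in> S - {i}" "f < j" for j
    using sep[of j] that by simp
  let ?mm = "\<lambda>i. min (m i) c"
  have mmi: "?mm i = gm h" "?mm f = c" using B(13,15) mf by simp_all
  show "equiv_rays (S - {i}) b y ?mm S b y ?mm"
  proof (rule equiv_rays_delete)
    fix z assume z: "0 \<le> z" "z \<le> b i"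
    show "\<exists>j\<in>S - {i}. z \<le> b j \<and> ray b y ?mm i z \<le> ray b y ?mm j z"
    proof (cases "b p \<le> z")
      case True
      have "(z - b p) / c \<le> (z - b p) / gm h" using True B(14,15) by (intro divide_left_mono) auto
      hence "y i + (b i - z) / gm h \<le> y f + (b f - z) / c"
        using le by (simp add: diff_divide_distrib)
      hence "ray b y ?mm i z \<le> ray b y ?mm f z" unfolding ray_def mmi .
      thus ?thesis using B(5) pi z bf by (intro bexI[of _ f]) auto
    next
      case False
      have "b 0 = 0" using B(3) by (simp add: heights_def)
      hence p0: "p \<noteq> 0" using False z by metis
      hence pS: "p \<in> S" using B(24) by simp
      have "y i + (b i - z) / gm h = y i + (b i - b p) / gm h + (b p - z) / gm h"
        by (simp add: diff_divide_distrib)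
      also have "\<dots> \<le> y p + (b p - z) / m p"
        using sep_i p0 B(13) B(22,23)[OF pS] False B(14)
        by (intro add_mono divide_left_mono) auto
      finally have "ray b y ?mm i z \<le> ray b y ?mm p z"
        using mmi B(22)[OF pS] B(13,15) by (simp add: ray_def)
      thus ?thesis using pS pi False by (intro bexI[of _ p]) auto
    qed
  qed
  have g2h: "g2 h = square_sum prv b {i \<in> S. i < f \<and> m i = gm h}"
    using levels_group(6)[OF B(4)] h(1) by simp
  \<comment> \<open>With the full length \<open>b i - b p\<close> moved to \<open>f\<close>, the
    update of \<open>g2\<close> used for a cut subtracts exactly the square of this length. The
    program can therefore use \<open>transfer\<close> in both cases.\<close>
  have g2'h: "g2' h = square_sum prv b ({i \<in> S. i < f \<and> m i = gm h} - {i})"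
    using square_sum_remove[of "{i \<in> S. i < f \<and> m i = gm h}" i prv b] fin B(9,10,13) g2h g2' p
    by (simp add: power2_eq_square)
  show "step_inv (S - {i}) m k n c (prv(f := p)) (nxt(p := f)) b y gf gm g2' u' f h' q' E'"
    unfolding step_inv_def
  proof (intro conjI)
    show "linked (prv(f := p)) (nxt(p := f)) (S - {i}) k"
      using linked_delete[OF B(1,9,11)] fx p by simp
    show "heights (prv(f := p)) b y (S - {i})" by (rule delete_heights[OF B(1,9,11) fx p B(3)])
    show "levels (prv(f := p)) b m (S - {i}) f h' gf gm g2'"
      unfolding levels_def
    proof (intro conjI ballI allI impI)
      fix l assume l0: "l \<in> {1..h'}"
      hence l: "1 \<le> l" "l \<le> h" using h' by (auto split: if_splits)
      note g = levels_group[OF B(4) l]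
      show "gf l < f" "m (gf l) = gm l" "0 < gm l" using g by auto
      have "gf l \<noteq> i"
      proof (cases "l = h")
        case True
        hence "i \<noteq> gf h" using l0 h' h(1) by auto
        thus ?thesis using True by simp
      next
        case False
        hence "gm l < gm h" using levels_strict[OF B(4), of l h] l by simp
        thus ?thesis using g(3) B(13) by auto
      qed
      thus "gf l \<in> S - {i}" using g by auto
      show "gf l \<le> i'" if "i' \<in> S - {i}" "i' < f \<and> m i' = gm l" for i' using g(5)[of i'] that by auto
      have oth: "square_sum (prv(f := p)) b {i' \<in> S - {i}. i' < f \<and> m i' = gm l}
          = square_sum prv b {i' \<in> S - {i}. i' < f \<and> m i' = gm l}"
        by (rule delete_square_sum_other[OF B(1,9,11) fx p]) auto
      show "g2' l = square_sum (prv(f := p)) b {i' \<in> S - {i}. i' < f \<and> m i' = gm l}"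
      proof (cases "l = h")
        case True
        have "{i \<in> S. i < f \<and> m i = gm h} - {i} = {i' \<in> S - {i}. i' < f \<and> m i' = gm l}"
          using True by blast
        thus ?thesis using oth g2'h True by simp
      next
        case False
        hence "gm l < gm h" using levels_strict[OF B(4), of l h] l by simp
        hence "{i' \<in> S - {i}. i' < f \<and> m i' = gm l} = {i \<in> S. i < f \<and> m i = gm l}"
          using B(13) by auto
        thus ?thesis using oth g(6) g2' False by simp
      qed
    next
      fix l l' assume "1 \<le> l \<and> l < l' \<and> l' \<le> h'"
      hence "1 \<le> l" "l < l'" "l' \<le> h" using h' by (auto split: if_splits)
      thus "gm l < gm l'" by (rule levels_strict[OF B(4)])
    next
      fix i' assume i': "i' \<in> S - {i}" "i' < f"
      then obtain l where l: "1 \<le> l" "l \<le> h" "m i' = gm l" using levels_ex[OF B(4), of i'] by auto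
      have "l \<le> h'"
      proof (rule ccontr)
        assume "\<not> l \<le> h'"
        hence "l = h" "i = gf h" using l h' by (auto split: if_splits)
        hence "i \<le> i'" using levels_group(5)[OF B(4), of h i'] l i' by auto
        moreover have "i' \<le> i" using O(2)[of i'] i' by simp
        ultimately show False using i' by simp
      qed
      thus "\<exists>l\<in>{1..h'}. m i' = gm l" using l by auto
    next
      fix i' j' assume "i' \<in> S - {i}" "j' \<in> S - {i}" "i' \<le> j' \<and> j' < f"
      thus "m i' \<le> m j'" using levels_mono[OF B(4), of i' j'] by auto
    qed
    show "thresholds (nxt(p := f)) b y m (S - {i}) k f n u'"
      unfolding thresholds_def
    proof (intro allI impI)
      fix l assume l: "l \<le> n"
      note T = boundary_thresholds[OF l]
      show "u' l = (if l \<in> S - {i} \<and> l < k \<and> (f \<le> l \<or> (nxt(p := f)) l < f \<and> m l = m ((nxt(p := f)) l))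
        then (b ((nxt(p := f)) l) - b l) / (y l - y ((nxt(p := f)) l)) else 0)"
      proof (cases "l = p")
        case True
        have "u' l = 0"
        proof (cases "i = gf h")
          case True
          have "u p = 0" using T \<open>l = p\<close> B(18,10,27) B(20)[OF True] by auto
          thus ?thesis using u' True \<open>l = p\<close> by simp
        qed (use u' True in simp)
        thus ?thesis using True B(18,10) by simp
      next
        case False
        have "u' l = u l" using u' False by simp
        moreover have "l = i \<Longrightarrow> u l = 0" using T B(10,12) by simp
        ultimately show ?thesis using T False by auto
      qed
    qed
    show "E' = area (prv(f := p)) b y m (S - {i})"
      using delete_area[OF B(1,9,11) fx p, of m b y] mf B(6,13,14) E' I by (simp add: step_inv_def)
    show "\<forall>l\<in>S - {i}. l < f \<longrightarrow> separated (prv(f := p)) b y m l" using sep by auto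
    have "{l \<in> S - {i}. f \<le> l} = {l \<in> S. f \<le> l}" using B(10) by auto
    thus "q' = square_sum (prv(f := p)) b {l \<in> S - {i}. f \<le> l}"
      using delete_square_sum_succ[OF B(1,9,11) fx p, of "{l \<in> S. f \<le> l}" b] B(5) q' I
      by (simp add: step_inv_def)
  qed (use B(1,2,5,6,7) pi in simp_all)
qed

end

text \<open>All rates on the stack lie below \<open>c\<close>, so the last group can be pushed on
  top of it. No leaf changes: thresholds depend on which neighbours share a rate, and not on where
  their group is kept.\<close>

lemma step_inv_rest:
  assumes I: "step_inv S m k n c prv nxt b y gf gm g2 u f h q E"
    and h: "\<And>l. 1 \<le> l \<Longrightarrow> l \<le> h \<Longrightarrow> gm l < c"
    and sep: "\<And>j. j \<in> S \<Longrightarrow> separated prv b y m j"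
  shows "rest_inv S m k n prv nxt b y (gf(Suc h := f)) (gm(Suc h := c)) (g2(Suc h := q)) u (Suc h) E"
proof -
  have L: "linked prv nxt S k" and V: "levels prv b m S f h gf gm g2"
    and T: "thresholds nxt b y m S k f n u"
    and f: "f \<in> S" and c: "0 < c" and top: "\<And>i. i \<in> S \<Longrightarrow> f \<le> i \<Longrightarrow> m i = c"
    and q: "q = square_sum prv b {i \<in> S. f \<le> i}"
    using I by (auto simp: step_inv_def)
  have bd: "i < Suc k" if "i \<in> S" for i using linked_bounds[OF L that] by simp
  have low: "m i < c" if "i \<in> S" "i < f" for i using levels_ex[OF V that] h by auto
  let ?gf = "gf(Suc h := f)" and ?gm = "gm(Suc h := c)" and ?g2 = "g2(Suc h := q)"
  have "levels prv b m S (Suc k) (Suc h) ?gf ?gm ?g2"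
    unfolding levels_def
  proof (intro conjI ballI allI impI)
    fix l assume "l \<in> {1..Suc h}"
    then consider "l = Suc h" | "1 \<le> l" "l \<le> h" by (auto simp: le_Suc_eq)
    hence *: "?gf l \<in> S \<and> m (?gf l) = ?gm l \<and> 0 < ?gm l \<and>
        (\<forall>i\<in>S. m i = ?gm l \<longrightarrow> ?gf l \<le> i) \<and> ?g2 l = square_sum prv b {i \<in> S. i < Suc k \<and> m i = ?gm l}"
    proof cases
      case 1
      have "{i \<in> S. i < Suc k \<and> m i = c} = {i \<in> S. f \<le> i}"
        using top low bd by (force simp: not_le[symmetric])
      moreover have "\<forall>i\<in>S. m i = c \<longrightarrow> f \<le> i" using low by (force simp: not_le[symmetric])
      ultimately show ?thesis using 1 f top[OF f] c q by simp
    next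
      case 2
      note g = levels_group[OF V 2]
      have lc: "gm l < c" by (rule h[OF 2])
      have *: "i < f" if "i \<in> S" "m i = gm l" for i using top[OF that(1)] that(2) lc by (cases "i < f") auto
      have "{i \<in> S. i < Suc k \<and> m i = gm l} = {i \<in> S. i < f \<and> m i = gm l}" using * bd by auto
      moreover have "\<forall>i\<in>S. m i = gm l \<longrightarrow> gf l \<le> i" using * g(5) by blast
      ultimately show ?thesis using 2 g by simp
    qed
    thus "?gf l \<in> S" "m (?gf l) = ?gm l" "0 < ?gm l" "?g2 l = square_sum prv b {i \<in> S. i < Suc k \<and> m i = ?gm l}"
      by auto
    show "?gf l < Suc k" using * bd by blast
    show "?gf l \<le> i" if "i \<in> S" "i < Suc k \<and> m i = ?gm l" for i using * that by blast
  next
    fix l l' assume l: "1 \<le> l \<and> l < l' \<and> l' \<le> Suc h"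
    show "?gm l < ?gm l'"
      using levels_strict[OF V, of l l'] h[of l] l by (cases "l' = Suc h") auto
  next
    fix i assume i: "i \<in> S"
    show "\<exists>l\<in>{1..Suc h}. m i = ?gm l"
    proof (cases "i < f")
      case True
      then obtain l where "1 \<le> l" "l \<le> h" "m i = gm l" using levels_ex[OF V i] by blast
      thus ?thesis by (intro bexI[of _ l]) auto
    next
      case False
      thus ?thesis using top[OF i] by (intro bexI[of _ "Suc h"]) auto
    qed
  next
    fix i j assume ij: "i \<in> S" "j \<in> S" "i \<le> j \<and> j < Suc k"
    show "m i \<le> m j"
    proof (cases "j < f")
      case True
      thus ?thesis using levels_mono[OF V ij(1,2)] ij(3) by simp
    next
      case False
      thus ?thesis using top[OF ij(2)] top[OF ij(1)] low[OF ij(1)] by (cases "i < f") auto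
    qed
  qed
  moreover have "thresholds nxt b y m S k (Suc k) n u"
    unfolding thresholds_def
  proof (intro allI impI)
    fix i assume i: "i \<le> n"
    have Ti: "u i = (if i \<in> S \<and> i < k \<and> (f \<le> i \<or> nxt i < f \<and> m i = m (nxt i))
      then (b (nxt i) - b i) / (y i - y (nxt i)) else 0)" using T i by (simp add: thresholds_def)
    show "u i = (if i \<in> S \<and> i < k \<and> (Suc k \<le> i \<or> nxt i < Suc k \<and> m i = m (nxt i))
      then (b (nxt i) - b i) / (y i - y (nxt i)) else 0)"
    proof (cases "i \<in> S \<and> i < k")
      case True
      have nx: "nxt i \<in> S" "i < nxt i" using linked_nxt[OF L, of i] True by auto
      have "(f \<le> i \<or> nxt i < f \<and> m i = m (nxt i)) \<longleftrightarrow> (Suc k \<le> i \<or> nxt i < Suc k \<and> m i = m (nxt i))"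
        using bd[OF nx(1)] top[of i] top[OF nx(1)] low[of i] nx(2) True
        by (cases "f \<le> i"; cases "nxt i < f") auto
      thus ?thesis using Ti by simp
    qed (use Ti in auto)
  qed
  ultimately show ?thesis using I sep by (simp add: rest_inv_def step_inv_def)
qed

section \<open>Total correctness and running time of programs\<close>

text \<open>The step count is an argument of the postcondition. As \<open>run\<close> is
  deterministic, the rules for straight-line code are equations, and the simplifier can execute
  programs.\<close>

definition wp :: "com \<Rightarrow> (nat \<Rightarrow> state \<Rightarrow> bool) \<Rightarrow> state \<Rightarrow> bool" where
  "wp p Q s \<longleftrightarrow> (\<exists>t s'. run p s t s' \<and> Q t s')"

lemma wp_mono: "wp p Q s \<Longrightarrow> (\<And>t s'. Q t s' \<Longrightarrow> Q' t s') \<Longrightarrow> wp p Q' s"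
  unfolding wp_def by blast

text \<open>Keeps the simplifier from executing the rest of a program on an unknown state.\<close>

lemma wp_weak_cong: "s = s' \<Longrightarrow> wp p Q s = wp p Q s'"
  by simp

lemma wp_Skip: "wp Skip Q s \<longleftrightarrow> Q 1 s"
  unfolding wp_def by (metis run_Skip run_deterministic)

lemma wp_NAssign: "wp (NAssign x e) Q s \<longleftrightarrow> Q (1 + ncost e) (s\<lparr>nvar := (nvar s)(x := nval s e)\<rparr>)"
  unfolding wp_def by (metis run_NAssign run_deterministic)

lemma wp_RAssign: "wp (RAssign x e) Q s \<longleftrightarrow> Q (1 + rcost e) (s\<lparr>rvar := (rvar s)(x := rval s e)\<rparr>)"
  unfolding wp_def by (metis run_RAssign run_deterministic)

lemma wp_NWrite: "wp (NWrite a i e) Q s \<longleftrightarrow> Q (1 + ncost i + ncost e)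
    (s\<lparr>narr := (narr s)(a := (narr s a)(nval s i := nval s e))\<rparr>)"
  unfolding wp_def by (metis run_NWrite run_deterministic)

lemma wp_RWrite: "wp (RWrite a i e) Q s \<longleftrightarrow> Q (1 + ncost i + rcost e)
    (s\<lparr>rarr := (rarr s)(a := (rarr s a)(nval s i := rval s e))\<rparr>)"
  unfolding wp_def by (metis run_RWrite run_deterministic)

lemma wp_Seq: "wp (Seq p q) Q s \<longleftrightarrow> wp p (\<lambda>t s'. wp q (\<lambda>t' s''. Q (t + t') s'') s') s"
  unfolding wp_def by (blast intro: run_Seq elim: run_SeqE)

lemma wp_If: "wp (If b p q) Q s \<longleftrightarrow>
    (if bval s b then wp p (\<lambda>t s'. Q (1 + bcost b + t) s') s
     else wp q (\<lambda>t s'. Q (1 + bcost b + t) s') s)"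
  unfolding wp_def by (auto intro: run_IfT run_IfF elim!: run_IfE)
     (metis run_IfT run_IfF add_Suc plus_1_eq_Suc)+

text \<open>Gives record updates a fixed order, so that consecutive updates of the same field meet
  and collapse during symbolic execution.\<close>

lemma update_commute:
  "s\<lparr>rvar := b, nvar := a\<rparr> = s\<lparr>nvar := a, rvar := b\<rparr>"
  "s\<lparr>narr := c, nvar := a\<rparr> = s\<lparr>nvar := a, narr := c\<rparr>"
  "s\<lparr>rarr := d, nvar := a\<rparr> = s\<lparr>nvar := a, rarr := d\<rparr>"
  "s\<lparr>narr := c, rvar := b\<rparr> = s\<lparr>rvar := b, narr := c\<rparr>"
  "s\<lparr>rarr := d, rvar := b\<rparr> = s\<lparr>rvar := b, rarr := d\<rparr>"
  "s\<lparr>rarr := d, narr := c\<rparr> = s\<lparr>narr := c, rarr := d\<rparr>"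
  for s :: state
  by simp_all

lemmas wp_simps = wp_Skip wp_NAssign wp_RAssign wp_NWrite wp_RWrite wp_Seq wp_If update_commute

text \<open>The number \<open>v\<close> is a time budget, so termination comes for free.\<close>

lemma wp_While:
  assumes step: "\<And>v s. Inv v s \<Longrightarrow> bval s b \<Longrightarrow>
      wp p (\<lambda>t s'. \<exists>v'. Inv v' s' \<and> 1 + bcost b + t + v' \<le> v) s"
    and inv: "Inv v s"
  shows "wp (While b p) (\<lambda>t s'. \<exists>v'. Inv v' s' \<and> \<not> bval s' b \<and> t + v' \<le> v + 1 + bcost b) s"
  using inv
proof (induction v arbitrary: s rule: less_induct)
  case (less v)
  show ?case
  proof (cases "bval s b")
    case True
    from step[OF less.prems True] obtain t s' v' where
      1: "run p s t s'" "Inv v' s'" "1 + bcost b + t + v' \<le> v"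
      unfolding wp_def by blast
    hence "v' < v" by simp
    from less.IH[OF this 1(2)] obtain t' s'' v'' where
      2: "run (While b p) s' t' s''" "Inv v'' s''" "\<not> bval s'' b" "t' + v'' \<le> v' + 1 + bcost b"
      unfolding wp_def by blast
    have "run (While b p) s (1 + bcost b + t + t') s''" by (rule run_WhileT[OF True 1(1) 2(1)])
    thus ?thesis unfolding wp_def using 1(3) 2 by (intro exI conjI) auto
  next
    case False
    thus ?thesis unfolding wp_def using run_WhileF[OF False] less.prems
      by (intro exI conjI) auto
  qed
qed

text \<open>Registers and arrays of both kinds are not distinguished here.\<close>

primrec writes :: "com \<Rightarrow> string set" where
  "writes Skip = {}"
| "writes (NAssign x e) = {x}"
| "writes (RAssign x e) = {x}"
| "writes (NWrite a i e) = {a}"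
| "writes (RWrite a i e) = {a}"
| "writes (Seq p q) = writes p \<union> writes q"
| "writes (If b p q) = writes p \<union> writes q"
| "writes (While b p) = writes p"

definition agree :: "string \<Rightarrow> state \<Rightarrow> state \<Rightarrow> bool" where
  "agree x s s' \<longleftrightarrow> nvar s' x = nvar s x \<and> rvar s' x = rvar s x \<and> narr s' x = narr s x \<and> rarr s' x = rarr s x"

lemma run_agree: "run p s t s' \<Longrightarrow> x \<notin> writes p \<Longrightarrow> agree x s s'"
  by (induction rule: run.induct) (auto simp: agree_def)

lemma wp_agree:
  assumes "wp p Q s"
  shows "wp p (\<lambda>t s'. Q t s' \<and> (\<forall>x. x \<notin> writes p \<longrightarrow> agree x s s')) s"
  using assms run_agree unfolding wp_def by blast

section \<open>A tournament tree\<close>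

text \<open>The array layout of a binary heap: inner nodes \<open>1, ..., N - 1\<close> and leaves
  \<open>N, ..., 2 * N - 1\<close>, for any \<open>N\<close>, not only powers of two. The doubled
  index is written as a sum because the machine only adds.\<close>

definition tree :: "(nat \<Rightarrow> real) \<Rightarrow> nat \<Rightarrow> bool" where
  "tree t N \<longleftrightarrow> (\<forall>x. 1 \<le> x \<and> x < N \<longrightarrow> t x = max (t (x + x)) (t (x + x + 1)))"

lemma tree_le_root: "tree t N \<Longrightarrow> 1 \<le> x \<Longrightarrow> x < 2 * N \<Longrightarrow> t x \<le> t 1"
proof (induction x rule: less_induct)
  case (less x)
  show ?case
  proof (cases "x = 1")
    case False
    define z where "z = x div 2"
    have z: "1 \<le> z" "z < N" "z < x" "x = z + z \<or> x = z + z + 1" using less.prems False by (auto simp: z_def)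
    have "t z = max (t (z + z)) (t (z + z + 1))" using less.prems(1) z by (simp add: tree_def)
    hence "t x \<le> t z" using z(4) by auto
    thus ?thesis using less.IH[of z] z less.prems by simp
  qed simp
qed

definition fix_node :: com where
  "fix_node =
    Seq (If (RLess (RRead ''tree'' (NAdd (NVar ''x'') (NVar ''x'')))
               (RRead ''tree'' (NAdd (NAdd (NVar ''x'') (NVar ''x'')) (NConst 1))))
      (RWrite ''tree'' (NVar ''x'') (RRead ''tree'' (NAdd (NAdd (NVar ''x'') (NVar ''x'')) (NConst 1))))
      (RWrite ''tree'' (NVar ''x'') (RRead ''tree'' (NAdd (NVar ''x'') (NVar ''x'')))))
    (NAssign ''x'' (NRead ''par'' (NVar ''x'')))"

text \<open>The arguments of \<open>set_leaf\<close> are the registers \<open>a\<close> (leaf) and \<open>v\<close> (value); the array \<open>par\<close> holds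
  the parents, because the machine cannot divide natural numbers.\<close>

definition set_leaf :: com where
  "set_leaf =
    Seq (RWrite ''tree'' (NAdd (NVar ''N'') (NVar ''a'')) (RVar ''v''))
   (Seq (NAssign ''x'' (NRead ''par'' (NAdd (NVar ''N'') (NVar ''a''))))
   (While (NLess (NConst 0) (NVar ''x''))
     fix_node))"

text \<open>While climbing, the maximum equation can fail only at the current node and its
  ancestors. The postcondition \<open>Q\<close> is arbitrary, so that the rule can be applied in the
  middle of a symbolic execution.\<close>

lemma wp_set_leaf:
  assumes N: "nvar s ''N'' = N" and a: "nvar s ''a'' = a" "a < N" and v: "rvar s ''v'' = v"
    and par: "\<And>x. x < 2 * N \<Longrightarrow> narr s ''par'' x = x div 2"
    and tr: "tree (rarr s ''tree'') N" and g: "2 * N \<le> 2 ^ g"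
    and Q: "\<And>\<tau> t'. \<tau> \<le> 40 * g + 40 \<Longrightarrow> tree t' N \<Longrightarrow>
      (\<And>i. i < N \<Longrightarrow> t' (N + i) = (if i = a then v else rarr s ''tree'' (N + i))) \<Longrightarrow>
      Q \<tau> (s\<lparr>nvar := (nvar s)(''x'' := 0), rarr := (rarr s)(''tree'' := t')\<rparr>)"
  shows "wp set_leaf Q s"
proof -
  \<comment> \<open>The ancestors of \<open>x\<close> are the numbers \<open>x div 2 ^ l\<close>,
    and \<open>x < 2 ^ d\<close> bounds their number by the remaining budget. The climb ends at 0,
    the parent of the root; then no node is exempt.\<close>
  define Inv where "Inv = (\<lambda>b r. \<exists>d x t'. b = 40 * d \<and> x < 2 ^ d \<and> x < N \<and>
      r = s\<lparr>nvar := (nvar s)(''x'' := x), rarr := (rarr s)(''tree'' := t')\<rparr> \<and>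
      (\<forall>z. 1 \<le> z \<and> z < N \<and> (\<forall>l. z \<noteq> x div 2 ^ l) \<longrightarrow> t' z = max (t' (z + z)) (t' (z + z + 1))) \<and>
      (\<forall>i<N. t' (N + i) = (if i = a then v else rarr s ''tree'' (N + i))))"
  have step: "wp fix_node
      (\<lambda>\<tau> r'. \<exists>b'. Inv b' r' \<and> 1 + bcost (NLess (NConst 0) (NVar ''x'')) + \<tau> + b' \<le> b) r"
    if "Inv b r" "bval r (NLess (NConst 0) (NVar ''x''))" for b r
  proof -
    from that(1) obtain d x t' where I: "b = 40 * d" "x < 2 ^ d" "x < N"
      "r = s\<lparr>nvar := (nvar s)(''x'' := x), rarr := (rarr s)(''tree'' := t')\<rparr>"
      "\<And>z. 1 \<le> z \<Longrightarrow> z < N \<Longrightarrow> (\<And>l. z \<noteq> x div 2 ^ l) \<Longrightarrow> t' z = max (t' (z + z)) (t' (z + z + 1))"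
      "\<And>i. i < N \<Longrightarrow> t' (N + i) = (if i = a then v else rarr s ''tree'' (N + i))"
      unfolding Inv_def by blast
    have x0: "0 < x" using that(2) I(4) by simp
    then obtain d' where d': "d = Suc d'" using I(2) by (cases d) auto
    define t'' where "t'' = t'(x := max (t' (x + x)) (t' (x + x + 1)))"
    have ok: "t'' z = max (t'' (z + z)) (t'' (z + z + 1))"
      if z: "1 \<le> z" "z < N" "\<And>l. z \<noteq> x div 2 div 2 ^ l" for z
    proof (cases "z = x")
      case True
      thus ?thesis using x0 by (auto simp: t''_def)
    next
      case False
      have "z \<noteq> x div 2" using z(3)[of 0] by simp
      hence ne: "z + z \<noteq> x" "z + z + 1 \<noteq> x" by auto
      have "z \<noteq> x div 2 ^ l" for l
      proof (cases l)
        case (Suc l')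
        thus ?thesis using z(3)[of l'] by (simp add: div_mult2_eq)
      qed (use False in simp)
      thus ?thesis using I(5)[OF z(1,2)] False ne by (simp add: t''_def)
    qed
    have leaf: "t'' (N + i) = (if i = a then v else rarr s ''tree'' (N + i))" if "i < N" for i
      using I(3) I(6)[OF that] by (simp add: t''_def)
    have inv': "Inv (40 * d') (s\<lparr>nvar := (nvar s)(''x'' := x div 2), rarr := (rarr s)(''tree'' := t'')\<rparr>)"
      unfolding Inv_def
      by (intro exI[of _ d'] exI[of _ "x div 2"] exI[of _ t'']) (use I(2,3) d' ok leaf in auto)
    have px: "narr s ''par'' x = x div 2" by (rule par) (use I(3) in simp)
    show ?thesis
    proof (cases "t' (x + x) < t' (x + x + 1)")
      case True
      hence "t'' = t'(x := t' (x + x + 1))" by (simp add: t''_def max_def)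
      thus ?thesis using inv' True px by (auto simp: fix_node_def wp_simps I(1,4) d' intro!: exI[of _ "40 * d'"])
    next
      case False
      hence "t'' = t'(x := t' (x + x))" by (auto simp: t''_def max_def)
      thus ?thesis using inv' False px by (auto simp: fix_node_def wp_simps I(1,4) d' intro!: exI[of _ "40 * d'"])
    qed
  qed
  define t0 where "t0 = (rarr s ''tree'')(N + a := v)"
  define s0 where "s0 = s\<lparr>nvar := (nvar s)(''x'' := (N + a) div 2), rarr := (rarr s)(''tree'' := t0)\<rparr>"
  have ok0: "t0 z = max (t0 (z + z)) (t0 (z + z + 1))"
    if z: "1 \<le> z" "z < N" "\<And>l. z \<noteq> (N + a) div 2 div 2 ^ l" for z
  proof -
    have "z \<noteq> (N + a) div 2" using z(3)[of 0] by simp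
    hence "z + z \<noteq> N + a" "z + z + 1 \<noteq> N + a" by auto
    thus ?thesis using tr z by (auto simp: t0_def tree_def)
  qed
  have Na: "(N + a) div 2 < N" "(N + a) div 2 < 2 ^ g" using a g by auto
  have "Inv (40 * g) s0"
    unfolding Inv_def s0_def
  proof (intro exI conjI allI impI)
    show "t0 z = max (t0 (z + z)) (t0 (z + z + 1))"
      if "1 \<le> z \<and> z < N \<and> (\<forall>l. z \<noteq> (N + a) div 2 div 2 ^ l)" for z
      using ok0[of z] that by blast
    show "t0 (N + i) = (if i = a then v else rarr s ''tree'' (N + i))" for i by (simp add: t0_def)
  qed (use Na in simp_all)
  note loop = wp_While[of Inv, OF step this]
  have pa: "narr s ''par'' (N + a) = (N + a) div 2" by (rule par) (use a in simp)
  have final: "Q (10 + \<tau>) r" if inv: "Inv b' r" and nb: "\<not> bval r (NLess (NConst 0) (NVar ''x''))"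
      and \<tau>: "\<tau> + b' \<le> 40 * g + 1 + bcost (NLess (NConst 0) (NVar ''x''))" for b' r \<tau>
  proof -
    from inv obtain d x t' where I: "b' = 40 * d" "x < 2 ^ d" "x < N"
      "r = s\<lparr>nvar := (nvar s)(''x'' := x), rarr := (rarr s)(''tree'' := t')\<rparr>"
      "\<And>z. 1 \<le> z \<Longrightarrow> z < N \<Longrightarrow> (\<And>l. z \<noteq> x div 2 ^ l) \<Longrightarrow> t' z = max (t' (z + z)) (t' (z + z + 1))"
      "\<And>i. i < N \<Longrightarrow> t' (N + i) = (if i = a then v else rarr s ''tree'' (N + i))"
      unfolding Inv_def by blast
    have x: "x = 0" using nb I(4) by simp
    show "Q (10 + \<tau>) r"
      unfolding I(4) x by (rule Q) (use \<tau> I(5,6) x in \<open>auto simp: tree_def\<close>)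
  qed
  have "wp (While (NLess (NConst 0) (NVar ''x''))
     fix_node) (\<lambda>\<tau> r. Q (10 + \<tau>) r) s0"
    by (rule wp_mono[OF loop], assumption, assumption, elim exE conjE, rule final)
  thus ?thesis
    unfolding set_leaf_def by (simp add: wp_simps N a v pa s0_def t0_def del: One_nat_def plus_1_eq_Suc)
qed

definition descend :: com where
  "descend =
    If (RLess (RRead ''tree'' (NAdd (NVar ''x'') (NVar ''x''))) (RRead ''tree'' (NVar ''x'')))
    (NAssign ''x'' (NAdd (NAdd (NVar ''x'') (NVar ''x'')) (NConst 1)))
    (NAssign ''x'' (NAdd (NVar ''x'') (NVar ''x'')))"

definition find_max :: com where
  "find_max =
    Seq (NAssign ''x'' (NConst 1))
   (Seq (While (NLess (NVar ''x'') (NVar ''N''))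
     descend)
   (NAssign ''i'' (NSub (NVar ''x'') (NVar ''N''))))"

text \<open>The walk follows children that carry the value of the root; if the left child is smaller
  than its parent, the right one must be equal to it. The product \<open>x * 2 ^ d\<close> stays at
  least \<open>2 ^ g\<close>, hence at least \<open>2 * N\<close>, so budget remains as long as
  \<open>x\<close> is an inner node.\<close>

lemma wp_find_max:
  assumes N: "nvar s ''N'' = N" "1 \<le> N"
    and tr: "tree (rarr s ''tree'') N" and g: "2 * N \<le> 2 ^ g"
    and Q: "\<And>\<tau> i. \<tau> \<le> 40 * g + 40 \<Longrightarrow> i < N \<Longrightarrow> rarr s ''tree'' (N + i) = rarr s ''tree'' 1 \<Longrightarrow>
      Q \<tau> (s\<lparr>nvar := (nvar s)(''x'' := N + i, ''i'' := i)\<rparr>)"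
  shows "wp find_max Q s"
proof -
  let ?t = "rarr s ''tree''"
  define Inv where "Inv = (\<lambda>b r. \<exists>d x. b = 40 * d \<and> 2 ^ g \<le> x * 2 ^ d \<and> 1 \<le> x \<and> x < 2 * N \<and>
      r = s\<lparr>nvar := (nvar s)(''x'' := x)\<rparr> \<and> ?t x = ?t 1)"
  have step: "wp descend
      (\<lambda>\<tau> r'. \<exists>b'. Inv b' r' \<and> 1 + bcost (NLess (NVar ''x'') (NVar ''N'')) + \<tau> + b' \<le> b) r"
    if "Inv b r" "bval r (NLess (NVar ''x'') (NVar ''N''))" for b r
  proof -
    from that(1) obtain d x where I: "b = 40 * d" "2 ^ g \<le> x * 2 ^ d" "1 \<le> x" "x < 2 * N"
      "r = s\<lparr>nvar := (nvar s)(''x'' := x)\<rparr>" "?t x = ?t 1"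
      unfolding Inv_def by blast
    have xN: "x < N" using that(2) I(5) N by simp
    have "d \<noteq> 0"
    proof
      assume "d = 0"
      hence "2 ^ g \<le> x" using I(2) by simp
      thus False using xN g by linarith
    qed
    then obtain d' where d': "d = Suc d'" by (cases d) auto
    have tx: "?t x = max (?t (x + x)) (?t (x + x + 1))" using tr I(3) xN by (simp add: tree_def)
    have inv': "Inv (40 * d') (s\<lparr>nvar := (nvar s)(''x'' := z)\<rparr>)"
      if z: "z = x + x \<or> z = x + x + 1" "?t z = ?t x" for z
      unfolding Inv_def
    proof (intro exI conjI)
      have "2 ^ g \<le> (x + x) * 2 ^ d'" using I(2) d' by (simp add: algebra_simps)
      also have "\<dots> \<le> z * 2 ^ d'" using z(1) by (intro mult_right_mono) auto
      finally show "2 ^ g \<le> z * 2 ^ d'" .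
    qed (use z xN I in auto)
    show ?thesis
    proof (cases "?t (x + x) < ?t x")
      case True
      hence "?t (x + x + 1) = ?t x" using tx by (auto simp: max_def split: if_splits)
      thus ?thesis using inv'[of "x + x + 1"] True
        by (auto simp: descend_def wp_simps I(1,5) d' intro!: exI[of _ "40 * d'"])
    next
      case False
      hence "?t (x + x) = ?t x" using tx by auto
      thus ?thesis using inv'[of "x + x"] False
        by (auto simp: descend_def wp_simps I(1,5) d' intro!: exI[of _ "40 * d'"])
    qed
  qed
  have "Inv (40 * g) (s\<lparr>nvar := (nvar s)(''x'' := 1)\<rparr>)"
    unfolding Inv_def using N by (intro exI[of _ g] exI[of _ 1]) auto
  note loop = wp_While[of Inv, OF step this]
  have final: "Q (6 + \<tau>) (r\<lparr>nvar := (nvar r)(''i'' := nvar r ''x'' - nvar r ''N'')\<rparr>)"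
    if inv: "Inv b' r" and nb: "\<not> bval r (NLess (NVar ''x'') (NVar ''N''))"
      and \<tau>: "\<tau> + b' \<le> 40 * g + 1 + bcost (NLess (NVar ''x'') (NVar ''N''))" for b' r \<tau>
  proof -
    from inv obtain d x where I: "b' = 40 * d" "2 ^ g \<le> x * 2 ^ d" "1 \<le> x" "x < 2 * N"
      "r = s\<lparr>nvar := (nvar s)(''x'' := x)\<rparr>" "?t x = ?t 1"
      unfolding Inv_def by blast
    have "N \<le> x" using nb I(5) N by simp
    then obtain i where i: "x = N + i" using le_Suc_ex by blast
    show ?thesis
      using Q[of "6 + \<tau>" i] \<tau> I(4,6) N by (simp add: I(5) i fun_upd_twist)
  qed
  have "wp (While (NLess (NVar ''x'') (NVar ''N''))
     descend)
     (\<lambda>\<tau> r. Q (6 + \<tau>) (r\<lparr>nvar := (nvar r)(''i'' := nvar r ''x'' - nvar r ''N'')\<rparr>))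
     (s\<lparr>nvar := (nvar s)(''x'' := 1)\<rparr>)"
    by (rule wp_mono[OF loop], assumption, assumption, elim exE conjE, rule final)
  thus ?thesis
    unfolding find_max_def by (simp add: wp_simps del: One_nat_def plus_1_eq_Suc)
qed

section \<open>The scan from left to right\<close>

lemma step_inv_cong:
  assumes "step_inv S m k n c prv nxt b y gf gm g2 u f h q E" "\<And>i. i \<le> n \<Longrightarrow> u' i = u i"
  shows "step_inv S m k n c prv nxt b y gf gm g2 u' f h q E"
  using assms by (simp add: step_inv_def thresholds_def)

abbreviation rconst :: "nat \<Rightarrow> rexp" where "rconst k \<equiv> OfNat (NConst k)"

abbreviation elem_at :: "string \<Rightarrow> string \<Rightarrow> rexp" where "elem_at a i \<equiv> RRead a (NVar i)"

abbreviation seqs :: "com list \<Rightarrow> com" where "seqs ps \<equiv> foldr Seq ps Skip"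

definition merge_step :: com where
  "merge_step =
    seqs [
    NAssign ''a'' (NRead ''prev'' (NVar ''f'')),
    RAssign ''v'' (RDiv (RSub (elem_at ''b'' ''f'') (elem_at ''b'' ''a'')) (RSub (elem_at ''y'' ''a'') (elem_at ''y'' ''f''))),
    set_leaf,
    RAssign ''E'' (RAdd (RVar ''E'') (RDiv (RMul (elem_at ''g2'' ''h'')
      (RSub (RDiv (rconst 1) (RVar ''cc'')) (RDiv (rconst 1) (elem_at ''gm'' ''h'')))) (rconst 2))),
    RAssign ''q'' (RAdd (RVar ''q'') (elem_at ''g2'' ''h'')),
    NAssign ''f'' (NRead ''gf'' (NVar ''h'')),
    NAssign ''h'' (NSub (NVar ''h'') (NConst 1))]"

definition merge_loop :: com where
  "merge_loop =
    While (And (NLess (NConst 0) (NVar ''h'')) (Not (RLess (elem_at ''gm'' ''h'') (RVar ''cc''))))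
     merge_step"

definition delete_step :: com where
  "delete_step =
    seqs [
    find_max,
    NAssign ''j'' (NRead ''next'' (NVar ''i'')),
    NAssign ''p'' (NRead ''prev'' (NVar ''i'')),
    RAssign ''e'' (RSub (elem_at ''b'' ''i'') (elem_at ''b'' ''p'')),
    RAssign ''q'' (RAdd (RVar ''q'') (RMul (RMul (rconst 2) (RSub (elem_at ''b'' ''j'') (elem_at ''b'' ''i''))) (RVar ''e''))),
    RAssign ''E'' (RAdd (RAdd (RVar ''E'') (RMul (RSub (elem_at ''y'' ''j'') (elem_at ''y'' ''i'')) (RVar ''e'')))
      (RDiv (RMul (RSub (elem_at ''b'' ''j'') (elem_at ''b'' ''i'')) (RVar ''e'')) (RVar ''cc''))),
    NWrite ''prev'' (NVar ''j'') (NVar ''p''),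
    NWrite ''next'' (NVar ''p'') (NVar ''j''),
    NAssign ''a'' (NVar ''i''),
    RAssign ''v'' (rconst 0),
    set_leaf,
    If (NLess (NVar ''f'') (NVar ''i''))
      (seqs [
        NAssign ''a'' (NVar ''p''),
        RAssign ''v'' (RDiv (RSub (elem_at ''b'' ''j'') (elem_at ''b'' ''p'')) (RSub (elem_at ''y'' ''p'') (elem_at ''y'' ''j''))),
        set_leaf])
      (NAssign ''f'' (NVar ''j''))]"

definition delete_loop :: com where
  "delete_loop =
    While (Not (RLess (RRead ''tree'' (NConst 1)) (RVar ''cc'')))
     delete_step"

text \<open>Piece \<open>f\<close> takes over the last part, of length \<open>e\<close>, of its predecessor \<open>i\<close>.\<close>

definition transfer :: com where
  "transfer = seqs [
      RAssign ''q'' (RAdd (RAdd (RVar ''q'') (RMul (RMul (rconst 2) (RSub (elem_at ''b'' ''f'') (elem_at ''b'' ''i''))) (RVar ''e'')))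
        (RMul (RVar ''e'') (RVar ''e''))),
      RAssign ''E'' (RAdd (RAdd (RAdd (RVar ''E'') (RMul (RSub (elem_at ''y'' ''f'') (elem_at ''y'' ''i'')) (RVar ''e'')))
        (RDiv (RMul (RSub (elem_at ''b'' ''f'') (elem_at ''b'' ''i'')) (RVar ''e'')) (RVar ''cc'')))
        (RDiv (RMul (RMul (RVar ''e'') (RVar ''e''))
          (RSub (RDiv (rconst 1) (RVar ''cc'')) (RDiv (rconst 1) (elem_at ''gm'' ''h'')))) (rconst 2))),
      RWrite ''g2'' (NVar ''h'') (RAdd (RSub (elem_at ''g2'' ''h'')
        (RMul (RMul (rconst 2) (RSub (elem_at ''b'' ''i'') (elem_at ''b'' ''p''))) (RVar ''e''))) (RMul (RVar ''e'') (RVar ''e'')))]"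

definition cut_piece :: com where
  "cut_piece = seqs [
      transfer,
      RWrite ''y'' (NVar ''i'') (RAdd (elem_at ''y'' ''i'') (RDiv (RVar ''e'') (elem_at ''gm'' ''h''))),
      RWrite ''b'' (NVar ''i'') (RSub (elem_at ''b'' ''i'') (RVar ''e'')),
      If (NLess (NRead ''gf'' (NVar ''h'')) (NVar ''i''))
        (seqs [
          RAssign ''v'' (RDiv (RSub (elem_at ''b'' ''i'') (elem_at ''b'' ''p'')) (RSub (elem_at ''y'' ''p'') (elem_at ''y'' ''i''))),
          set_leaf])
        Skip]"

definition absorb_piece :: com where
  "absorb_piece = seqs [
      RAssign ''e'' (RSub (elem_at ''b'' ''i'') (elem_at ''b'' ''p'')),
      transfer,
      NWrite ''prev'' (NVar ''f'') (NVar ''p''),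
      NWrite ''next'' (NVar ''p'') (NVar ''f''),
      If (NLess (NRead ''gf'' (NVar ''h'')) (NVar ''i''))
        (seqs [RAssign ''v'' (rconst 0), set_leaf])
        (NAssign ''h'' (NSub (NVar ''h'') (NConst 1)))]"

text \<open>\<open>e\<close> is the distance from \<open>b i\<close> back to the crossing of the two
  rays, that is, the solution of \<open>y f + (b f - b i + e) / c = y i + e / gm h\<close>. A
  crossing inside piece \<open>i\<close> cuts it; otherwise the piece is absorbed.\<close>

definition boundary_step :: com where
  "boundary_step =
    seqs [
    NAssign ''i'' (NRead ''prev'' (NVar ''f'')),
    NAssign ''p'' (NRead ''prev'' (NVar ''i'')),
    NAssign ''a'' (NVar ''p''),
    RAssign ''e'' (RDiv
      (RSub (RAdd (elem_at ''y'' ''f'') (RDiv (RSub (elem_at ''b'' ''f'') (elem_at ''b'' ''i'')) (RVar ''cc''))) (elem_at ''y'' ''i''))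
      (RSub (RDiv (rconst 1) (elem_at ''gm'' ''h'')) (RDiv (rconst 1) (RVar ''cc'')))),
    If (RLess (RVar ''e'') (RSub (elem_at ''b'' ''i'') (elem_at ''b'' ''p'')))
      cut_piece
      absorb_piece]"

text \<open>\<open>h > 0\<close> says that there is a piece before \<open>f\<close>; the second test
  says that the ray of \<open>f\<close> exceeds its end point.\<close>

definition boundary_loop :: com where
  "boundary_loop =
    While (And (NLess (NConst 0) (NVar ''h''))
      (RLess (RRead ''y'' (NRead ''prev'' (NVar ''f'')))
        (RAdd (elem_at ''y'' ''f'') (RDiv (RSub (elem_at ''b'' ''f'') (RRead ''b'' (NRead ''prev'' (NVar ''f'')))) (RVar ''cc'')))))
     boundary_step"

lemma wp_seqs:
  "wp (foldr Seq [] r) Q s = wp r Q s"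
  "wp (foldr Seq (p # ps) r) Q s = wp p (\<lambda>t s'. wp (foldr Seq ps r) (\<lambda>t' s''. Q (t + t') s'') s') s"
  by (simp_all add: wp_Seq)

lemmas wp_exec = wp_simps wp_seqs

declare wp_weak_cong [cong]

text \<open>What stays fixed while vertex \<open>k\<close> is processed: the rays \<open>T\<close>,
  \<open>bt\<close>, \<open>yt\<close>, \<open>mt\<close> to be represented, the new capacity
  \<open>c\<close>, the end point \<open>(B, Y)\<close> of piece \<open>k\<close>, which is never
  removed or moved, and a bound \<open>g\<close> on the height of the tree.\<close>

locale step_params =
  fixes n k g :: nat and c B Y :: real and T :: "nat set" and bt yt mt :: "nat \<Rightarrow> real"
  assumes g: "2 * Suc n \<le> 2 ^ g"
begin

text \<open>\<open>S\<close> and \<open>m\<close> exist only in the proof. The equivalence uses the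
  rates capped at \<open>c\<close> from the beginning; the loops change the representation but never
  the envelope it stands for.\<close>

definition step_state :: "nat set \<Rightarrow> (nat \<Rightarrow> real) \<Rightarrow> state \<Rightarrow> bool" where
  "step_state S m s \<longleftrightarrow> nvar s ''N'' = Suc n \<and> rvar s ''cc'' = c \<and>
     (\<forall>x<2 * Suc n. narr s ''par'' x = x div 2) \<and> tree (rarr s ''tree'') (Suc n) \<and>
     step_inv S m k n c (narr s ''prev'') (narr s ''next'') (rarr s ''b'') (rarr s ''y'')
       (narr s ''gf'') (rarr s ''gm'') (rarr s ''g2'') (\<lambda>i. rarr s ''tree'' (Suc n + i))
       (nvar s ''f'') (nvar s ''h'') (rvar s ''q'') (rvar s ''E'') \<and>
     equiv_rays S (rarr s ''b'') (rarr s ''y'') (\<lambda>i. min (m i) c) T bt yt mt \<and>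
     rarr s ''b'' k = B \<and> rarr s ''y'' k = Y"

lemma step_state_inv:
  assumes "step_state S m s"
  shows "step_inv S m k n c (narr s ''prev'') (narr s ''next'') (rarr s ''b'') (rarr s ''y'')
       (narr s ''gf'') (rarr s ''gm'') (rarr s ''g2'') (\<lambda>i. rarr s ''tree'' (Suc n + i))
       (nvar s ''f'') (nvar s ''h'') (rvar s ''q'') (rvar s ''E'')"
  using assms unfolding step_state_def by blast

lemma step_stateI:
  assumes "nvar s ''N'' = Suc n" "rvar s ''cc'' = c"
    "\<And>x. x < 2 * Suc n \<Longrightarrow> narr s ''par'' x = x div 2" "tree (rarr s ''tree'') (Suc n)"
    "step_inv S m k n c (narr s ''prev'') (narr s ''next'') (rarr s ''b'') (rarr s ''y'')
       (narr s ''gf'') (rarr s ''gm'') (rarr s ''g2'') u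
       (nvar s ''f'') (nvar s ''h'') (rvar s ''q'') (rvar s ''E'')"
    "\<And>i. i \<le> n \<Longrightarrow> rarr s ''tree'' (Suc n + i) = u i"
    "equiv_rays S (rarr s ''b'') (rarr s ''y'') (\<lambda>i. min (m i) c) T bt yt mt"
    "rarr s ''b'' k = B" "rarr s ''y'' k = Y"
  shows "step_state S m s"
  unfolding step_state_def using assms step_inv_cong[OF assms(5,6)] by blast

text \<open>Each iteration pops one group, which pays for it. As the rates on the stack increase,
  testing the top group suffices.\<close>

lemma wp_merge_loop:
  assumes "step_state S m s"
  shows "wp merge_loop (\<lambda>\<tau> s'. \<exists>m'. step_state S m' s' \<and> (nvar s' ''h'' = 0 \<or> rarr s' ''gm'' (nvar s' ''h'') < c) \<and>
      \<tau> + (120 * g + 400) * nvar s' ''h'' \<le> (120 * g + 400) * nvar s ''h'' + 20) s"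
proof -
  \<comment> \<open>Enough for one iteration of any of the three loops: at most three tree
    operations of \<open>40 * g + 40\<close> steps each, as in \<open>delete_step\<close>, and a
    constant amount of other work.\<close>
  define A where "A = 120 * g + 400"
  define Inv where "Inv = (\<lambda>v r. (\<exists>m. step_state S m r) \<and> v = A * nvar r ''h'')"
  let ?guard = "And (NLess (NConst 0) (NVar ''h'')) (Not (RLess (elem_at ''gm'' ''h'') (RVar ''cc'')))"
  have "wp merge_loop (\<lambda>\<tau> r'. \<exists>v'. Inv v' r' \<and> \<not> bval r' ?guard \<and> \<tau> + v' \<le> A * nvar s ''h'' + 1 + bcost ?guard) s"
    unfolding merge_loop_def
  proof (rule wp_While)
    show "Inv (A * nvar s ''h'') s" using assms by (auto simp: Inv_def)
    fix v r assume I: "Inv v r" and gd: "bval r ?guard"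
    from I obtain m where st: "step_state S m r" and v: "v = A * nvar r ''h''" by (auto simp: Inv_def)
    let ?b = "rarr r ''b''" and ?y = "rarr r ''y''" and ?h = "nvar r ''h''" and ?f = "nvar r ''f''"
    define p where "p = narr r ''prev'' ?f"
    note S = st[unfolded step_state_def]
    have cc: "rvar r ''cc'' = c" using S by simp
    have hh: "0 < ?h" "c \<le> rarr r ''gm'' ?h" using gd cc by auto
    note si = step_state_inv[OF st]
    note M = step_inv_merge[OF si hh p_def refl refl refl]
    let ?m = "\<lambda>i. if narr r ''gf'' ?h \<le> i then c else m i"
    have eq: "equiv_rays S ?b ?y (\<lambda>i. min (?m i) c) T bt yt mt"
      by (rule equiv_rays_trans[OF equiv_rays_cong]) (use M(2) S in auto)
    have Ah: "A * ?h = A * (?h - 1) + A" using hh(1) by (cases ?h) auto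
    show "wp merge_step
      (\<lambda>\<tau> r'. \<exists>v'. Inv v' r' \<and> 1 + bcost ?guard + \<tau> + v' \<le> v) r"
      unfolding merge_step_def
      apply (simp add: wp_exec del: One_nat_def plus_1_eq_Suc)
      apply (rule wp_set_leaf[where N = "Suc n" and a = p and g = g])
             apply (use S M(3) g in \<open>simp_all add: p_def[symmetric] del: One_nat_def plus_1_eq_Suc\<close>)
      subgoal for \<tau> t'
        apply (simp add: wp_exec cc del: One_nat_def plus_1_eq_Suc)
        apply (rule exI[of _ "A * (?h - 1)"])
        apply (rule conjI)
         apply (simp add: Inv_def)
         apply (rule exI[of _ ?m])
         apply (rule step_stateI[where u = "(\<lambda>i. rarr r ''tree'' (Suc n + i))(p := (?b ?f - ?b p) / (?y p - ?y ?f))"])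
        using S M(1) eq apply (simp_all add: cc del: One_nat_def)
         apply (simp split: if_splits)
        apply (simp only: v Ah)
        apply (simp add: A_def)
        done
      done
  qed
  thus ?thesis
    by (rule wp_mono) (auto simp: Inv_def A_def step_state_def)
qed

definition low_levels :: "state \<Rightarrow> bool" where
  "low_levels s \<longleftrightarrow> (\<forall>l. 1 \<le> l \<and> l \<le> nvar s ''h'' \<longrightarrow> rarr s ''gm'' l < c)"

text \<open>Each iteration removes one piece, which pays for it. The loop ends with a root below
  \<open>c\<close>, when no two neighbours in the last group are due to merge.\<close>

lemma wp_delete_loop:
  assumes "step_state S m s" "low_levels s"
  shows "wp delete_loop (\<lambda>\<tau> s'. \<exists>S' m'. step_state S' m' s' \<and> low_levels s' \<and> rarr s' ''tree'' 1 < c \<and>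
      \<tau> + (120 * g + 400) * card S' \<le> (120 * g + 400) * card S + 20) s"
proof -
  define A where "A = 120 * g + 400"
  define Inv where "Inv = (\<lambda>v r. \<exists>S m. step_state S m r \<and> low_levels r \<and> v = A * card S)"
  have InvI: "step_state S m r \<Longrightarrow> low_levels r \<Longrightarrow> Inv (A * card S) r" for S m r
    by (auto simp: Inv_def)
  let ?guard = "Not (RLess (RRead ''tree'' (NConst 1)) (RVar ''cc''))"
  have "wp delete_loop (\<lambda>\<tau> r'. \<exists>v'. Inv v' r' \<and> \<not> bval r' ?guard \<and> \<tau> + v' \<le> A * card S + 1 + bcost ?guard) s"
    unfolding delete_loop_def
  proof (rule wp_While)
    show "Inv (A * card S) s" using assms by (auto simp: Inv_def)
    fix v r assume I: "Inv v r" and gd: "bval r ?guard"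
    from I obtain S m where st: "step_state S m r" and low: "low_levels r" and v: "v = A * card S"
      by (auto simp: Inv_def)
    let ?b = "rarr r ''b''" and ?y = "rarr r ''y''" and ?h = "nvar r ''h''" and ?f = "nvar r ''f''"
      and ?t = "rarr r ''tree''"
    note R = st[unfolded step_state_def]
    have cc: "rvar r ''cc'' = c" and N: "nvar r ''N'' = Suc n" and tr: "tree ?t (Suc n)" using R by simp_all
    have gd': "c \<le> ?t (Suc 0)" using gd cc by auto
    note si = step_state_inv[OF st]
    have gl: "\<And>l. 1 \<le> l \<Longrightarrow> l \<le> ?h \<Longrightarrow> rarr r ''gm'' l < c" using low by (simp add: low_levels_def)
    have fin: "finite S" using si linked_finite unfolding step_inv_def by blast
    show "wp delete_step
      (\<lambda>\<tau> r'. \<exists>v'. Inv v' r' \<and> 1 + bcost ?guard + \<tau> + v' \<le> v) r"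
      unfolding delete_step_def
      apply (simp only: wp_seqs)
      apply (rule wp_find_max[where N = "Suc n" and g = g])
          apply (use N tr g in \<open>simp_all del: One_nat_def plus_1_eq_Suc\<close>)
      subgoal premises prems for \<tau> i
      proof -
        have \<tau>: "\<tau> \<le> 40 * g + 40" and i: "i < Suc n" "?t (Suc (n + i)) = ?t 1"
          using prems by auto
        define j where "j = narr r ''next'' i"
        define p where "p = narr r ''prev'' i"
        have i': "i \<le> n" "c \<le> ?t (Suc n + i)" using i gd' by auto
        note D = step_inv_delete[OF si gl i' j_def p_def refl refl refl refl]
        have cS: "A * card S = A * card (S - {i}) + A"
          using card_Suc_Diff1[OF fin D(3)] by (metis add.commute mult_Suc_right)
        have eq: "equiv_rays (S - {i}) ?b ?y (\<lambda>i. min (m i) c) T bt yt mt"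
          using equiv_rays_trans[OF D(2)] R by blast
        have kn: "k \<noteq> i" "i < k" using D(4) by auto
        show ?thesis
          apply (simp add: wp_exec j_def[symmetric] p_def[symmetric] cc del: One_nat_def plus_1_eq_Suc)
          apply (rule wp_set_leaf[where N = "Suc n" and a = i and g = g])
                 apply (use R g i in \<open>simp_all del: One_nat_def plus_1_eq_Suc\<close>)
          subgoal premises prems for \<tau>1 t1
          proof -
            have t1: "\<tau>1 \<le> 40 * g + 40" "tree t1 (Suc n)"
              "\<And>l. l < Suc n \<Longrightarrow> t1 (Suc (n + l)) = (if l = i then 0 else ?t (Suc (n + l)))"
              using prems by auto
            show ?thesis
            proof (cases "?f < i")
              case True
              hence ne: "i \<noteq> ?f" by simp
              have pn: "p < Suc n" using D(5) ne by simp
              have L: "linked (narr r ''prev'') (narr r ''next'') S k" using si unfolding step_inv_def by blast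
              have pi: "p \<noteq> i" using linked_prv(1)[OF L, of i] D(3) p_def by simp
              show ?thesis
                using True
                apply (simp add: wp_exec del: One_nat_def plus_1_eq_Suc)
                apply (rule wp_set_leaf[where N = "Suc n" and a = p and g = g])
                       apply (use R g pn t1 in \<open>simp_all del: One_nat_def plus_1_eq_Suc\<close>)
                subgoal for \<tau>2 t2
                  apply (simp add: wp_exec del: One_nat_def plus_1_eq_Suc)
                  apply (rule exI[of _ "A * card (S - {i})"])
                  apply (rule conjI)
                   apply (rule InvI[where m = m])
                    apply (rule step_stateI[where u = "(\<lambda>i. ?t (Suc n + i))(i := 0, p := (?b j - ?b p) / (?y p - ?y j))"])
                  using R D(1) eq ne low t1(1) \<tau> i pi apply (simp_all add: cc low_levels_def del: One_nat_def split: if_splits)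
                  apply (simp only: v cS)
                  apply (simp add: A_def)
                  done
                done
            next
              case False
              hence eqf: "i = ?f" using D(6) by simp
              show ?thesis
                using False
                apply (simp add: wp_exec del: One_nat_def plus_1_eq_Suc)
                apply (rule exI[of _ "A * card (S - {i})"])
                apply (rule conjI)
                 apply (rule InvI[where m = m])
                  apply (rule step_stateI[where u = "(\<lambda>i. ?t (Suc n + i))(i := 0)"])
                using R D(1) eq eqf low t1 \<tau> i apply (simp_all add: cc low_levels_def del: One_nat_def split: if_splits)
                apply (simp only: v cS)
                apply (simp add: A_def)
                done
            qed
          qed
          done
      qed
      done
  qed
  thus ?thesis
  proof (rule wp_mono)
    fix \<tau> s'
    assume "\<exists>v'. Inv v' s' \<and> \<not> bval s' ?guard \<and> \<tau> + v' \<le> A * card S + 1 + bcost ?guard"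
    then obtain S' m' where *: "step_state S' m' s'" "low_levels s'" "\<not> bval s' ?guard"
      "\<tau> + A * card S' \<le> A * card S + 1 + bcost ?guard"
      unfolding Inv_def by blast
    have "rvar s' ''cc'' = c" using *(1) by (simp add: step_state_def)
    hence "rarr s' ''tree'' 1 < c" using *(3) by simp
    thus "\<exists>S' m'. step_state S' m' s' \<and> low_levels s' \<and> rarr s' ''tree'' 1 < c \<and>
        \<tau> + (120 * g + 400) * card S' \<le> (120 * g + 400) * card S + 20"
      using * unfolding A_def by (intro exI[of _ S'] exI[of _ m'] conjI) auto
  qed
qed

end

context step_params
begin

text \<open>An absorption removes a piece, but a cut does not. The potential therefore counts one
  extra unit while the guard holds: a cut makes the two rays meet exactly at the boundary, so the
  guard fails afterwards and this unit pays for the cut.\<close>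

lemma wp_boundary_loop:
  assumes "step_state S m s" "low_levels s"
    "\<And>j. j \<in> S \<Longrightarrow> nvar s ''f'' < j \<Longrightarrow> separated (narr s ''prev'') (rarr s ''b'') (rarr s ''y'') m j"
  shows "wp boundary_loop (\<lambda>\<tau> s'. \<exists>S' m'. step_state S' m' s' \<and> low_levels s' \<and> nvar s' ''h'' \<le> nvar s ''h'' \<and>
      (\<forall>j\<in>S'. separated (narr s' ''prev'') (rarr s' ''b'') (rarr s' ''y'') m' j) \<and>
      \<tau> + (120 * g + 400) * card S' \<le> (120 * g + 400) * (card S + 1) + 30) s"
proof -
  define A where "A = 120 * g + 400"
  let ?guard = "And (NLess (NConst 0) (NVar ''h''))
      (RLess (RRead ''y'' (NRead ''prev'' (NVar ''f'')))
        (RAdd (elem_at ''y'' ''f'') (RDiv (RSub (elem_at ''b'' ''f'') (RRead ''b'' (NRead ''prev'' (NVar ''f'')))) (RVar ''cc''))))"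
  define Inv where "Inv = (\<lambda>v r. \<exists>S m. step_state S m r \<and> low_levels r \<and> nvar r ''h'' \<le> nvar s ''h'' \<and>
      (\<forall>j\<in>S. nvar r ''f'' < j \<longrightarrow> separated (narr r ''prev'') (rarr r ''b'') (rarr r ''y'') m j) \<and>
      v = A * (card S + (if bval r ?guard then 1 else 0)))"
  have InvI: "Inv v r" if "step_state S m r" "low_levels r" "nvar r ''h'' \<le> nvar s ''h''"
    "\<And>j. j \<in> S \<Longrightarrow> nvar r ''f'' < j \<Longrightarrow> separated (narr r ''prev'') (rarr r ''b'') (rarr r ''y'') m j"
    "v = A * (card S + (if bval r ?guard then 1 else 0))" for S m r v
    using that unfolding Inv_def by blast
  \<comment> \<open>After an absorption the value of the guard is unknown, so its unit of potential
    is granted in either case; the removed piece pays.\<close>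
  have InvX: "\<exists>v'. Inv v' r \<and> Q v'" if "step_state S m r" "low_levels r" "nvar r ''h'' \<le> nvar s ''h''"
    "\<And>j. j \<in> S \<Longrightarrow> nvar r ''f'' < j \<Longrightarrow> separated (narr r ''prev'') (rarr r ''b'') (rarr r ''y'') m j"
    "\<And>v'. v' \<le> A * (card S + 1) \<Longrightarrow> Q v'" for S m r Q
  proof -
    have "A * (card S + (if bval r ?guard then 1 else 0)) \<le> A * (card S + 1)" by simp
    thus ?thesis using that(5) InvI[OF that(1-4) refl] by blast
  qed
  have "wp boundary_loop (\<lambda>\<tau> r'. \<exists>v'. Inv v' r' \<and> \<not> bval r' ?guard \<and>
      \<tau> + v' \<le> A * (card S + (if bval s ?guard then 1 else 0)) + 1 + bcost ?guard) s"
    unfolding boundary_loop_def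
  proof (rule wp_While)
    show "Inv (A * (card S + (if bval s ?guard then 1 else 0))) s"
      by (rule InvI) (use assms in auto)
    fix v r assume I: "Inv v r" and gd: "bval r ?guard"
    from I obtain S m where st: "step_state S m r" and low: "low_levels r"
      and hs: "nvar r ''h'' \<le> nvar s ''h''"
      and sep: "\<And>j. j \<in> S \<Longrightarrow> nvar r ''f'' < j \<Longrightarrow> separated (narr r ''prev'') (rarr r ''b'') (rarr r ''y'') m j"
      and v: "v = A * (card S + 1)"
      unfolding Inv_def using gd by auto
    let ?b = "rarr r ''b''" and ?y = "rarr r ''y''" and ?h = "nvar r ''h''" and ?f = "nvar r ''f''"
      and ?t = "rarr r ''tree''" and ?u = "\<lambda>i. rarr r ''tree'' (Suc n + i)" and ?gm = "rarr r ''gm''"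
      and ?g2 = "rarr r ''g2''" and ?gf = "narr r ''gf''"
    define i where "i = narr r ''prev'' ?f"
    define p where "p = narr r ''prev'' i"
    define e where "e = (?y ?f + (?b ?f - ?b i) / c - ?y i) / (1 / ?gm ?h - 1 / c)"
    note R = st[unfolded step_state_def]
    have cc: "rvar r ''cc'' = c" using R by simp
    have h0: "0 < ?h" and ov: "?y i < ?y ?f + (?b ?f - ?b i) / c" using gd cc by (auto simp: i_def)
    note si = step_state_inv[OF st]
    have gl: "\<And>l. 1 \<le> l \<Longrightarrow> l \<le> ?h \<Longrightarrow> ?gm l < c" using low by (simp add: low_levels_def)
    have gpos: "0 < ?gm ?h" "?gm ?h < c" and ik: "i < k" "?f \<le> k" and fi: "?f \<noteq> i" and pi1: "p < i" and iS: "i \<in> S"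
      and gfi: "?gf ?h \<le> i" and c0: "0 < c" and L: "linked (narr r ''prev'') (narr r ''next'') S k"
      using boundary[OF si h0 gl sep i_def p_def] by auto
    have pi: "p < i" "p \<noteq> i" using pi1 by auto
    have fin: "finite S" by (rule linked_finite[OF L])
    have inv: "1 / c < 1 / ?gm ?h" using gpos c0 by (simp add: frac_less2)
    have e0: "0 < e" using ov inv by (simp add: e_def)
    have ee: "e / ?gm ?h - e / c = ?y ?f + (?b ?f - ?b i) / c - ?y i"
    proof -
      have "e * (1 / ?gm ?h - 1 / c) = ?y ?f + (?b ?f - ?b i) / c - ?y i" using gpos(2) by (simp add: e_def)
      thus ?thesis by (simp add: right_diff_distrib)
    qed
    have cut: "wp cut_piece (\<lambda>\<tau> r'. \<exists>v'. Inv v' r' \<and> \<tau> + v' + 100 \<le> v)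
         (r\<lparr>nvar := (nvar r)(''i'' := i, ''p'' := p, ''a'' := p), rvar := (rvar r)(''e'' := e)\<rparr>)"
      if less: "e < ?b i - ?b p"
    proof -
      define x where "x = ?b i - e"
      define y' where "y' = ?y i + e / ?gm ?h"
      have x: "?b p < x" "x < ?b i" "?b i - x = e" using less e0 by (auto simp: x_def)
      have y': "y' = ?y i + (?b i - x) / ?gm ?h" "y' = ?y ?f + (?b ?f - x) / c"
        using ee by (auto simp: y'_def x_def diff_divide_distrib)
      note C = step_inv_cut[OF si h0 gl sep i_def p_def x(1,2) y' refl refl refl refl,
          unfolded x(3) power2_eq_square]
      have eq: "equiv_rays S (?b(i := x)) (?y(i := y')) (\<lambda>i. min (m i) c) T bt yt mt"
        using equiv_rays_trans[OF C(3)] R by blast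
      have sepf: "y' = ?y ?f + (?b ?f - x) / c" by (rule y'(2))
      have sep': "\<And>j. j \<in> S \<Longrightarrow> separated (narr r ''prev'') (?b(i := x)) (?y(i := y')) m j"
        using C(2) by auto
      show ?thesis
      proof (cases "?gf ?h < i")
        case True
        hence ne: "i \<noteq> ?gf ?h" by simp
        have pn: "p < Suc n" using C(4) ne by simp
        show ?thesis
          unfolding cut_piece_def transfer_def
          apply (simp add: wp_exec cc True x_def[symmetric] y'_def[symmetric] fi pi del: One_nat_def plus_1_eq_Suc)
          apply (rule wp_set_leaf[where N = "Suc n" and a = p and g = g])
                 apply (use R g pn in \<open>simp_all del: One_nat_def plus_1_eq_Suc\<close>)
          subgoal for \<tau> t1
            apply (simp add: wp_exec del: One_nat_def plus_1_eq_Suc)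
            apply (rule exI[of _ "A * card S"])
            apply (rule conjI)
             apply (rule InvI[where S = S and m = m])
                 apply (rule step_stateI[where u = "?u(p := (x - ?b p) / (?y p - y'))"])
            subgoal using R by simp
            subgoal using R by simp
            subgoal using R by simp
            subgoal  by simp
            subgoal using C(1) ne by (simp add: cc)
            subgoal by simp
            subgoal using eq by simp
            subgoal using R ik by simp
            subgoal using R ik by simp
            subgoal using low by (simp add: low_levels_def)
            subgoal using hs by simp
            subgoal using sep' by simp
            subgoal using fi sepf by (simp add: cc i_def[symmetric] order_less_irrefl)
            apply (simp only: v)
            apply (simp add: A_def)
            done
          done
      next
        case False
        hence eqi: "i = ?gf ?h" using gfi by simp
        show ?thesis
          unfolding cut_piece_def transfer_def
          apply (simp add: wp_exec cc False x_def[symmetric] y'_def[symmetric] fi pi del: One_nat_def plus_1_eq_Suc)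
          apply (rule exI[of _ "A * card S"])
          apply (rule conjI)
           apply (rule InvI[where S = S and m = m])
               apply (rule step_stateI[where u = "?u"])
          subgoal using R by simp
          subgoal using R by simp
          subgoal using R by simp
          subgoal using R by simp
          subgoal using C(1) eqi by (simp add: cc)
          subgoal by simp
          subgoal using eq by simp
          subgoal using R ik by simp
          subgoal using R ik by simp
          subgoal using low by (simp add: low_levels_def)
          subgoal using hs by simp
          subgoal using sep' by simp
          subgoal using fi sepf by (simp add: cc i_def[symmetric] order_less_irrefl)
          apply (simp only: v)
          apply (simp add: A_def)
          done
      qed
    qed
    have absorb: "wp absorb_piece (\<lambda>\<tau> r'. \<exists>v'. Inv v' r' \<and> \<tau> + v' + 100 \<le> v)
         (r\<lparr>nvar := (nvar r)(''i'' := i, ''p'' := p, ''a'' := p), rvar := (rvar r)(''e'' := e)\<rparr>)"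
      if nless: "\<not> e < ?b i - ?b p"
    proof -
      have "(?b i - ?b p) * (1 / ?gm ?h - 1 / c) \<le> e * (1 / ?gm ?h - 1 / c)"
        using nless inv by (intro mult_right_mono) auto
      hence "(?b i - ?b p) / ?gm ?h - (?b i - ?b p) / c \<le> e / ?gm ?h - e / c"
        by (simp add: right_diff_distrib)
      hence le: "?y i + (?b i - ?b p) / ?gm ?h \<le> ?y ?f + (?b ?f - ?b p) / c"
        unfolding ee by (simp add: diff_divide_distrib)
      note C = step_inv_absorb[OF si h0 gl sep i_def p_def le refl refl refl refl refl,
          unfolded power2_eq_square]
      have eq: "equiv_rays (S - {i}) ?b ?y (\<lambda>i. min (m i) c) T bt yt mt"
        using equiv_rays_trans[OF C(3)] R by blast
      have sep': "\<And>j. j \<in> S - {i} \<Longrightarrow> ?f < j \<Longrightarrow> separated ((narr r ''prev'')(?f := p)) ?b ?y m j"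
        using C(2) by auto
      have cS: "card S = Suc (card (S - {i}))" using card_Suc_Diff1[OF fin iS] by simp
      have vv: "v = A * (card (S - {i}) + 1) + A" unfolding v cS by simp
      show ?thesis
      proof (cases "?gf ?h < i")
        case True
        hence ne: "i \<noteq> ?gf ?h" by simp
        have pn: "p < Suc n" using C(4) ne by simp
        show ?thesis
          unfolding absorb_piece_def transfer_def
          apply (simp add: wp_exec cc True fi pi del: One_nat_def plus_1_eq_Suc)
          apply (rule wp_set_leaf[where N = "Suc n" and a = p and g = g])
                 apply (use R g pn in \<open>simp_all del: One_nat_def plus_1_eq_Suc\<close>)
          subgoal for \<tau> t1
            apply (simp add: wp_exec del: One_nat_def plus_1_eq_Suc)
            apply (rule InvX[where S = "S - {i}" and m = m])
                apply (rule step_stateI[where u = "?u(p := 0)"])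
            subgoal using R by simp
            subgoal using R by simp
            subgoal using R by simp
            subgoal  by simp
            subgoal using C(1) ne by (simp add: cc)
            subgoal by simp
            subgoal using eq by simp
            subgoal using R ik by simp
            subgoal using R ik by simp
            subgoal using low by (simp add: low_levels_def)
            subgoal using hs by simp
            subgoal using sep' by simp
            apply (simp only: vv)
            apply (simp add: A_def)
            done
          done
      next
        case False
        hence eqi: "i = ?gf ?h" using gfi by simp
        show ?thesis
          unfolding absorb_piece_def transfer_def
          apply (simp add: wp_exec cc False fi pi del: One_nat_def plus_1_eq_Suc)
          apply (rule InvX[where S = "S - {i}" and m = m])
              apply (rule step_stateI[where u = "?u"])
          subgoal using R by simp
          subgoal using R by simp
          subgoal using R by simp
          subgoal using R by simp
          subgoal using C(1) eqi by (simp add: cc)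
          subgoal by simp
          subgoal using eq by simp
          subgoal using R ik by simp
          subgoal using R ik by simp
          subgoal using low by (auto simp: low_levels_def)
          subgoal using hs by simp
          subgoal using sep' by simp
          apply (simp only: vv)
          apply (simp add: A_def)
          done
      qed
    qed
    show "wp boundary_step
      (\<lambda>\<tau> r'. \<exists>v'. Inv v' r' \<and> 1 + bcost ?guard + \<tau> + v' \<le> v) r"
    proof (cases "e < ?b i - ?b p")
      case True
      show ?thesis
        unfolding boundary_step_def
        apply (simp add: wp_exec i_def[symmetric] p_def[symmetric] cc e_def[symmetric] True
            del: One_nat_def plus_1_eq_Suc)
        apply (rule wp_mono[OF cut[OF True]])
        apply (simp add: wp_exec, elim exE conjE, rule exI, erule conjI, simp)
        done
    next
      case False
      show ?thesis
        unfolding boundary_step_def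
        apply (simp add: wp_exec i_def[symmetric] p_def[symmetric] cc e_def[symmetric] False
            del: One_nat_def plus_1_eq_Suc)
        apply (rule wp_mono[OF absorb[OF False]])
        apply (simp add: wp_exec, elim exE conjE, rule exI, erule conjI, simp)
        done
    qed
  qed
  thus ?thesis
  proof (rule wp_mono)
    fix \<tau> r
    assume "\<exists>v'. Inv v' r \<and> \<not> bval r ?guard \<and>
      \<tau> + v' \<le> A * (card S + (if bval s ?guard then 1 else 0)) + 1 + bcost ?guard"
    then obtain v' where v': "Inv v' r" "\<not> bval r ?guard"
      "\<tau> + v' \<le> A * (card S + (if bval s ?guard then 1 else 0)) + 1 + bcost ?guard" by blast
    from v'(1,2) obtain S' m' where st: "step_state S' m' r" and low: "low_levels r"
      and hs: "nvar r ''h'' \<le> nvar s ''h''"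
      and sep: "\<And>j. j \<in> S' \<Longrightarrow> nvar r ''f'' < j \<Longrightarrow> separated (narr r ''prev'') (rarr r ''b'') (rarr r ''y'') m' j"
      and v: "v' = A * card S'"
      unfolding Inv_def by auto
    let ?b = "rarr r ''b''" and ?y = "rarr r ''y''" and ?h = "nvar r ''h''" and ?f = "nvar r ''f''"
    let ?prv = "narr r ''prev''"
    have cc: "rvar r ''cc'' = c" using st by (simp add: step_state_def)
    note si = step_state_inv[OF st]
    \<comment> \<open>When the guard fails, either no piece precedes \<open>f\<close>, or its ray is
      low enough. The inequality need not be strict, as the preceding rate lies below
      \<open>c\<close>.\<close>
    have sepf: "separated ?prv ?b ?y m' ?f"
    proof (cases "?prv ?f = 0")
      case False
      have L: "linked ?prv (narr r ''next'') S' k" and V: "levels ?prv ?b m' S' ?f ?h (narr r ''gf'') (rarr r ''gm'') (rarr r ''g2'')"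
        and f: "?f \<in> S'" and top: "m' ?f = c" using si unfolding step_inv_def by auto
      have p: "?prv ?f \<in> S'" "?prv ?f < ?f" using linked_prv[OF L f] False by auto
      obtain l where l: "1 \<le> l" "l \<le> ?h" "m' (?prv ?f) = rarr r ''gm'' l" using levels_ex[OF V p] by blast
      hence "m' (?prv ?f) < c" using low by (simp add: low_levels_def)
      moreover have "\<not> ?y (?prv ?f) < ?y ?f + (?b ?f - ?b (?prv ?f)) / c"
        using v'(2) l cc by auto
      ultimately show ?thesis using top by (simp add: separated_def)
    qed (simp add: separated_def)
    have "separated ?prv ?b ?y m' j" if "j \<in> S'" for j
    proof -
      have "\<forall>j\<in>S'. j < ?f \<longrightarrow> separated ?prv ?b ?y m' j" using si unfolding step_inv_def by blast
      thus ?thesis using sep[OF that] sepf that by (cases j ?f rule: linorder_cases) auto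
    qed
    moreover have "A * (card S + (if bval s ?guard then 1 else 0)) \<le> A * (card S + 1)" by simp
    ultimately show "\<exists>S' m'. step_state S' m' r \<and> low_levels r \<and> nvar r ''h'' \<le> nvar s ''h'' \<and>
      (\<forall>j\<in>S'. separated (narr r ''prev'') (rarr r ''b'') (rarr r ''y'') m' j) \<and>
      \<tau> + (120 * g + 400) * card S' \<le> (120 * g + 400) * (card S + 1) + 30"
      using st low hs v'(3) v unfolding A_def[symmetric]
      by (intro exI[of _ S'] exI[of _ m'] conjI) auto
  qed
qed

end

section \<open>The three loops in sequence\<close>

definition loops :: com where
  "loops = Seq merge_loop (Seq delete_loop boundary_loop)"

lemma writes_set_leaf: "writes set_leaf = {''tree'', ''x''}"
  by (auto simp: set_leaf_def fix_node_def)

lemma writes_find_max: "writes find_max = {''x'', ''i''}"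
  by (auto simp: find_max_def descend_def)

lemma writes_loops: "writes merge_loop \<subseteq> {''a'', ''v'', ''tree'', ''x'', ''E'', ''q'', ''f'', ''h''}"
  "writes delete_loop \<subseteq> {''x'', ''i'', ''j'', ''p'', ''e'', ''q'', ''E'', ''prev'', ''next'', ''a'', ''v'', ''tree'', ''f''}"
  "writes boundary_loop \<subseteq> {''i'', ''p'', ''a'', ''e'', ''q'', ''E'', ''g2'', ''y'', ''b'', ''v'', ''tree'', ''x'',
     ''prev'', ''next'', ''h''}"
  unfolding merge_loop_def delete_loop_def boundary_loop_def merge_step_def delete_step_def
    boundary_step_def cut_piece_def absorb_piece_def transfer_def
  by (simp_all add: writes_set_leaf writes_find_max)

definition unaffected :: "state \<Rightarrow> state \<Rightarrow> bool" where
  "unaffected s s' \<longleftrightarrow> (\<forall>x\<in>{''n'', ''N'', ''k'', ''tau'', ''W'', ''X'', ''cc'', ''iw'', ''id'', ''ic'', ''out'', ''par'', ''gm'', ''gf''}. agree x s s')"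

context step_params
begin

lemma low_levelsI:
  assumes "step_state S m s" "nvar s ''h'' = 0 \<or> rarr s ''gm'' (nvar s ''h'') < c"
  shows "low_levels s"
  unfolding low_levels_def
proof (intro allI impI)
  fix l assume l: "1 \<le> l \<and> l \<le> nvar s ''h''"
  have V: "levels (narr s ''prev'') (rarr s ''b'') m S (nvar s ''f'') (nvar s ''h'')
      (narr s ''gf'') (rarr s ''gm'') (rarr s ''g2'')"
    using step_state_inv[OF assms(1)] unfolding step_inv_def by blast
  show "rarr s ''gm'' l < c"
    using levels_strict[OF V, of l "nvar s ''h''"] assms(2) l by (cases "l = nvar s ''h''") auto
qed

text \<open>A root below \<open>c\<close> bounds all thresholds in the last group, and a threshold
  below the common rate is strict separation.\<close>

lemma top_separated:
  assumes st: "step_state S m s" and t: "rarr s ''tree'' 1 < c" and j: "j \<in> S" "nvar s ''f'' < j"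
  shows "separated (narr s ''prev'') (rarr s ''b'') (rarr s ''y'') m j"
proof -
  let ?b = "rarr s ''b''" and ?y = "rarr s ''y''" and ?f = "nvar s ''f''"
  define i where "i = narr s ''prev'' j"
  note si = step_state_inv[OF st]
  have L: "linked (narr s ''prev'') (narr s ''next'') S k" and kn: "k \<le> n"
    and H: "heights (narr s ''prev'') ?b ?y S"
    and T: "thresholds (narr s ''next'') ?b ?y m S k ?f n (\<lambda>i. rarr s ''tree'' (Suc n + i))"
    and f: "?f \<in> S" and top: "\<And>i. i \<in> S \<Longrightarrow> ?f \<le> i \<Longrightarrow> m i = c" and c: "0 < c"
    using si unfolding step_inv_def by auto
  have i: "i < j" "narr s ''next'' i = j" "?f \<le> i"
    using linked_prv[OF L j(1)] j(2) f by (auto simp: i_def)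
  have i0: "i \<noteq> 0" using linked_bounds[OF L f] i by simp
  hence iS: "i \<in> S" using linked_prv(2)[OF L j(1)] by (simp add: i_def)
  have ik: "i < k" "i \<le> n" using linked_bounds[OF L j(1)] i kn by auto
  have y: "?y j < ?y i" using H j(1) i0 by (auto simp: heights_def i_def)
  have "rarr s ''tree'' (Suc n + i) \<le> rarr s ''tree'' 1"
    by (rule tree_le_root[of _ "Suc n"]) (use st ik in \<open>auto simp: step_state_def\<close>)
  moreover have "rarr s ''tree'' (Suc n + i) = (?b j - ?b i) / (?y i - ?y j)"
    using T iS ik i unfolding thresholds_def by auto
  ultimately have "(?b j - ?b i) / (?y i - ?y j) < c" using t by simp
  hence "(?b j - ?b i) / c < ?y i - ?y j" using y c by (simp add: field_simps)
  thus ?thesis using top[OF j(1)] j(2) by (simp add: separated_def i_def)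
qed

text \<open>The budgets can be added because the merge loop keeps the pieces and the delete loop
  keeps the stack height. The extra unit is the possible cut.\<close>

lemma wp_loops:
  assumes st: "step_state S m s"
  shows "wp loops (\<lambda>\<tau> s'. \<exists>S' m'. step_state S' m' s' \<and> low_levels s' \<and>
      (\<forall>j\<in>S'. separated (narr s' ''prev'') (rarr s' ''b'') (rarr s' ''y'') m' j) \<and> unaffected s s' \<and>
      \<tau> + (120 * g + 400) * (card S' + nvar s' ''h'') \<le> (120 * g + 400) * (card S + nvar s ''h'' + 1) + 70) s"
  unfolding loops_def wp_Seq
proof (rule wp_mono[OF wp_agree[OF wp_merge_loop[OF st]]], elim exE conjE)
  let ?A = "120 * g + 400"
  fix \<tau>1 s1 m1
  assume 1: "step_state S m1 s1" "nvar s1 ''h'' = 0 \<or> rarr s1 ''gm'' (nvar s1 ''h'') < c"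
    "\<tau>1 + ?A * nvar s1 ''h'' \<le> ?A * nvar s ''h'' + 20"
    "\<forall>x. x \<notin> writes merge_loop \<longrightarrow> agree x s s1"
  note low1 = low_levelsI[OF 1(1,2)]
  show "wp delete_loop (\<lambda>\<tau>2 s2. wp boundary_loop (\<lambda>\<tau>3 s'. \<exists>S' m'. step_state S' m' s' \<and> low_levels s' \<and>
      (\<forall>j\<in>S'. separated (narr s' ''prev'') (rarr s' ''b'') (rarr s' ''y'') m' j) \<and> unaffected s s' \<and>
      \<tau>1 + (\<tau>2 + \<tau>3) + ?A * (card S' + nvar s' ''h'') \<le> ?A * (card S + nvar s ''h'' + 1) + 70) s2) s1"
  proof (rule wp_mono[OF wp_agree[OF wp_delete_loop[OF 1(1) low1]]], elim exE conjE)
    fix \<tau>2 s2 S2 m2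
    assume 2: "step_state S2 m2 s2" "low_levels s2" "rarr s2 ''tree'' 1 < c"
      "\<tau>2 + ?A * card S2 \<le> ?A * card S + 20" "\<forall>x. x \<notin> writes delete_loop \<longrightarrow> agree x s1 s2"
    show "wp boundary_loop (\<lambda>\<tau>3 s'. \<exists>S' m'. step_state S' m' s' \<and> low_levels s' \<and>
      (\<forall>j\<in>S'. separated (narr s' ''prev'') (rarr s' ''b'') (rarr s' ''y'') m' j) \<and> unaffected s s' \<and>
      \<tau>1 + (\<tau>2 + \<tau>3) + ?A * (card S' + nvar s' ''h'') \<le> ?A * (card S + nvar s ''h'' + 1) + 70) s2"
    proof (rule wp_mono[OF wp_agree[OF wp_boundary_loop[OF 2(1,2) top_separated[OF 2(1,3)]]]], assumption, assumption, elim exE conjE)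
      fix \<tau>3 s' S' m'
      assume 3: "step_state S' m' s'" "low_levels s'" "nvar s' ''h'' \<le> nvar s2 ''h''"
        "\<forall>j\<in>S'. separated (narr s' ''prev'') (rarr s' ''b'') (rarr s' ''y'') m' j"
        "\<tau>3 + ?A * card S' \<le> ?A * (card S2 + 1) + 30" "\<forall>x. x \<notin> writes boundary_loop \<longrightarrow> agree x s2 s'"
      have "''h'' \<notin> writes delete_loop" using writes_loops(2) by auto
      hence "nvar s2 ''h'' = nvar s1 ''h''" using 2(5) by (auto simp: agree_def)
      hence "?A * nvar s' ''h'' \<le> ?A * nvar s1 ''h''" using 3(3) by simp
      hence time: "\<tau>1 + (\<tau>2 + \<tau>3) + ?A * (card S' + nvar s' ''h'') \<le> ?A * (card S + nvar s ''h'' + 1) + 70"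
        using 1(3) 2(4) 3(5) unfolding distrib_left by linarith
      have "unaffected s s'"
        unfolding unaffected_def
      proof
        fix x assume x: "x \<in> {''n'', ''N'', ''k'', ''tau'', ''W'', ''X'', ''cc'', ''iw'', ''id'', ''ic'', ''out'', ''par'', ''gm'', ''gf''}"
        have "x \<notin> writes merge_loop" "x \<notin> writes delete_loop" "x \<notin> writes boundary_loop"
          using writes_loops x by auto
        hence "agree x s s1" "agree x s1 s2" "agree x s2 s'" using 1(4) 2(5) 3(6) by auto
        thus "agree x s s'" by (simp add: agree_def)
      qed
      thus "\<exists>S' m'. step_state S' m' s' \<and> low_levels s' \<and>
        (\<forall>j\<in>S'. separated (narr s' ''prev'') (rarr s' ''b'') (rarr s' ''y'') m' j) \<and> unaffected s s' \<and>
        \<tau>1 + (\<tau>2 + \<tau>3) + ?A * (card S' + nvar s' ''h'') \<le> ?A * (card S + nvar s ''h'' + 1) + 70"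
        using 3 time by blast
    qed
  qed
qed

end

text \<open>The vertex enters with end point \<open>(W, -X)\<close>. The last write is the affine
  formula for the left cost, evaluated at the next vertex, whose offset is the updated
  \<open>X\<close>.\<close>

definition scan_step :: com where
  "scan_step = seqs [
    RAssign ''W'' (RAdd (RVar ''W'') (elem_at ''iw'' ''k'')),
    RAssign ''cc'' (elem_at ''ic'' ''k''),
    RWrite ''b'' (NVar ''k'') (RVar ''W''),
    RWrite ''y'' (NVar ''k'') (RSub (rconst 0) (RVar ''X'')),
    NWrite ''prev'' (NVar ''k'') (NSub (NVar ''k'') (NConst 1)),
    NWrite ''next'' (NSub (NVar ''k'') (NConst 1)) (NVar ''k''),
    RAssign ''q'' (RMul (elem_at ''iw'' ''k'') (elem_at ''iw'' ''k'')),
    RAssign ''E'' (RAdd (RAdd (RVar ''E'') (RMul (elem_at ''y'' ''k'') (elem_at ''iw'' ''k'')))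
      (RDiv (RVar ''q'') (RMul (rconst 2) (RVar ''cc'')))),
    NAssign ''f'' (NVar ''k''),
    loops,
    NAssign ''h'' (NAdd (NVar ''h'') (NConst 1)),
    RWrite ''gm'' (NVar ''h'') (RVar ''cc''),
    NWrite ''gf'' (NVar ''h'') (NVar ''f''),
    RWrite ''g2'' (NVar ''h'') (RVar ''q''),
    RAssign ''X'' (RAdd (RVar ''X'') (RMul (RVar ''tau'') (elem_at ''id'' ''k''))),
    NAssign ''k'' (NAdd (NVar ''k'') (NConst 1)),
    RWrite ''out'' (NVar ''k'') (RAdd (RMul (RVar ''X'') (RVar ''W'')) (RVar ''E''))]"

section \<open>Invariant and cost of the scan\<close>

definition inputs :: "path_network \<Rightarrow> state \<Rightarrow> bool" where
  "inputs Q s \<longleftrightarrow> nvar s ''n'' = num_vertices Q \<and> rvar s ''tau'' = tau Q \<and>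
     (\<forall>i. 1 \<le> i \<and> i \<le> num_vertices Q \<longrightarrow> rarr s ''iw'' i = weight Q i) \<and>
     (\<forall>i. 1 \<le> i \<and> i < num_vertices Q \<longrightarrow> rarr s ''id'' i = edge_len Q i \<and> rarr s ''ic'' i = capacity Q i)"

text \<open>The register \<open>k\<close> names the next vertex to be processed. The output is one
  entry ahead of the envelope, because the left cost at vertex \<open>Suc k\<close> involves only
  the first \<open>k\<close> vertices.\<close>

definition scan_inv :: "path_network \<Rightarrow> nat set \<Rightarrow> (nat \<Rightarrow> real) \<Rightarrow> nat \<Rightarrow> state \<Rightarrow> bool" where
  "scan_inv Q S m k s \<longleftrightarrow> inputs Q s \<and> (let n = num_vertices Q in
     nvar s ''N'' = Suc n \<and> nvar s ''k'' = Suc k \<and> Suc k \<le> n \<and>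
     (\<forall>x<2 * Suc n. narr s ''par'' x = x div 2) \<and> tree (rarr s ''tree'') (Suc n) \<and>
     rest_inv S m k n (narr s ''prev'') (narr s ''next'') (rarr s ''b'') (rarr s ''y'')
       (narr s ''gf'') (rarr s ''gm'') (rarr s ''g2'') (\<lambda>i. rarr s ''tree'' (Suc n + i))
       (nvar s ''h'') (rvar s ''E'') \<and>
     equiv_rays S (rarr s ''b'') (rarr s ''y'') m
       {1..k} (total_weight Q) (\<lambda>j. - offset Q j) (\<lambda>j. rate (capacity Q) j k) \<and>
     rarr s ''b'' k = total_weight Q k \<and> (k \<noteq> 0 \<longrightarrow> rarr s ''y'' k = - offset Q k) \<and>
     rvar s ''W'' = total_weight Q k \<and> rvar s ''X'' = offset Q (Suc k) \<and>
     (\<forall>i. 1 \<le> i \<and> i \<le> Suc k \<longrightarrow> rarr s ''out'' i = left_cost Q (pos Q i)))"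

lemma rest_inv_pos:
  assumes "rest_inv S m k n prv nxt b y gf gm g2 u h E" "i \<in> S"
  shows "0 < m i"
proof -
  have L: "linked prv nxt S k" and V: "levels prv b m S (Suc k) h gf gm g2"
    using assms(1) unfolding rest_inv_def by auto
  obtain l where "1 \<le> l" "l \<le> h" "m i = gm l"
    using levels_ex[OF V assms(2)] linked_bounds[OF L assms(2)] by auto
  thus ?thesis using levels_group(4)[OF V] by auto
qed

lemma rest_inv_area:
  assumes Q: "path_network Q" and k: "1 \<le> k" "k < num_vertices Q"
    and R: "rest_inv S m k n prv nxt b y gf gm g2 u h E"
    and eq: "equiv_rays S b y m {1..k} (total_weight Q) (\<lambda>j. - offset Q j) (\<lambda>j. rate (capacity Q) j k)"
    and b: "b k = total_weight Q k"
  shows "residual_area Q k = E"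
proof -
  have L: "linked prv nxt S k" and H: "heights prv b y S" and V: "levels prv b m S (Suc k) h gf gm g2"
    and E: "E = area prv b y m S" and sep: "\<And>j. j \<in> S \<Longrightarrow> separated prv b y m j"
    using R unfolding rest_inv_def by auto
  have kS: "k \<in> S" using L k by (auto simp: linked_def)
  have mono: "m i \<le> m j" if "i \<in> S" "j \<in> S" "i \<le> j" for i j
    using levels_mono[OF V that(1,2,3)] linked_bounds[OF L that(2)] by simp
  have "(envelope S b y m has_integral E) {0..b k}"
    unfolding E by (rule envelope_has_integral[OF L H _ mono sep]) (use rest_inv_pos[OF R] in auto)
  moreover have "envelope S b y m p = residual Q k p" if "p \<in> {0..b k}" for p
    unfolding residual_def
    by (rule equiv_rays_envelope[OF eq linked_finite[OF L] _ kS]) (use that in auto)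
  ultimately have "(residual Q k has_integral E) {0..b k}" by (metis has_integral_cong)
  thus ?thesis unfolding residual_area_def[OF Q] b[symmetric] by (rule integral_unique)
qed

text \<open>The three additional units of potential are the new piece, the possible cut and the
  group that is pushed at the end; 300 covers the straight-line code.\<close>

lemma wp_scan_step:
  assumes Q: "path_network Q" and g: "2 * Suc (num_vertices Q) \<le> 2 ^ g"
    and I: "scan_inv Q S m k s" and k: "Suc k < num_vertices Q"
  shows "wp scan_step (\<lambda>\<tau> s'. \<exists>S' m'. scan_inv Q S' m' (Suc k) s' \<and>
    \<tau> + (120 * g + 400) * (card S' + nvar s' ''h'') \<le> (120 * g + 400) * (card S + nvar s ''h'' + 3) + 300) s"
proof -
  let ?n = "num_vertices Q" and ?b = "rarr s ''b''" and ?y = "rarr s ''y''" and ?W = "total_weight Q"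
  let ?A = "120 * g + 400"
  define c where "c = capacity Q (Suc k)"
  define w where "w = weight Q (Suc k)"
  interpret step_params ?n "Suc k" g c "?W (Suc k)" "- offset Q (Suc k)" "{1..Suc k}" ?W
    "\<lambda>j. - offset Q j" "\<lambda>j. rate (capacity Q) j (Suc k)"
    by unfold_locales (rule g)
  have c: "0 < c" and w: "0 < w" and edge: "0 < edge_len Q (Suc k)" and tau: "0 < tau Q"
    using Q k by (auto simp: path_network_def c_def w_def)
  have inp: "inputs Q s" and N: "nvar s ''N'' = Suc ?n" and kk: "nvar s ''k'' = Suc k"
    and par: "\<And>x. x < 2 * Suc ?n \<Longrightarrow> narr s ''par'' x = x div 2" and tr: "tree (rarr s ''tree'') (Suc ?n)"
    and R: "rest_inv S m k ?n (narr s ''prev'') (narr s ''next'') ?b ?y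
       (narr s ''gf'') (rarr s ''gm'') (rarr s ''g2'') (\<lambda>i. rarr s ''tree'' (Suc ?n + i))
       (nvar s ''h'') (rvar s ''E'')"
    and eq: "equiv_rays S ?b ?y m {1..k} ?W (\<lambda>j. - offset Q j) (\<lambda>j. rate (capacity Q) j k)"
    and bk: "?b k = ?W k" and yk: "k \<noteq> 0 \<Longrightarrow> ?y k = - offset Q k"
    and W: "rvar s ''W'' = ?W k" and X: "rvar s ''X'' = offset Q (Suc k)"
    and out: "\<And>i. 1 \<le> i \<Longrightarrow> i \<le> Suc k \<Longrightarrow> rarr s ''out'' i = left_cost Q (pos Q i)"
    using I unfolding scan_inv_def Let_def by auto
  have L: "linked (narr s ''prev'') (narr s ''next'') S k" using R by (simp add: rest_inv_def)
  have nk: "i \<noteq> Suc k" if "i \<in> S" for i using linked_bounds[OF L that] by simp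
  have iw: "rarr s ''iw'' (Suc k) = w" and ic: "rarr s ''ic'' (Suc k) = c"
    and id: "rarr s ''id'' (Suc k) = edge_len Q (Suc k)" and taus: "rvar s ''tau'' = tau Q"
    using inp k by (auto simp: inputs_def w_def c_def)
  have Wk: "?W (Suc k) = ?W k + w" by (simp add: total_weight_Suc w_def)
  have yless: "- offset Q (Suc k) < ?y k" if "k \<noteq> 0"
    using yk[OF that] edge that tau Q k
    by (simp add: offset_def pos_Suc distrib_left path_network_def)
  define q where "q = w * w"
  define E where "E = rvar s ''E'' - offset Q (Suc k) * w + q / (2 * c)"
  have push: "step_inv (insert (Suc k) S) (m(Suc k := c)) (Suc k) ?n c ((narr s ''prev'')(Suc k := k))
      ((narr s ''next'')(k := Suc k)) (?b(Suc k := ?W (Suc k))) (?y(Suc k := - offset Q (Suc k)))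
      (narr s ''gf'') (rarr s ''gm'') (rarr s ''g2'') (\<lambda>i. rarr s ''tree'' (Suc ?n + i)) (Suc k) (nvar s ''h'') q E"
    by (rule rest_inv_push[OF R _ c _ yless])
       (use k w bk in \<open>auto simp: Wk q_def E_def power2_eq_square\<close>)
  \<comment> \<open>The rays of the first \<open>Suc k\<close> vertices are the previous ones with
    rates capped at \<open>c\<close>, together with the ray of the new vertex. Both sides of the
    equivalence undergo the same two changes.\<close>
  have "equiv_rays S ?b ?y (\<lambda>i. min (m i) c) {1..k} ?W (\<lambda>j. - offset Q j) (\<lambda>j. min (rate (capacity Q) j k) c)"
    by (rule equiv_rays_cap[OF eq c]) (use rest_inv_pos[OF R] rate_capacity_pos[OF Q] k in auto)
  hence "equiv_rays S (?b(Suc k := ?W (Suc k))) (?y(Suc k := - offset Q (Suc k)))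
      (\<lambda>i. min ((m(Suc k := c)) i) c) {1..k} ?W (\<lambda>j. - offset Q j) (\<lambda>j. min (rate (capacity Q) j k) c)"
    by (rule equiv_rays_trans[OF equiv_rays_cong, rotated]) (use nk in auto)
  hence "equiv_rays S (?b(Suc k := ?W (Suc k))) (?y(Suc k := - offset Q (Suc k)))
      (\<lambda>i. min ((m(Suc k := c)) i) c) {1..k} ?W (\<lambda>j. - offset Q j) (\<lambda>j. rate (capacity Q) j (Suc k))"
    by (rule equiv_rays_trans) (rule equiv_rays_cong, auto simp: c_def)
  hence "equiv_rays (insert (Suc k) S) (?b(Suc k := ?W (Suc k))) (?y(Suc k := - offset Q (Suc k)))
      (\<lambda>i. min ((m(Suc k := c)) i) c) (insert (Suc k) {1..k}) ?W (\<lambda>j. - offset Q j) (\<lambda>j. rate (capacity Q) j (Suc k))"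
    by (rule equiv_rays_insert) (auto simp: c_def)
  moreover have "insert (Suc k) {1..k} = {1..Suc k}" by auto
  ultimately have eq': "equiv_rays (insert (Suc k) S) (?b(Suc k := ?W (Suc k))) (?y(Suc k := - offset Q (Suc k)))
      (\<lambda>i. min ((m(Suc k := c)) i) c) {1..Suc k} ?W (\<lambda>j. - offset Q j) (\<lambda>j. rate (capacity Q) j (Suc k))"
    by simp
  define s1 where "s1 = s\<lparr>nvar := (nvar s)(''f'' := Suc k),
      rvar := (rvar s)(''W'' := ?W (Suc k), ''cc'' := c, ''q'' := q, ''E'' := E),
      narr := (narr s)(''prev'' := (narr s ''prev'')(Suc k := k), ''next'' := (narr s ''next'')(k := Suc k)),
      rarr := (rarr s)(''b'' := ?b(Suc k := ?W (Suc k)), ''y'' := ?y(Suc k := - offset Q (Suc k)))\<rparr>"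
  have st: "step_state (insert (Suc k) S) (m(Suc k := c)) s1"
    unfolding step_state_def using push eq' N par tr by (simp add: s1_def del: rate.simps)
  have cS: "card (insert (Suc k) S) = Suc (card S)"
    using nk linked_finite[OF L] by (subst card_insert_disjoint) auto
  \<comment> \<open>The effect of the commands after \<open>loops\<close>, isolated so that the
    invariant for \<open>Suc k\<close> can be shown apart from the symbolic execution.\<close>
  define fin where "fin = (\<lambda>r :: state. r\<lparr>
        nvar := (nvar r)(''h'' := Suc (nvar r ''h''), ''k'' := Suc (Suc k)),
        rvar := (rvar r)(''X'' := rvar r ''X'' + rvar r ''tau'' * rarr r ''id'' (Suc k)),
        narr := (narr r)(''gf'' := (narr r ''gf'')(Suc (nvar r ''h'') := nvar r ''f'')),
        rarr := (rarr r)(''gm'' := (rarr r ''gm'')(Suc (nvar r ''h'') := rvar r ''cc''),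
          ''g2'' := (rarr r ''g2'')(Suc (nvar r ''h'') := rvar r ''q''),
          ''out'' := (rarr r ''out'')(Suc (Suc k) :=
             (rvar r ''X'' + rvar r ''tau'' * rarr r ''id'' (Suc k)) * rvar r ''W'' + rvar r ''E''))\<rparr>)"
  have final: "\<exists>S' m'. scan_inv Q S' m' (Suc k) (fin r) \<and>
      \<tau> + 200 + ?A * (card S' + Suc (nvar r ''h'')) \<le> ?A * (card S + nvar s ''h'' + 3) + 300"
    if st': "step_state S' m' r" and low: "low_levels r"
      and sep: "\<And>j. j \<in> S' \<Longrightarrow> separated (narr r ''prev'') (rarr r ''b'') (rarr r ''y'') m' j"
      and un: "unaffected s1 r"
      and time: "\<tau> + ?A * (card S' + nvar r ''h'') \<le> ?A * (card (insert (Suc k) S) + nvar s1 ''h'' + 1) + 70"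
    for S' m' r \<tau>
  proof -
    have ag: "nvar r ''n'' = nvar s ''n''" "nvar r ''N'' = nvar s ''N''"
      "rvar r ''tau'' = rvar s ''tau''" "rvar r ''W'' = ?W (Suc k)" "rvar r ''X'' = rvar s ''X''"
      "rvar r ''cc'' = c" "rarr r ''iw'' = rarr s ''iw''" "rarr r ''id'' = rarr s ''id''"
      "rarr r ''ic'' = rarr s ''ic''" "rarr r ''out'' = rarr s ''out''" "narr r ''par'' = narr s ''par''"
      using un by (simp_all add: unaffected_def agree_def s1_def)
    have gl: "\<And>l. 1 \<le> l \<Longrightarrow> l \<le> nvar r ''h'' \<Longrightarrow> rarr r ''gm'' l < c" using low by (simp add: low_levels_def)
    note rest = step_inv_rest[OF step_state_inv[OF st'] gl sep]
    have m'c: "m' i \<le> c" if iS: "i \<in> S'" for i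
    proof -
      have V: "levels (narr r ''prev'') (rarr r ''b'') m' S' (nvar r ''f'') (nvar r ''h'')
          (narr r ''gf'') (rarr r ''gm'') (rarr r ''g2'')"
        and top: "\<And>i. i \<in> S' \<Longrightarrow> nvar r ''f'' \<le> i \<Longrightarrow> m' i = c"
        using step_state_inv[OF st'] unfolding step_inv_def by auto
      show ?thesis
      proof (cases "nvar r ''f'' \<le> i")
        case False
        then obtain l where "1 \<le> l" "l \<le> nvar r ''h''" "m' i = rarr r ''gm'' l"
          using levels_ex[OF V iS] by auto
        thus ?thesis using gl by (simp add: less_imp_le)
      qed (use top iS in simp)
    qed
    have eq1: "equiv_rays S' (rarr r ''b'') (rarr r ''y'') m' {1..Suc k} ?W (\<lambda>j. - offset Q j)
        (\<lambda>j. rate (capacity Q) j (Suc k))"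
    proof (rule equiv_rays_trans[OF equiv_rays_cong])
      show "equiv_rays S' (rarr r ''b'') (rarr r ''y'') (\<lambda>i. min (m' i) c) {1..Suc k} ?W (\<lambda>j. - offset Q j)
        (\<lambda>j. rate (capacity Q) j (Suc k))" using st' unfolding step_state_def by blast
    qed (use m'c in simp)
    have by': "rarr r ''b'' (Suc k) = ?W (Suc k)" "rarr r ''y'' (Suc k) = - offset Q (Suc k)"
      and tr': "tree (rarr r ''tree'') (Suc ?n)" using st' unfolding step_state_def by blast+
    have area: "residual_area Q (Suc k) = rvar r ''E''"
      by (rule rest_inv_area[OF Q _ k rest eq1 by'(1)]) auto
    have X': "rvar r ''X'' + rvar r ''tau'' * rarr r ''id'' (Suc k) = offset Q (Suc (Suc k))"
      using offset_Suc[of "Suc k" Q] ag X id taus by simp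
    have cost: "left_cost Q (pos Q (Suc (Suc k))) = offset Q (Suc (Suc k)) * ?W (Suc k) + rvar r ''E''"
      using left_cost_eq[OF Q, of "Suc k" "pos Q (Suc (Suc k))"] pos_strict[OF Q, of "Suc k" "Suc (Suc k)"] k area
      by (simp add: offset_def)
    have "scan_inv Q S' m' (Suc k) (fin r)"
      unfolding scan_inv_def Let_def
    proof (intro conjI)
      show "inputs Q (fin r)" using inp ag by (simp add: inputs_def fin_def)
      show "\<forall>i. 1 \<le> i \<and> i \<le> Suc (Suc k) \<longrightarrow> rarr (fin r) ''out'' i = left_cost Q (pos Q i)"
        using out X' ag cost by (auto simp: le_Suc_eq fin_def)
    qed (use N ag k par tr' rest eq1 by' X' in \<open>simp_all add: fin_def del: rate.simps\<close>)
    moreover have "\<tau> + 200 + ?A * (card S' + Suc (nvar r ''h'')) \<le> ?A * (card S + nvar s ''h'' + 3) + 300"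
      using time unfolding cS by (simp add: s1_def algebra_simps)
    ultimately show ?thesis by blast
  qed
  show ?thesis
    unfolding scan_step_def
    apply (simp add: wp_exec kk iw ic W X Wk[symmetric] del: One_nat_def plus_1_eq_Suc)
    apply (simp only: q_def[symmetric] E_def[symmetric])
    apply (fold s1_def)
    apply (rule wp_mono[OF wp_loops[OF st]], elim exE conjE)
    subgoal premises prems for \<tau> r S' m'
    proof -
      have kr: "nvar r ''k'' = Suc k" using prems(4) kk by (simp add: unaffected_def agree_def s1_def)
      from final[OF prems(1,2) _ prems(4,5)] prems(3) obtain S2 m2 where
        F: "scan_inv Q S2 m2 (Suc k) (fin r)"
        "\<tau> + 200 + ?A * (card S2 + Suc (nvar r ''h'')) \<le> ?A * (card S + nvar s ''h'' + 3) + 300"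
        by blast
      show ?thesis
        apply (simp add: wp_exec kr)
        apply (rule exI[of _ S2], rule conjI, rule exI[of _ m2])
        subgoal using F(1) by (simp add: fin_def)
        subgoal using F(2) by simp
        done
    qed
    done
qed

text \<open>Parents are tabulated from above because the machine cannot halve. The round
  \<open>x = 0\<close> writes the nodes 0 and 1 and gives the root the parent 0, which stops the
  climb in \<open>set_leaf\<close>. Resetting the tree matters for the second scan.\<close>

definition clear_node :: com where
  "clear_node =
    seqs [
    NAssign ''a'' (NAdd (NVar ''x'') (NVar ''x'')),
    NWrite ''par'' (NVar ''a'') (NVar ''x''),
    RWrite ''tree'' (NVar ''a'') (rconst 0),
    NAssign ''a'' (NAdd (NVar ''a'') (NConst 1)),
    NWrite ''par'' (NVar ''a'') (NVar ''x''),
    RWrite ''tree'' (NVar ''a'') (rconst 0),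
    NAssign ''x'' (NAdd (NVar ''x'') (NConst 1))]"

definition scan_init :: com where
  "scan_init = seqs [
    NAssign ''N'' (NAdd (NVar ''n'') (NConst 1)),
    NAssign ''x'' (NConst 0),
    While (NLess (NVar ''x'') (NVar ''N''))
     clear_node,
    NAssign ''k'' (NConst 1),
    NAssign ''h'' (NConst 0),
    RAssign ''W'' (rconst 0),
    RAssign ''X'' (rconst 0),
    RAssign ''E'' (rconst 0),
    RWrite ''b'' (NConst 0) (rconst 0),
    RWrite ''out'' (NConst 1) (rconst 0)]"

definition scan :: com where
  "scan = Seq scan_init (While (NLess (NVar ''k'') (NVar ''n'')) scan_step)"

text \<open>Without pieces the invariant says nothing about the links and the contents of the stack,
  so the remains of an earlier scan in these arrays do no harm.\<close>

lemma scan_inv_init: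
  assumes Q: "path_network Q" and inp: "inputs Q s"
    and N: "nvar s ''N'' = Suc (num_vertices Q)" and k: "nvar s ''k'' = 1" and h: "nvar s ''h'' = 0"
    and r: "rvar s ''W'' = 0" "rvar s ''X'' = 0" "rvar s ''E'' = 0"
    and par: "\<And>z. z < 2 * Suc (num_vertices Q) \<Longrightarrow> narr s ''par'' z = z div 2 \<and> rarr s ''tree'' z = 0"
    and b: "rarr s ''b'' 0 = 0" and out: "rarr s ''out'' 1 = 0"
  shows "scan_inv Q {} (\<lambda>_. 0) 0 s"
proof -
  have n: "1 \<le> num_vertices Q" using Q by (simp add: path_network_def)
  have "tree (rarr s ''tree'') (Suc (num_vertices Q))" using par by (simp add: tree_def)
  moreover have "rest_inv {} (\<lambda>_. 0) 0 (num_vertices Q) (narr s ''prev'') (narr s ''next'') (rarr s ''b'') (rarr s ''y'')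
       (narr s ''gf'') (rarr s ''gm'') (rarr s ''g2'') (\<lambda>i. rarr s ''tree'' (Suc (num_vertices Q) + i)) 0 0"
    using par b by (simp add: rest_inv_def linked_def heights_def levels_def thresholds_def area_def)
  ultimately show ?thesis
    using assms n left_cost_0[OF Q]
    by (auto simp: scan_inv_def Let_def equiv_rays_def dominated_def offset_def le_Suc_eq)
qed

lemma wp_scan_init:
  assumes Q: "path_network Q" and inp: "inputs Q s"
  shows "wp scan_init (\<lambda>\<tau> s'. scan_inv Q {} (\<lambda>_. 0) 0 s' \<and> nvar s' ''h'' = 0 \<and> \<tau> \<le> 50 * num_vertices Q + 150) s"
proof -
  let ?n = "num_vertices Q"
  define Inv where "Inv = (\<lambda>v (r :: state). nvar r ''N'' = Suc ?n \<and> nvar r ''x'' \<le> Suc ?n \<and>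
    v = 50 * (Suc ?n - nvar r ''x'') \<and>
    (\<forall>z<2 * nvar r ''x''. narr r ''par'' z = z div 2 \<and> rarr r ''tree'' z = 0))"
  let ?s0 = "s\<lparr>nvar := (nvar s)(''N'' := ?n + 1, ''x'' := 0)\<rparr>"
  have loop: "wp (While (NLess (NVar ''x'') (NVar ''N'')) clear_node)
      (\<lambda>\<tau> r. \<exists>v'. Inv v' r \<and> \<not> bval r (NLess (NVar ''x'') (NVar ''N'')) \<and>
        \<tau> + v' \<le> 50 * Suc ?n + 1 + bcost (NLess (NVar ''x'') (NVar ''N''))) ?s0"
  proof (rule wp_While)
    show "Inv (50 * Suc ?n) ?s0" by (simp add: Inv_def)
    fix v r assume I: "Inv v r" and gd: "bval r (NLess (NVar ''x'') (NVar ''N''))"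
    define x where "x = nvar r ''x''"
    have x: "x < Suc ?n" and v: "v = 50 * (Suc ?n - Suc x) + 50"
      and IH: "\<And>z. z < 2 * x \<Longrightarrow> narr r ''par'' z = z div 2 \<and> rarr r ''tree'' z = 0"
      and N: "nvar r ''N'' = Suc ?n"
      using I gd by (auto simp: Inv_def x_def)
    have z: "z = x + x \<or> z = Suc (x + x) \<or> z < 2 * x" if "z < 2 * Suc x" for z using that by auto
    show "wp clear_node (\<lambda>\<tau> r'. \<exists>v'. Inv v' r' \<and> 1 + bcost (NLess (NVar ''x'') (NVar ''N'')) + \<tau> + v' \<le> v) r"
      unfolding clear_node_def
      apply (simp add: wp_exec x_def[symmetric])
      apply (rule exI[of _ "50 * (Suc ?n - Suc x)"])
      apply (rule conjI)
      subgoal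
        unfolding Inv_def
      proof (intro conjI allI impI, goal_cases)
        case (4 z)
        hence "z < 2 * Suc x" by simp
        from z[OF this] IH[of z] show ?case by auto
      next
        case (5 z)
        hence "z < 2 * Suc x" by simp
        from z[OF this] IH[of z] show ?case by auto
      qed (use x N in simp_all)
      subgoal unfolding v by simp
      done
  qed
  have n: "nvar s ''n'' = ?n" using inp by (simp add: inputs_def)
  show ?thesis
    unfolding scan_init_def
    apply (simp add: wp_exec n del: foldr.simps One_nat_def plus_1_eq_Suc)
    apply (rule wp_mono[OF wp_agree[OF loop]], elim exE conjE)
    subgoal premises prems for \<tau> r v'
    proof -
      have I: "nvar r ''N'' = Suc ?n" "nvar r ''x'' = Suc ?n"
        "\<And>z. z < 2 * Suc ?n \<Longrightarrow> narr r ''par'' z = z div 2 \<and> rarr r ''tree'' z = 0"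
      proof -
        have c: "nvar r ''N'' = Suc ?n \<and> nvar r ''x'' \<le> Suc ?n" using prems(2) unfolding Inv_def by blast
        show N: "nvar r ''N'' = Suc ?n" and x: "nvar r ''x'' = Suc ?n" using c prems(3) by simp_all
        show "narr r ''par'' z = z div 2 \<and> rarr r ''tree'' z = 0" if "z < 2 * Suc ?n" for z
          using prems(2) that unfolding Inv_def x by blast
      qed
      have "agree ''n'' ?s0 r" "agree ''tau'' ?s0 r" "agree ''iw'' ?s0 r" "agree ''id'' ?s0 r" "agree ''ic'' ?s0 r"
        by (rule prems(1)[rule_format], simp add: clear_node_def)+
      hence "inputs Q r" using inp by (simp add: inputs_def agree_def)
      thus ?thesis
        apply (simp add: wp_exec)
        apply (rule conjI)
        subgoal by (rule scan_inv_init[OF Q]) (use I in \<open>simp_all add: inputs_def\<close>)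
        subgoal using prems(4) by simp
        done
    qed
    done
qed

text \<open>An amortized bound: every vertex contributes \<open>3 * A + 310\<close>, and the
  potential \<open>A * (card S + h)\<close> is 0 at the start. The initialization accounts for the
  rest of the linear term.\<close>

lemma wp_scan:
  assumes Q: "path_network Q" and g: "2 * Suc (num_vertices Q) \<le> 2 ^ g" and inp: "inputs Q s"
  shows "wp scan (\<lambda>\<tau> s'. (\<forall>i. 1 \<le> i \<and> i \<le> num_vertices Q \<longrightarrow> rarr s' ''out'' i = left_cost Q (pos Q i)) \<and>
    \<tau> \<le> num_vertices Q * (360 * g + 1600) + 160) s"
  unfolding scan_def wp_Seq
proof (rule wp_mono[OF wp_scan_init[OF Q inp]], elim conjE)
  let ?n = "num_vertices Q"
  define A where "A = 120 * g + 400"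
  define Inv where "Inv = (\<lambda>v r. \<exists>S m k. scan_inv Q S m k r \<and>
    v = (?n - Suc k) * (3 * A + 310) + A * (card S + nvar r ''h''))"
  fix \<tau>0 s0
  assume 0: "scan_inv Q {} (\<lambda>_. 0) 0 s0" "nvar s0 ''h'' = 0" "\<tau>0 \<le> 50 * ?n + 150"
  have n: "1 \<le> ?n" using Q by (simp add: path_network_def)
  have "wp (While (NLess (NVar ''k'') (NVar ''n'')) scan_step)
    (\<lambda>\<tau> r. \<exists>v'. Inv v' r \<and> \<not> bval r (NLess (NVar ''k'') (NVar ''n'')) \<and>
      \<tau> + v' \<le> (?n - 1) * (3 * A + 310) + 1 + bcost (NLess (NVar ''k'') (NVar ''n''))) s0"
  proof (rule wp_While)
    show "Inv ((?n - 1) * (3 * A + 310)) s0"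
      unfolding Inv_def using 0 by (intro exI[of _ "{}"] exI[of _ "\<lambda>_. 0"] exI[of _ 0]) simp
    fix v r assume I: "Inv v r" and gd: "bval r (NLess (NVar ''k'') (NVar ''n''))"
    from I obtain S m k where si: "scan_inv Q S m k r"
      and v: "v = (?n - Suc k) * (3 * A + 310) + A * (card S + nvar r ''h'')"
      unfolding Inv_def by blast
    have k: "Suc k < ?n" using gd si by (simp add: scan_inv_def Let_def inputs_def)
    hence "?n - Suc k = Suc (?n - Suc (Suc k))" by simp
    hence vv: "v = (?n - Suc (Suc k)) * (3 * A + 310) + 310 + A * (card S + nvar r ''h'' + 3)"
      unfolding v by (simp add: algebra_simps)
    show "wp scan_step (\<lambda>\<tau> r'. \<exists>v'. Inv v' r' \<and> 1 + bcost (NLess (NVar ''k'') (NVar ''n'')) + \<tau> + v' \<le> v) r"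
    proof (rule wp_mono[OF wp_scan_step[OF Q g si k]], elim exE conjE)
      fix \<tau> r' S' m'
      assume si': "scan_inv Q S' m' (Suc k) r'"
        and t: "\<tau> + (120 * g + 400) * (card S' + nvar r' ''h'') \<le> (120 * g + 400) * (card S + nvar r ''h'' + 3) + 300"
      have "Inv ((?n - Suc (Suc k)) * (3 * A + 310) + A * (card S' + nvar r' ''h'')) r'"
        unfolding Inv_def using si' by blast
      thus "\<exists>v'. Inv v' r' \<and> 1 + bcost (NLess (NVar ''k'') (NVar ''n'')) + \<tau> + v' \<le> v"
        using t unfolding A_def[symmetric] vv by (intro exI conjI) auto
    qed
  qed
  thus "wp (While (NLess (NVar ''k'') (NVar ''n'')) scan_step) (\<lambda>t' s''.
      (\<forall>i. 1 \<le> i \<and> i \<le> ?n \<longrightarrow> rarr s'' ''out'' i = left_cost Q (pos Q i)) \<and>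
      \<tau>0 + t' \<le> ?n * (360 * g + 1600) + 160) s0"
  proof (rule wp_mono, elim exE conjE)
    fix \<tau> r v'
    assume I: "Inv v' r" and gd: "\<not> bval r (NLess (NVar ''k'') (NVar ''n''))"
      and t: "\<tau> + v' \<le> (?n - 1) * (3 * A + 310) + 1 + bcost (NLess (NVar ''k'') (NVar ''n''))"
    from I obtain S m k where si: "scan_inv Q S m k r" unfolding Inv_def by blast
    have k: "Suc k = ?n" using gd si by (simp add: scan_inv_def Let_def inputs_def)
    have out: "rarr r ''out'' i = left_cost Q (pos Q i)" if "1 \<le> i" "i \<le> ?n" for i
      using si that k by (simp add: scan_inv_def Let_def)
    obtain n' where n': "?n = Suc n'" using n by (cases ?n) auto
    have "\<tau>0 + \<tau> \<le> ?n * (360 * g + 1600) + 160"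
      using t 0(3) unfolding n' A_def by (simp add: algebra_simps)
    thus "(\<forall>i. 1 \<le> i \<and> i \<le> ?n \<longrightarrow> rarr r ''out'' i = left_cost Q (pos Q i)) \<and>
      \<tau>0 + \<tau> \<le> ?n * (360 * g + 1600) + 160"
      using out by blast
  qed
qed

section \<open>The program\<close>

text \<open>Saving \<open>out\<close> in \<open>L\<close> serves the second call, which rescues the
  costs of the forward scan before the scan of the reversal overwrites them.\<close>

definition copy_step :: "nexp \<Rightarrow> nexp \<Rightarrow> com" where
  "copy_step a b =
    seqs [
    RWrite ''iw'' (NVar ''i'') (RRead ''w'' a),
    RWrite ''id'' (NVar ''i'') (RRead ''d'' b),
    RWrite ''ic'' (NVar ''i'') (RRead ''c'' b),
    RWrite ''L'' (NVar ''i'') (elem_at ''out'' ''i''),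
    NAssign ''i'' (NAdd (NVar ''i'') (NConst 1))]"

definition copy :: "nexp \<Rightarrow> nexp \<Rightarrow> com" where
  "copy a b = seqs [
    NAssign ''i'' (NConst 1),
    While (Not (NLess (NVar ''n'') (NVar ''i'')))
     (copy_step a b)]"

lemma wp_copy:
  assumes n: "nvar s ''n'' = n"
    and a: "\<And>r j. nvar r ''n'' = n \<Longrightarrow> nvar r ''i'' = j \<Longrightarrow> nval r a = \<alpha> j" "ncost a \<le> 5"
    and b: "\<And>r j. nvar r ''n'' = n \<Longrightarrow> nvar r ''i'' = j \<Longrightarrow> nval r b = \<beta> j" "ncost b \<le> 5"
  shows "wp (copy a b) (\<lambda>\<tau> s'. (\<forall>j. 1 \<le> j \<and> j \<le> n \<longrightarrow>
      rarr s' ''iw'' j = rarr s ''w'' (\<alpha> j) \<and> rarr s' ''id'' j = rarr s ''d'' (\<beta> j) \<and>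
      rarr s' ''ic'' j = rarr s ''c'' (\<beta> j) \<and> rarr s' ''L'' j = rarr s ''out'' j) \<and> \<tau> \<le> 60 * n + 20) s"
proof -
  define Inv where "Inv = (\<lambda>v (r :: state). nvar r ''n'' = n \<and> 1 \<le> nvar r ''i'' \<and> nvar r ''i'' \<le> Suc n \<and>
    v = 60 * (Suc n - nvar r ''i'') \<and>
    rarr r ''w'' = rarr s ''w'' \<and> rarr r ''d'' = rarr s ''d'' \<and> rarr r ''c'' = rarr s ''c'' \<and> rarr r ''out'' = rarr s ''out'' \<and>
    (\<forall>j. 1 \<le> j \<and> j < nvar r ''i'' \<longrightarrow>
      rarr r ''iw'' j = rarr s ''w'' (\<alpha> j) \<and> rarr r ''id'' j = rarr s ''d'' (\<beta> j) \<and>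
      rarr r ''ic'' j = rarr s ''c'' (\<beta> j) \<and> rarr r ''L'' j = rarr s ''out'' j))"
  let ?g = "Not (NLess (NVar ''n'') (NVar ''i''))"
  have "wp (While ?g (copy_step a b)) (\<lambda>\<tau> r. \<exists>v'. Inv v' r \<and> \<not> bval r ?g \<and> \<tau> + v' \<le> 60 * n + 1 + bcost ?g)
      (s\<lparr>nvar := (nvar s)(''i'' := 1)\<rparr>)"
  proof (rule wp_While)
    show "Inv (60 * n) (s\<lparr>nvar := (nvar s)(''i'' := 1)\<rparr>)" using n by (auto simp: Inv_def)
    fix v r assume I: "Inv v r" and gd: "bval r ?g"
    define i where "i = nvar r ''i''"
    have i: "1 \<le> i" "i \<le> n" and v: "v = 60 * (Suc n - Suc i) + 60" and rn: "nvar r ''n'' = n"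
      and src: "rarr r ''w'' = rarr s ''w''" "rarr r ''d'' = rarr s ''d''" "rarr r ''c'' = rarr s ''c''" "rarr r ''out'' = rarr s ''out''"
      and IH: "\<And>j. 1 \<le> j \<Longrightarrow> j < i \<Longrightarrow> rarr r ''iw'' j = rarr s ''w'' (\<alpha> j) \<and> rarr r ''id'' j = rarr s ''d'' (\<beta> j) \<and>
      rarr r ''ic'' j = rarr s ''c'' (\<beta> j) \<and> rarr r ''L'' j = rarr s ''out'' j"
      using I gd by (auto simp: Inv_def i_def)
    show "wp (copy_step a b) (\<lambda>\<tau> r'. \<exists>v'. Inv v' r' \<and> 1 + bcost ?g + \<tau> + v' \<le> v) r"
      unfolding copy_step_def
      apply (simp add: wp_exec a(1)[OF _ refl] b(1)[OF _ refl] rn i_def[symmetric])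
      apply (rule exI[of _ "60 * (Suc n - Suc i)"])
      apply (rule conjI)
      subgoal unfolding Inv_def using i rn src IH by (auto simp: less_Suc_eq)
      subgoal unfolding v using a(2) b(2) by simp
      done
  qed
  hence "wp (While ?g (copy_step a b)) (\<lambda>\<tau> s'. (\<forall>j. 1 \<le> j \<and> j \<le> n \<longrightarrow>
      rarr s' ''iw'' j = rarr s ''w'' (\<alpha> j) \<and> rarr s' ''id'' j = rarr s ''d'' (\<beta> j) \<and>
      rarr s' ''ic'' j = rarr s ''c'' (\<beta> j) \<and> rarr s' ''L'' j = rarr s ''out'' j) \<and> \<tau> \<le> 60 * n + 6)
      (s\<lparr>nvar := (nvar s)(''i'' := 1)\<rparr>)"
    by (rule wp_mono) (auto simp: Inv_def)
  thus ?thesis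
    unfolding copy_def
    apply (simp add: wp_exec del: One_nat_def plus_1_eq_Suc foldr.simps)
    apply (erule wp_mono)
    apply (simp add: wp_exec)
    done
qed

definition select_step :: com where
  "select_step =
    seqs [
    RAssign ''v'' (RAdd (elem_at ''L'' ''i'') (RRead ''out'' (NSub (NAdd (NVar ''n'') (NConst 1)) (NVar ''i'')))),
    If (RLess (RVar ''v'') (RVar ''e''))
      (seqs [RAssign ''e'' (RVar ''v''), RAssign ''mu'' (RVar ''X'')])
      Skip,
    RAssign ''X'' (RAdd (RVar ''X'') (elem_at ''d'' ''i'')),
    NAssign ''i'' (NAdd (NVar ''i'') (NConst 1))]"

definition select :: com where
  "select = seqs [
    NAssign ''i'' (NConst 1),
    RAssign ''X'' (rconst 0),
    RAssign ''mu'' (rconst 0),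
    RAssign ''e'' (RAdd (RRead ''L'' (NConst 1)) (elem_at ''out'' ''n'')),
    While (Not (NLess (NVar ''n'') (NVar ''i'')))
     select_step]"

lemma wp_select:
  assumes P: "path_network P" and n: "nvar s ''n'' = num_vertices P"
    and d: "\<And>i. 1 \<le> i \<Longrightarrow> i < num_vertices P \<Longrightarrow> rarr s ''d'' i = edge_len P i"
    and cost: "\<And>i. 1 \<le> i \<Longrightarrow> i \<le> num_vertices P \<Longrightarrow>
      rarr s ''L'' i + rarr s ''out'' (Suc (num_vertices P) - i) = vertex_cost P i"
  shows "wp select (\<lambda>\<tau> s'. minsum_sink P (rvar s' ''mu'') \<and> \<tau> \<le> 60 * num_vertices P + 60) s"
proof -
  let ?n = "num_vertices P"
  define Inv where "Inv = (\<lambda>v (r :: state). nvar r ''n'' = ?n \<and> 1 \<le> nvar r ''i'' \<and> nvar r ''i'' \<le> Suc ?n \<and>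
    v = 60 * (Suc ?n - nvar r ''i'') \<and>
    rarr r ''d'' = rarr s ''d'' \<and> rarr r ''L'' = rarr s ''L'' \<and> rarr r ''out'' = rarr s ''out'' \<and>
    (nvar r ''i'' \<le> ?n \<longrightarrow> rvar r ''X'' = pos P (nvar r ''i'')) \<and>
    (\<exists>j. 1 \<le> j \<and> j \<le> ?n \<and> rvar r ''mu'' = pos P j \<and> rvar r ''e'' = vertex_cost P j) \<and>
    (\<forall>j. 1 \<le> j \<and> j < nvar r ''i'' \<longrightarrow> rvar r ''e'' \<le> vertex_cost P j))"
  let ?g = "Not (NLess (NVar ''n'') (NVar ''i''))"
  let ?s0 = "s\<lparr>nvar := (nvar s)(''i'' := 1),
      rvar := (rvar s)(''X'' := 0, ''mu'' := 0, ''e'' := vertex_cost P 1)\<rparr>"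
  have n1: "1 \<le> ?n" using P by (simp add: path_network_def)
  have "wp (While ?g select_step) (\<lambda>\<tau> r. \<exists>v'. Inv v' r \<and> \<not> bval r ?g \<and> \<tau> + v' \<le> 60 * ?n + 1 + bcost ?g) ?s0"
  proof (rule wp_While)
    show "Inv (60 * ?n) ?s0" using n n1 by (auto simp: Inv_def intro!: exI[of _ 1])
    fix v r assume I: "Inv v r" and gd: "bval r ?g"
    define i where "i = nvar r ''i''"
    have rn: "nvar r ''n'' = ?n" using I by (simp add: Inv_def)
    hence i: "1 \<le> i" "i \<le> ?n" using I gd by (auto simp: Inv_def i_def)
    have v: "v = 60 * (Suc ?n - Suc i) + 60" using I i by (simp add: Inv_def i_def)
    have X: "rvar r ''X'' = pos P i" and best: "\<And>j. 1 \<le> j \<Longrightarrow> j < i \<Longrightarrow> rvar r ''e'' \<le> vertex_cost P j"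
      and src: "rarr r ''d'' = rarr s ''d''" "rarr r ''L'' = rarr s ''L''" "rarr r ''out'' = rarr s ''out''"
      using I i by (auto simp: Inv_def i_def)
    obtain j where j: "1 \<le> j" "j \<le> ?n" "rvar r ''mu'' = pos P j" "rvar r ''e'' = vertex_cost P j"
      using I unfolding Inv_def by blast
    have ci: "rarr s ''L'' i + rarr s ''out'' (Suc ?n - i) = vertex_cost P i" by (rule cost[OF i])
    have X': "Suc i \<le> ?n \<Longrightarrow> pos P i + rarr s ''d'' i = pos P (Suc i)" using d[of i] i pos_Suc[of i P] by simp
    have best': "vertex_cost P i \<le> vertex_cost P l" if "vertex_cost P i < vertex_cost P j" "1 \<le> l" "l < Suc i" for l
      using best[of l] that j(4) by (cases "l = i") auto
    have best'': "vertex_cost P j \<le> vertex_cost P l" if "\<not> vertex_cost P i < vertex_cost P j" "1 \<le> l" "l < Suc i" for l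
      using best[of l] that j(4) by (cases "l = i") auto
    show "wp select_step (\<lambda>\<tau> r'. \<exists>v'. Inv v' r' \<and> 1 + bcost ?g + \<tau> + v' \<le> v) r"
    proof (cases "vertex_cost P i < vertex_cost P j")
      case True
      show ?thesis
        unfolding select_step_def
        apply (simp add: wp_exec rn i_def[symmetric] src ci j(4) X True)
        apply (rule exI[of _ "60 * (Suc ?n - Suc i)"])
        apply (rule conjI)
        subgoal unfolding Inv_def using i rn src X' best'[OF True] by auto
        subgoal unfolding v by simp
        done
    next
      case False
      show ?thesis
        unfolding select_step_def
        apply (simp add: wp_exec rn i_def[symmetric] src ci j(4) X False)
        apply (rule exI[of _ "60 * (Suc ?n - Suc i)"])
        apply (rule conjI)
        subgoal unfolding Inv_def using i rn src X' j best''[OF False] by auto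
        subgoal unfolding v by simp
        done
    qed
  qed
  hence "wp (While ?g select_step) (\<lambda>\<tau> s'. minsum_sink P (rvar s' ''mu'') \<and> \<tau> \<le> 60 * ?n + 10) ?s0"
  proof (rule wp_mono, elim exE conjE)
    fix \<tau> r v'
    assume I: "Inv v' r" and gd: "\<not> bval r ?g" and t: "\<tau> + v' \<le> 60 * ?n + 1 + bcost ?g"
    have best: "\<And>j. 1 \<le> j \<Longrightarrow> j \<le> ?n \<Longrightarrow> rvar r ''e'' \<le> vertex_cost P j"
      using I gd by (auto simp: Inv_def)
    obtain j where j: "1 \<le> j" "j \<le> ?n" "rvar r ''mu'' = pos P j" "rvar r ''e'' = vertex_cost P j"
      using I unfolding Inv_def by blast
    have "minsum_sink P (pos P j)"
      by (rule minsum_sink_vertexI[OF P j(1,2)]) (use best j(4) in simp)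
    thus "minsum_sink P (rvar r ''mu'') \<and> \<tau> \<le> 60 * ?n + 10" using j(3) t by simp
  qed
  moreover have "rarr s ''L'' 1 + rarr s ''out'' ?n = vertex_cost P 1" using cost[of 1] n1 by simp
  ultimately show ?thesis
    unfolding select_def
    apply (simp add: wp_exec n del: One_nat_def plus_1_eq_Suc foldr.simps)
    apply (erule wp_mono)
    apply (simp add: wp_exec)
    done
qed

definition sink_program :: com where
  "sink_program = Seq (copy (NVar ''i'') (NVar ''i''))
    (Seq scan
    (Seq (copy (NSub (NAdd (NVar ''n'') (NConst 1)) (NVar ''i'')) (NSub (NVar ''n'') (NVar ''i'')))
    (Seq scan select)))"

lemma writes_scan: "writes scan \<inter> {''n'', ''tau'', ''w'', ''d'', ''c'', ''L''} = {}"
proof -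
  have "writes loops \<inter> {''n'', ''tau'', ''w'', ''d'', ''c'', ''L''} = {}"
    using writes_loops by (auto simp: loops_def)
  thus ?thesis by (simp add: scan_def scan_init_def clear_node_def scan_step_def)
qed

lemma writes_copy: "writes (copy a b) = {''i'', ''iw'', ''id'', ''ic'', ''L''}"
  by (auto simp: copy_def copy_step_def)

text \<open>The bound is that of two scans, plus 60 steps per vertex for each of the two copies and
  for the selection, rounded up.\<close>

lemma wp_sink_program:
  assumes P: "path_network P" and g: "2 * Suc (num_vertices P) \<le> 2 ^ g"
  shows "wp sink_program (\<lambda>\<tau> s'. minsum_sink P (rvar s' ''mu'') \<and>
    \<tau> \<le> num_vertices P * (720 * g + 3500) + 500) (input_state P)"
  unfolding sink_program_def wp_Seq
proof -
  let ?n = "num_vertices P" and ?Q = "reversed P" and ?s = "input_state P"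
  let ?S = "?n * (360 * g + 1600) + 160"
  note Q = path_network_reversed[OF P]
  have n1: "1 \<le> ?n" using P by (simp add: path_network_def)
  have nQ: "num_vertices ?Q = ?n" and tauQ: "tau ?Q = tau P" by (simp_all add: reversed_def)
  have s: "nvar ?s ''n'' = ?n" "rvar ?s ''tau'' = tau P"
    "\<And>i. 1 \<le> i \<Longrightarrow> i \<le> ?n \<Longrightarrow> rarr ?s ''w'' i = weight P i"
    "\<And>i. 1 \<le> i \<Longrightarrow> i < ?n \<Longrightarrow> rarr ?s ''d'' i = edge_len P i \<and> rarr ?s ''c'' i = capacity P i"
    by (simp_all add: input_state_def)
  let ?R = "\<lambda>\<tau> s'. minsum_sink P (rvar s' ''mu'') \<and> \<tau> \<le> ?n * (720 * g + 3500) + 500"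
  let ?fwd = "copy (NVar ''i'') (NVar ''i'')"
  let ?bwd = "copy (NSub (NAdd (NVar ''n'') (NConst 1)) (NVar ''i'')) (NSub (NVar ''n'') (NVar ''i''))"
  have keep: "agree x r r'" if "\<forall>x. x \<notin> writes scan \<longrightarrow> agree x r r'" "x \<in> {''n'', ''tau'', ''w'', ''d'', ''c'', ''L''}" for x r r'
  proof -
    have "x \<notin> writes scan" using that(2) writes_scan by blast
    thus ?thesis using that(1) by blast
  qed
  have keep': "agree x r r'" if "\<forall>x. x \<notin> writes (copy a b) \<longrightarrow> agree x r r'" "x \<in> {''n'', ''tau'', ''w'', ''d'', ''c'', ''out''}" for x r r' a b
  proof -
    have "x \<notin> writes (copy a b)" using that(2) by (auto simp: writes_copy)
    thus ?thesis using that(1) by blast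
  qed
  have agree_trans: "agree x r r' \<Longrightarrow> agree x r' r'' \<Longrightarrow> agree x r r''" for x r r' r''
    by (simp add: agree_def)
  have C1: "wp ?fwd (\<lambda>\<tau> s'. (\<forall>j. 1 \<le> j \<and> j \<le> ?n \<longrightarrow>
      rarr s' ''iw'' j = rarr ?s ''w'' j \<and> rarr s' ''id'' j = rarr ?s ''d'' j \<and>
      rarr s' ''ic'' j = rarr ?s ''c'' j \<and> rarr s' ''L'' j = rarr ?s ''out'' j) \<and> \<tau> \<le> 60 * ?n + 20) ?s"
    by (rule wp_copy[OF s(1)]) simp_all
  show "wp ?fwd (\<lambda>t1 s1. wp scan (\<lambda>t2 s2. wp ?bwd (\<lambda>t3 s3.
    wp scan (\<lambda>t4 s4. wp select (\<lambda>t5. ?R (t1 + (t2 + (t3 + (t4 + t5))))) s4) s3) s2) s1) ?s"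
  proof (rule wp_mono[OF wp_agree[OF C1]], elim conjE)
    fix t1 s1
    assume copy1: "\<forall>j. 1 \<le> j \<and> j \<le> ?n \<longrightarrow>
        rarr s1 ''iw'' j = rarr ?s ''w'' j \<and> rarr s1 ''id'' j = rarr ?s ''d'' j \<and>
        rarr s1 ''ic'' j = rarr ?s ''c'' j \<and> rarr s1 ''L'' j = rarr ?s ''out'' j"
      and t1: "t1 \<le> 60 * ?n + 20" and ag1: "\<forall>x. x \<notin> writes ?fwd \<longrightarrow> agree x ?s s1"
    note a1 = keep'[OF ag1]
    have n1: "nvar s1 ''n'' = ?n" "rvar s1 ''tau'' = tau P"
      using a1[of "''n''"] a1[of "''tau''"] s(1,2) by (simp_all add: agree_def)
    have inp1: "inputs P s1"
      unfolding inputs_def using copy1 n1 s(3,4) by (simp add: less_imp_le)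
    show "wp scan (\<lambda>t2 s2. wp ?bwd (\<lambda>t3 s3.
      wp scan (\<lambda>t4 s4. wp select (\<lambda>t5. ?R (t1 + (t2 + (t3 + (t4 + t5))))) s4) s3) s2) s1"
    proof (rule wp_mono[OF wp_agree[OF wp_scan[OF P g inp1]]], elim conjE)
      fix t2 s2
      assume out2: "\<forall>i. 1 \<le> i \<and> i \<le> ?n \<longrightarrow> rarr s2 ''out'' i = left_cost P (pos P i)" and t2: "t2 \<le> ?S"
        and ag2: "\<forall>x. x \<notin> writes scan \<longrightarrow> agree x s1 s2"
      have a2: "agree x ?s s2" if "x \<in> {''n'', ''tau'', ''w'', ''d'', ''c''}" for x
        by (rule agree_trans[OF a1 keep[OF ag2]]) (use that in blast)+
      have n2: "nvar s2 ''n'' = ?n" using a2[of "''n''"] s(1) by (simp add: agree_def)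
      have C2: "wp ?bwd (\<lambda>\<tau> s'. (\<forall>j. 1 \<le> j \<and> j \<le> ?n \<longrightarrow>
          rarr s' ''iw'' j = rarr s2 ''w'' (?n + 1 - j) \<and> rarr s' ''id'' j = rarr s2 ''d'' (?n - j) \<and>
          rarr s' ''ic'' j = rarr s2 ''c'' (?n - j) \<and> rarr s' ''L'' j = rarr s2 ''out'' j) \<and> \<tau> \<le> 60 * ?n + 20) s2"
        by (rule wp_copy[OF n2]) simp_all
      show "wp ?bwd (\<lambda>t3 s3.
        wp scan (\<lambda>t4 s4. wp select (\<lambda>t5. ?R (t1 + (t2 + (t3 + (t4 + t5))))) s4) s3) s2"
      proof (rule wp_mono[OF wp_agree[OF C2]], elim conjE)
        fix t3 s3
        assume copy3: "\<forall>j. 1 \<le> j \<and> j \<le> ?n \<longrightarrow>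
            rarr s3 ''iw'' j = rarr s2 ''w'' (?n + 1 - j) \<and> rarr s3 ''id'' j = rarr s2 ''d'' (?n - j) \<and>
            rarr s3 ''ic'' j = rarr s2 ''c'' (?n - j) \<and> rarr s3 ''L'' j = rarr s2 ''out'' j"
          and t3: "t3 \<le> 60 * ?n + 20" and ag3: "\<forall>x. x \<notin> writes ?bwd \<longrightarrow> agree x s2 s3"
        have a3: "agree x ?s s3" if "x \<in> {''n'', ''tau'', ''w'', ''d'', ''c''}" for x
          by (rule agree_trans[OF a2 keep'[OF ag3]]) (use that in blast)+
        have n3: "nvar s3 ''n'' = ?n" "rvar s3 ''tau'' = tau P"
          using a3[of "''n''"] a3[of "''tau''"] s(1,2) by (simp_all add: agree_def)
        have arr: "rarr s2 ''w'' = rarr ?s ''w''" "rarr s2 ''d'' = rarr ?s ''d''" "rarr s2 ''c'' = rarr ?s ''c''"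
          using a2[of "''w''"] a2[of "''d''"] a2[of "''c''"] by (simp_all add: agree_def)
        have inp3: "inputs ?Q s3"
          unfolding inputs_def nQ tauQ
        proof (intro conjI allI impI n3)
          fix i assume i: "1 \<le> i \<and> i \<le> ?n"
          hence "1 \<le> ?n + 1 - i" "?n + 1 - i \<le> ?n" by auto
          from s(3)[OF this] show "rarr s3 ''iw'' i = weight ?Q i"
            using copy3 i arr by (simp add: reversed_def)
        next
          fix i assume i: "1 \<le> i \<and> i < ?n"
          hence "1 \<le> ?n - i" "?n - i < ?n" by auto
          from s(4)[OF this] show "rarr s3 ''id'' i = edge_len ?Q i" "rarr s3 ''ic'' i = capacity ?Q i"
            using copy3 i arr by (simp_all add: reversed_def)
        qed
        have L3: "rarr s3 ''L'' i = left_cost P (pos P i)" if "1 \<le> i" "i \<le> ?n" for i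
          using copy3 out2 that by simp
        note S = wp_scan[OF Q _ inp3, unfolded nQ, OF g]
        show "wp scan (\<lambda>t4 s4. wp select (\<lambda>t5. ?R (t1 + (t2 + (t3 + (t4 + t5))))) s4) s3"
        proof (rule wp_mono[OF wp_agree[OF S]], elim conjE)
          fix t4 s4
          assume out4: "\<forall>i. 1 \<le> i \<and> i \<le> ?n \<longrightarrow> rarr s4 ''out'' i = left_cost ?Q (pos ?Q i)" and t4: "t4 \<le> ?S"
            and ag4: "\<forall>x. x \<notin> writes scan \<longrightarrow> agree x s3 s4"
          note a4 = keep[OF ag4]
          have e4: "nvar s4 ''n'' = ?n" "rarr s4 ''d'' = rarr ?s ''d''" "rarr s4 ''L'' = rarr s3 ''L''"
            using a4[of "''n''"] a4[of "''d''"] a4[of "''L''"] a3[of "''d''"] n3 by (simp_all add: agree_def)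
          have "wp select (\<lambda>\<tau> s'. minsum_sink P (rvar s' ''mu'') \<and> \<tau> \<le> 60 * ?n + 60) s4"
          proof (rule wp_select[OF P e4(1)])
            show "rarr s4 ''d'' i = edge_len P i" if "1 \<le> i" "i < ?n" for i
              using e4(2) s(4)[OF that] by simp
            show "rarr s4 ''L'' i + rarr s4 ''out'' (Suc ?n - i) = vertex_cost P i" if i: "1 \<le> i" "i \<le> ?n" for i
            proof -
              have "1 \<le> Suc ?n - i \<and> Suc ?n - i \<le> ?n" using i by auto
              thus ?thesis using e4(3) L3[OF i] out4 by (simp add: vertex_cost_def)
            qed
          qed
          thus "wp select (\<lambda>t5. ?R (t1 + (t2 + (t3 + (t4 + t5))))) s4"
            by (rule wp_mono) (use t1 t2 t3 t4 in \<open>auto simp: algebra_simps\<close>)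
        qed
      qed
    qed
  qed
qed

text \<open>A bound on the height of the tree that occurs only in the analysis; the program never
  computes it.\<close>

definition log_bound :: "nat \<Rightarrow> nat" where
  "log_bound n = nat \<lfloor>log 2 (2 * (real n + 1))\<rfloor> + 1"

lemma log_bound: "2 * Suc n \<le> 2 ^ log_bound n"
proof -
  have "log 2 (2 * (real n + 1)) \<ge> 0" by (simp add: zero_le_log_cancel_iff)
  hence "log 2 (2 * (real n + 1)) \<le> real (log_bound n)"
    unfolding log_bound_def by linarith
  hence "2 * (real n + 1) \<le> 2 powr real (log_bound n)"
    by (subst (asm) log_le_iff) auto
  hence "real (2 * Suc n) \<le> real (2 ^ log_bound n)" by (simp add: powr_realpow)
  thus ?thesis by (simp only: of_nat_le_iff)
qed

lemma log_bound_le: "real (log_bound n) \<le> log 2 (2 * (real n + 1)) + 1"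
proof -
  have "log 2 (2 * (real n + 1)) \<ge> 0" by (simp add: zero_le_log_cancel_iff)
  thus ?thesis unfolding log_bound_def by linarith
qed

theorem theorem1:
  shows "\<exists>(prog :: com) (T :: nat \<Rightarrow> nat).
    (\<lambda>n. real (T n)) \<in> O(\<lambda>n. real n * ln (real n)) \<and>
    (\<forall>P. path_network P \<longrightarrow>
      (\<exists>t s. run prog (input_state P) t s \<and> t \<le> T (num_vertices P) \<and> minsum_sink P (rvar s ''mu'')))"
proof (intro exI[of _ sink_program] exI[of _ "\<lambda>n. n * (720 * log_bound n + 3500) + 500"] conjI allI impI)
  \<comment> \<open>The rounding inside \<open>log_bound\<close> is removed first, so that
    \<open>real_asymp\<close> meets only elementary functions.\<close>
  have "(\<lambda>n. real (n * (720 * log_bound n + 3500) + 500))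
      \<in> O(\<lambda>n. real n * (720 * (log 2 (2 * (real n + 1)) + 1) + 3500) + 500)"
  proof (intro bigoI[of _ 1] always_eventually allI)
    fix n
    have "real n * (720 * real (log_bound n) + 3500) \<le> real n * (720 * (log 2 (2 * (real n + 1)) + 1) + 3500)"
      using log_bound_le[of n] by (intro mult_left_mono) auto
    moreover have "0 \<le> real n * (720 * real (log_bound n) + 3500)" by simp
    ultimately show "norm (real (n * (720 * log_bound n + 3500) + 500))
      \<le> 1 * norm (real n * (720 * (log 2 (2 * (real n + 1)) + 1) + 3500) + 500)" by simp
  qed
  also have "(\<lambda>n. real n * (720 * (log 2 (2 * (real n + 1)) + 1) + 3500) + 500) \<in> O(\<lambda>n. real n * ln (real n))"
    unfolding log_def by real_asymp
  finally show "(\<lambda>n. real (n * (720 * log_bound n + 3500) + 500)) \<in> O(\<lambda>n. real n * ln (real n))" .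
  fix P assume "path_network P"
  from wp_sink_program[OF this log_bound]
  show "\<exists>t s. run sink_program (input_state P) t s \<and>
      t \<le> num_vertices P * (720 * log_bound (num_vertices P) + 3500) + 500 \<and> minsum_sink P (rvar s ''mu'')"
    unfolding wp_def by blast
qed

end
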